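(* Let $N$ be the linear marked Hawkes process started from the empty history, with base rate $\nu>0$, exciting function $h:\mathbb{R}^{+}\times\mathbb{X}\to\mathbb{R}^{+}$ and mark law $q$, and let $H(a)=\int_0^\infty h(t,a)\,dt$ (all as described in the context). Assume that $$\lim_{t\to\infty}t^{1/2}\int_t^\infty\mathbb{E}^{q}[h(s,a)]\,ds=0\qquad\text{and}\qquad \int_{\mathbb{X}}H(a)\,q(da)<1.$$ Then $$\frac{N_t-\frac{\nu t}{1-\mathbb{E}^{q}[H(a)]}}{\sqrt{t}}\longrightarrow \mathcal{N}\left(0,\frac{\nu\left(1+\mathrm{Var}^{q}[H(a)]\right)}{\left(1-\mathbb{E}^{q}[H(a)]\right)^{3}}\right)$$ in distribution as $t\to\infty$, where $\mathcal{N}(0,\sigma^2)$ denotes the centered normal law with variance $\sigma^2$.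
   Context: Marked Hawkes process. Let $\mathbb{X}$ be a measurable space, $q$ a probability measure on $\mathbb{X}$, $\nu>0$, and $h:\mathbb{R}^{+}\times\mathbb{X}\to\mathbb{R}^{+}$ measurable with $\int_0^\infty\int_{\mathbb{X}}h(t,a)\,q(da)\,dt<\infty$. The linear marked Hawkes process is a simple point process $N$ with arrival times $0<\tau_1<\tau_2<\cdots$ (no points in $(-\infty,0]$) and marks $a_1,a_2,\dots$ in $\mathbb{X}$ such that: the $a_i$ are i.i.d. with law $q$, $a_i$ being independent of $(\tau_j)_{j\le i}$ and $(a_j)_{j<i}$; and $N$ has, with respect to the filtration $(\mathcal{F}_t)$ generated by the points and their marks up to time $t$, the predictable intensity $$\lambda_t=\nu+\sum_{\tau_i<t}h(t-\tau_i,a_i),$$ i.e. $\mathbb{E}[N(s,u]\,|\,\mathcal{F}_s]=\mathbb{E}[\int_s^u\lambda_r\,dr\,|\,\mathcal{F}_s]$ a.s. for all intervals $(s,u]$. Notation: $N_t:=N(0,t]$, $H(a):=\int_0^\infty h(t,a)\,dt$; $\mathbb{E}^{q}$ and $\mathrm{Var}^{q}$ denote expectation and variance when $a$ has law $q$. *)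

theory Defs
  imports "HOL-Probability.Probability"
begin

definition total_excitation :: "(real \<Rightarrow> 'x \<Rightarrow> real) \<Rightarrow> 'x \<Rightarrow> real" where
  "total_excitation h x = (LINT t:{0..}|lborel. h t x)"

text \<open>The number of points in the interval \<open>(s, u]\<close>.  The arrival times are indexed from 0.\<close>

definition num_points :: "(nat \<Rightarrow> 'w \<Rightarrow> real) \<Rightarrow> real \<Rightarrow> real \<Rightarrow> 'w \<Rightarrow> nat" where
  "num_points \<tau> s u \<omega> = card {i. s < \<tau> i \<omega> \<and> \<tau> i \<omega> \<le> u}"

definition hawkes_intensity ::
  "real \<Rightarrow> (real \<Rightarrow> 'x \<Rightarrow> real) \<Rightarrow> (nat \<Rightarrow> 'w \<Rightarrow> real) \<Rightarrow> (nat \<Rightarrow> 'w \<Rightarrow> 'x) \<Rightarrow> real \<Rightarrow> 'w \<Rightarrow> real" where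
  "hawkes_intensity \<nu> h \<tau> a t \<omega> = \<nu> + (\<Sum>i | \<tau> i \<omega> < t. h (t - \<tau> i \<omega>) (a i \<omega>))"

text \<open>The \<open>\<sigma>\<close>-algebra generated by the points up to time \<open>t\<close> and their marks.  The choice
  \<open>A = space q\<close> gives the events \<open>\<tau> i \<le> s\<close> themselves.\<close>

definition history ::
  "'w measure \<Rightarrow> 'x measure \<Rightarrow> (nat \<Rightarrow> 'w \<Rightarrow> real) \<Rightarrow> (nat \<Rightarrow> 'w \<Rightarrow> 'x) \<Rightarrow> real \<Rightarrow> 'w measure" where
  "history M q \<tau> a t =
     sigma (space M) {{\<omega> \<in> space M. \<tau> i \<omega> \<le> s \<and> a i \<omega> \<in> A} | i s A. s \<le> t \<and> A \<in> sets q}"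

text \<open>The measure \<open>q\<close> carries both the measurable space of marks and the law of the marks; \<open>h\<close> is
  only constrained at nonnegative times.  Independence of a mark from the past
  is independence of generated \<open>\<sigma>\<close>-algebras, because \<open>indep_var\<close> needs both variables to have
  the same type.  The compensator identity is stated with the conditional
  expectation of \<open>[0, \<infinity>]\<close>-valued functions.  Integrability of the number of points is part
  of the requirement because the identity is void where both sides are infinite.\<close>

locale marked_hawkes = prob_space M + mark: prob_space q
  for M :: "'w measure" and q :: "'x measure" +
  fixes \<nu> :: real
    and h :: "real \<Rightarrow> 'x \<Rightarrow> real"
    and \<tau> :: "nat \<Rightarrow> 'w \<Rightarrow> real"
    and a :: "nat \<Rightarrow> 'w \<Rightarrow> 'x"
  assumes base_rate_pos: "\<nu> > 0"
    and h_nonneg: "\<And>t x. t \<ge> 0 \<Longrightarrow> x \<in> space q \<Longrightarrow> h t x \<ge> 0"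
    and h_measurable:
      "(\<lambda>(t, x). h t x) \<in> borel_measurable (restrict_space borel {0..} \<Otimes>\<^sub>M q)"
    and h_integrable: "(\<integral>\<^sup>+t\<in>{0..}. (\<integral>\<^sup>+x. ennreal (h t x) \<partial>q) \<partial>lborel) < \<infinity>"
    and arrival_measurable: "\<And>i. \<tau> i \<in> borel_measurable M"
    and mark_measurable: "\<And>i. a i \<in> measurable M q"
    and arrival_pos: "\<And>i \<omega>. \<omega> \<in> space M \<Longrightarrow> 0 < \<tau> i \<omega>"
    and arrival_strict_mono: "\<And>\<omega>. \<omega> \<in> space M \<Longrightarrow> strict_mono (\<lambda>i. \<tau> i \<omega>)"
    and locally_finite: "\<And>\<omega>. \<omega> \<in> space M \<Longrightarrow> filterlim (\<lambda>i. \<tau> i \<omega>) at_top sequentially"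
    and mark_distr: "\<And>i. distr M q (a i) = q"
    and marks_indep: "indep_vars (\<lambda>_. q) a UNIV"
    and mark_indep_past:
      "\<And>i. indep_set
         (sets (vimage_algebra (space M) (a i) q))
         (sets (vimage_algebra (space M)
            (\<lambda>\<omega>. (\<lambda>j\<in>{..i}. \<tau> j \<omega>, \<lambda>j\<in>{..<i}. a j \<omega>))
            ((\<Pi>\<^sub>M j\<in>{..i}. borel) \<Otimes>\<^sub>M (\<Pi>\<^sub>M j\<in>{..<i}. q))))"
    and count_integrable: "\<And>t. integrable M (\<lambda>\<omega>. real (num_points \<tau> 0 t \<omega>))"
    and compensator: "\<And>s u. 0 \<le> s \<Longrightarrow> s < u \<Longrightarrow>
      AE \<omega> in M.
        nn_cond_exp M (history M q \<tau> a s) (\<lambda>\<omega>. ennreal (real (num_points \<tau> s u \<omega>))) \<omega> =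
        nn_cond_exp M (history M q \<tau> a s)
          (\<lambda>\<omega>. \<integral>\<^sup>+r\<in>{s<..u}. ennreal (hawkes_intensity \<nu> h \<tau> a r \<omega>) \<partial>lborel) \<omega>"
begin

lemma subalgebra_history: "subalgebra M (history M q \<tau> a t)"
proof -
  have [measurable]: "\<And>i. \<tau> i \<in> borel_measurable M" "\<And>i. a i \<in> measurable M q"
    by (fact arrival_measurable mark_measurable)+
  have *: "{{\<omega> \<in> space M. \<tau> i \<omega> \<le> s \<and> a i \<omega> \<in> A} | i s A. s \<le> t \<and> A \<in> sets q} \<subseteq> sets M"
    by (auto intro!: sets.sets_Collect_conj predE)
  have "sigma_sets (space M)
      {{\<omega> \<in> space M. \<tau> i \<omega> \<le> s \<and> a i \<omega> \<in> A} | i s A. s \<le> t \<and> A \<in> sets q} \<subseteq> sets M"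
    using * by (rule sets.sigma_sets_subset)
  moreover have "{{\<omega> \<in> space M. \<tau> i \<omega> \<le> s \<and> a i \<omega> \<in> A} | i s A. s \<le> t \<and> A \<in> sets q}
      \<subseteq> Pow (space M)"
    by auto
  ultimately show ?thesis
    by (simp add: subalgebra_def history_def space_measure_of sets_measure_of)
qed

end

text \<open>The library predicate \<open>weak_conv_m\<close> with the filter \<open>sequentially\<close> replaced by \<open>at_top\<close>
  on the reals.\<close>

definition weak_conv_m_at_top :: "(real \<Rightarrow> real measure) \<Rightarrow> real measure \<Rightarrow> bool" where
  "weak_conv_m_at_top \<mu> \<mu>' \<longleftrightarrow>
     (\<forall>x. isCont (cdf \<mu>') x \<longrightarrow> ((\<lambda>t. cdf (\<mu> t) x) \<longlongrightarrow> cdf \<mu>' x) at_top)"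

end

theory Submission
  imports Defs "HOL-Real_Asymp.Real_Asymp"
begin

text \<open>Let \<open>\<Gamma>\<^sub>n\<close> be the integral of the intensity up to the \<open>n\<close>-th arrival.  By random time change the
  increments of \<open>\<Gamma>\<close> are independent, standard exponential, and independent of the marks, while
  \<open>\<Gamma>\<^sub>n = \<nu> \<tau>\<^sub>n + (\<Sum>i<n. H (a\<^sub>i)) - R\<^sub>n\<close>, where \<open>R\<^sub>n\<close> is the excitation that the first \<open>n\<close> points have left for
  the time after \<open>\<tau>\<^sub>n\<close>.  Thus \<open>\<nu> \<tau>\<^sub>n\<close> exceeds by \<open>R\<^sub>n \<ge> 0\<close> a random walk whose steps, after the first, are i.i.d. with
  mean \<open>1 - E H\<close> and variance \<open>1 + Var H\<close>, and the classical central limit theorem applies to the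
  walk.  Since \<open>N\<^sub>t \<le> n\<close> iff \<open>t < \<tau>\<^sub>n\<close>, this bounds the law of \<open>N\<^sub>t\<close> from one side.  For the other
  side, the walk at index \<open>N\<^sub>t\<close> is at least \<open>\<nu> t\<close> minus the excitation still outstanding at the fixed time
  \<open>t\<close>, whose mean is \<open>o(sqrt t)\<close> by the tail condition, and Ottaviani's inequality replaces the maximum
  of the walk up to \<open>n\<close> by its value at \<open>n\<close>.\<close>

subsection \<open>Random walks adapted to a filtration\<close>

text \<open>The compensator identity is given only for deterministic intervals and events of the
  history at their left end, whereas the time change needs it on the random stretch between two
  arrivals. It is therefore extended to all predictable sets, where it shows that the tail of each
  gap equals its own integral. The two bounds treat the residual excitation differently because of
  where it is measured. At an arrival it sits at a random time, around which the expected number of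
  points is not controlled. At a fixed time a renewal inequality bounds the expected number of
  points in any unit window by \<nu> / (1 - E H), and this combines with the tail condition. The
  price is a walk read at a random index, of which only the upper bound n is kept; the positive
  drift makes the maximum harmless. With c = 1 - E H, the relevant index is about \<nu> t / c + x
  sqrt t. Passing from a deviation of the walk to one of the index divides by c, and the variance of
  the walk there is about (\<nu> t / c) (1 + Var H); hence the cube in the limit variance.\<close>

lemma (in prob_space) indep_vars_adapted:
  fixes X :: "nat \<Rightarrow> 'a \<Rightarrow> real" and F :: "nat \<Rightarrow> 'a measure"
  assumes X: "\<And>n. random_variable borel (X n)"
    and F: "\<And>n. space (F n) = space M"
    and adapted: "\<And>i n. i < n \<Longrightarrow> X i \<in> borel_measurable (F n)"
    and indep: "\<And>n A B. A \<in> sets (F n) \<Longrightarrow> B \<in> sets borel \<Longrightarrow>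
      prob (A \<inter> {\<omega> \<in> space M. X n \<omega> \<in> B}) = prob A * prob {\<omega> \<in> space M. X n \<omega> \<in> B}"
  shows "indep_vars (\<lambda>_. borel) X UNIV"
  unfolding indep_vars_def2
proof (intro conjI ballI X indep_setsI)
  fix i :: nat
  show "{X i -` A \<inter> space M |A. A \<in> sets borel} \<subseteq> events"
    using X[of i] by (auto simp: measurable_sets)
next
  fix A and J :: "nat set"
  assume J: "J \<noteq> {}" "J \<subseteq> UNIV" "finite J"
    and A: "\<forall>j\<in>J. A j \<in> {X j -` A \<inter> space M |A. A \<in> sets borel}"
  \<comment> \<open>The induction adds the largest index last, so that all earlier events lie in
    \<open>F b\<close>. The premise \<open>J \<noteq> {}\<close> stays in the induction because the
    empty intersection is \<open>UNIV\<close>, which need not be an event.\<close>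
  have "J \<noteq> {} \<longrightarrow> prob (\<Inter>j\<in>J. A j) = (\<Prod>j\<in>J. prob (A j))"
    using J(3) A
  proof (induction J rule: finite_linorder_max_induct)
    case (insert b J)
    obtain B where B: "A b = X b -` B \<inter> space M" "B \<in> sets borel"
      using insert.prems by auto
    show ?case
    proof (cases "J = {}")
      case False
      have Aj: "A j \<in> sets (F b)" if "j \<in> J" for j
      proof -
        obtain C where C: "A j = X j -` C \<inter> space M" "C \<in> sets borel"
          using insert.prems \<open>j \<in> J\<close> by auto
        have "X j \<in> borel_measurable (F b)"
          using adapted insert.hyps that by auto
        from measurable_sets[OF this C(2)] show ?thesis
          using C(1) F by simp
      qed
      have "(\<Inter>j\<in>J. A j) \<in> sets (F b)"
        using False insert.hyps Aj by (intro sets.finite_INT) auto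
      from indep[OF this B(2)] have "prob ((\<Inter>j\<in>J. A j) \<inter> A b) = prob (\<Inter>j\<in>J. A j) * prob (A b)"
        using B(1) by (simp add: vimage_def Collect_conj_eq Int_commute)
      then show ?thesis
        using insert False by (auto simp: Int_commute mult.commute)
    qed simp
  qed simp
  then show "prob (\<Inter> (A ` J)) = (\<Prod>j\<in>J. prob (A j))"
    using J by simp
qed

lemma (in prob_space) second_moment_sum_indep:
  fixes X :: "'i \<Rightarrow> 'a \<Rightarrow> real"
  assumes "finite I" "indep_vars (\<lambda>_. borel) X I"
    and "\<And>i. i \<in> I \<Longrightarrow> integrable M (\<lambda>\<omega>. (X i \<omega>)\<^sup>2)"
    and "\<And>i. i \<in> I \<Longrightarrow> expectation (X i) = 0"
    and "\<And>i. i \<in> I \<Longrightarrow> expectation (\<lambda>\<omega>. (X i \<omega>)\<^sup>2) = v"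
  shows "integrable M (\<lambda>\<omega>. (\<Sum>i\<in>I. X i \<omega>)\<^sup>2) \<and>
    expectation (\<lambda>\<omega>. (\<Sum>i\<in>I. X i \<omega>)\<^sup>2) = real (card I) * v"
  using assms
proof (induction I)
  case (insert i I)
  have rv: "random_variable borel (X j)" if "j \<in> insert i I" for j
    using insert.prems(1) that unfolding indep_vars_def by auto
  have IH: "integrable M (\<lambda>\<omega>. (\<Sum>i\<in>I. X i \<omega>)\<^sup>2)"
    "expectation (\<lambda>\<omega>. (\<Sum>i\<in>I. X i \<omega>)\<^sup>2) = real (card I) * v"
    using insert.IH[OF indep_vars_subset[OF insert.prems(1)]] insert.prems by auto
  have int: "integrable M (X j)" if "j \<in> insert i I" for j
    by (rule square_integrable_imp_integrable[OF rv[OF that]]) (use insert.prems(2) that in auto)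
  have intS: "integrable M (\<lambda>\<omega>. \<Sum>i\<in>I. X i \<omega>)"
    using int by (intro Bochner_Integration.integrable_sum) auto
  have iv: "indep_var borel (X i) borel (\<lambda>\<omega>. \<Sum>i\<in>I. X i \<omega>)"
    using insert by (intro indep_vars_sum) auto
  have prod: "integrable M (\<lambda>\<omega>. X i \<omega> * (\<Sum>i\<in>I. X i \<omega>))"
    "expectation (\<lambda>\<omega>. X i \<omega> * (\<Sum>i\<in>I. X i \<omega>)) = 0"
    using indep_var_integrable[OF iv int intS] indep_var_lebesgue_integral[OF iv int intS]
      insert.prems(3) by auto
  have eq: "(\<Sum>j\<in>insert i I. X j \<omega>)\<^sup>2 = (X i \<omega>)\<^sup>2 + 2 * (X i \<omega> * (\<Sum>j\<in>I. X j \<omega>)) + (\<Sum>j\<in>I. X j \<omega>)\<^sup>2" for \<omega>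
    using insert.hyps by (simp add: power2_eq_square algebra_simps)
  show ?case
    unfolding eq using IH prod insert.prems insert.hyps by (simp add: algebra_simps)
qed simp

text \<open>Moments are prescribed for the increments alone: the start \<open>S 0\<close> will be
  \<nu> times the first arrival time, whose law is never computed. \<open>F\<close> may be larger
  than the filtration generated by \<open>S\<close>.\<close>

locale adapted_walk = prob_space M for M :: "'a measure" +
  fixes F :: "nat \<Rightarrow> 'a measure" and S :: "nat \<Rightarrow> 'a \<Rightarrow> real" and c v :: real
  assumes subalg: "\<And>n. subalgebra M (F n)"
    and filtration: "\<And>m n. m \<le> n \<Longrightarrow> sets (F m) \<subseteq> sets (F n)"
    and adapted: "\<And>n. S n \<in> borel_measurable (F n)"
    and increment_indep: "\<And>n A B. A \<in> sets (F n) \<Longrightarrow> B \<in> sets borel \<Longrightarrow>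
      prob (A \<inter> {\<omega> \<in> space M. S (Suc n) \<omega> - S n \<omega> \<in> B}) =
      prob A * prob {\<omega> \<in> space M. S (Suc n) \<omega> - S n \<omega> \<in> B}"
    and square_integrable: "\<And>n. integrable M (\<lambda>\<omega>. (S (Suc n) \<omega> - S n \<omega>)\<^sup>2)"
    and mean: "\<And>n. expectation (\<lambda>\<omega>. S (Suc n) \<omega> - S n \<omega>) = c"
    and var: "\<And>n. variance (\<lambda>\<omega>. S (Suc n) \<omega> - S n \<omega>) = v"
begin

lemma space_F [simp]: "space (F n) = space M"
  using subalg by (simp add: subalgebra_def)

lemma sets_F: "A \<in> sets (F n) \<Longrightarrow> A \<in> events"
  using subalg[of n] by (auto simp: subalgebra_def)

lemma measurable_F_mono: "m \<le> n \<Longrightarrow> f \<in> borel_measurable (F m) \<Longrightarrow> f \<in> borel_measurable (F n)"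
  using filtration[of m n] by (auto simp: measurable_def)

lemma measurable_walk [measurable]: "S n \<in> borel_measurable M"
  by (rule measurable_from_subalg[OF subalg adapted])

lemma increments_indep: "indep_vars (\<lambda>_. borel) (\<lambda>n \<omega>. S (Suc n) \<omega> - S n \<omega>) UNIV"
proof (rule indep_vars_adapted[where F = F])
  show "(\<lambda>\<omega>. S (Suc i) \<omega> - S i \<omega>) \<in> borel_measurable (F n)" if "i < n" for i n
    using that by (intro borel_measurable_diff measurable_F_mono[OF _ adapted]) auto
qed (auto intro: increment_indep)

lemma increment_integrable: "integrable M (\<lambda>\<omega>. S (Suc n) \<omega> - S n \<omega>)"
  by (rule square_integrable_imp_integrable[OF _ square_integrable]) simp

lemma walk_telescope: "k \<le> n \<Longrightarrow> S n \<omega> - S k \<omega> = (\<Sum>i<n - k. S (Suc (k + i)) \<omega> - S (k + i) \<omega>)"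
  using sum_lessThan_telescope[of "\<lambda>i. S (k + i) \<omega>" "n - k"] by simp

lemma increments_second_moment:
  assumes "k \<le> n"
  shows "integrable M (\<lambda>\<omega>. (S n \<omega> - S k \<omega> - real (n - k) * c)\<^sup>2)"
    and "expectation (\<lambda>\<omega>. (S n \<omega> - S k \<omega> - real (n - k) * c)\<^sup>2) = real (n - k) * v"
proof -
  let ?X = "\<lambda>i \<omega>. S (Suc i) \<omega> - S i \<omega> - c"
  have iv: "indep_vars (\<lambda>_. borel) ?X {k..<n}"
    using indep_vars_compose2[OF indep_vars_subset[OF increments_indep], of "{k..<n}" "\<lambda>_ x. x - c" "\<lambda>_. borel"]
    by simp
  have int: "integrable M (\<lambda>\<omega>. (?X i \<omega>)\<^sup>2)" for i
  proof -
    have "(\<lambda>\<omega>. (?X i \<omega>)\<^sup>2) = (\<lambda>\<omega>. (S (Suc i) \<omega> - S i \<omega>)\<^sup>2 - 2 * c * (S (Suc i) \<omega> - S i \<omega>) + c\<^sup>2)"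
      by (rule ext) (simp add: power2_eq_square algebra_simps)
    then show ?thesis
      using square_integrable increment_integrable by simp
  qed
  have "expectation (?X i) = 0" for i
    using increment_integrable[of i] mean[of i]
    by (subst Bochner_Integration.integral_diff) (simp_all add: prob_space)
  moreover have "expectation (\<lambda>\<omega>. (?X i \<omega>)\<^sup>2) = v" for i
    using var[of i] mean[of i] by simp
  moreover have "S n \<omega> - S k \<omega> - real (n - k) * c = (\<Sum>i\<in>{k..<n}. ?X i \<omega>)" for \<omega>
    using assms sum_Suc_diff'[OF assms, of "\<lambda>i. S i \<omega>"]
    by (simp add: sum_subtractf[of "\<lambda>i. S (Suc i) \<omega> - S i \<omega>" "\<lambda>_. c"])
  ultimately show "integrable M (\<lambda>\<omega>. (S n \<omega> - S k \<omega> - real (n - k) * c)\<^sup>2)"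
    and "expectation (\<lambda>\<omega>. (S n \<omega> - S k \<omega> - real (n - k) * c)\<^sup>2) = real (n - k) * v"
    using second_moment_sum_indep[OF _ iv] int by auto
qed

text \<open>Independence of a single step from the past passes to several steps by treating the
  indicator of \<open>A\<close> as one more variable in front of the increments after
  \<open>k\<close>. The extended sequence \<open>W\<close> is again adapted, with the trivial
  \<sigma>-algebra before its first term, so \<open>indep_vars_adapted\<close> applies to
  it.\<close>

lemma past_indep_increment:
  assumes A: "A \<in> sets (F k)" and "k \<le> n" and B: "B \<in> sets borel"
  shows "prob (A \<inter> {\<omega> \<in> space M. S n \<omega> - S k \<omega> \<in> B}) =
    prob A * prob {\<omega> \<in> space M. S n \<omega> - S k \<omega> \<in> B}"
proof -
  define W where "W i = (case i of 0 \<Rightarrow> indicator A | Suc j \<Rightarrow> \<lambda>\<omega>. S (Suc (k + j)) \<omega> - S (k + j) \<omega>)"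
    for i :: nat
  define F' where "F' i = (case i of 0 \<Rightarrow> sigma (space M) {} | Suc j \<Rightarrow> F (k + j))" for i :: nat
  have [measurable]: "A \<in> events" using sets_F[OF A] .
  have "indep_vars (\<lambda>_. borel) W UNIV"
  proof (rule indep_vars_adapted[where F = F'])
    show "random_variable borel (W n)" for n
      by (simp add: W_def split: nat.split)
    show "space (F' n) = space M" for n
      by (simp add: F'_def space_measure_of_conv split: nat.split)
  next
    fix i n :: nat assume "i < n"
    show "W i \<in> borel_measurable (F' n)"
    proof (cases i)
      case 0
      have "A \<in> sets (F (k + (n - 1)))" using A filtration[of k "k + (n - 1)"] by auto
      with 0 \<open>i < n\<close> show ?thesis by (auto simp: W_def F'_def split: nat.split)
    next
      case (Suc j)
      with \<open>i < n\<close> show ?thesis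
        by (auto simp: W_def F'_def split: nat.split
            intro!: borel_measurable_diff measurable_F_mono[OF _ adapted])
    qed
  next
    fix n C and B :: "real set" assume "C \<in> sets (F' n)" "B \<in> sets borel"
    then show "prob (C \<inter> {\<omega> \<in> space M. W n \<omega> \<in> B}) = prob C * prob {\<omega> \<in> space M. W n \<omega> \<in> B}"
      by (cases n) (auto simp: W_def F'_def increment_indep sigma_sets_empty_eq prob_space Int_absorb1)
  qed
  then have "indep_vars (\<lambda>_. borel) W (insert 0 (Suc ` {..<n - k}))"
    by (rule indep_vars_subset) auto
  then have iv: "indep_var borel (W 0) borel (\<lambda>\<omega>. \<Sum>i\<in>Suc ` {..<n - k}. W i \<omega>)"
    by (intro indep_vars_sum) auto
  have W0: "W 0 = indicator A" by (simp add: W_def)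
  have WS: "(\<lambda>\<omega>. \<Sum>i\<in>Suc ` {..<n - k}. W i \<omega>) = (\<lambda>\<omega>. S n \<omega> - S k \<omega>)"
    using walk_telescope[OF \<open>k \<le> n\<close>] by (simp add: sum.reindex W_def)
  have "A \<subseteq> space M" using sets.sets_into_space[OF \<open>A \<in> events\<close>] .
  then have "(indicator A :: _ \<Rightarrow> real) -` {1} \<inter> space M = A"
    by (auto simp: indicator_def)
  moreover have "(\<lambda>x. (indicator A x, S n x - S k x)) -` ({1::real} \<times> B) \<inter> space M =
      A \<inter> {\<omega> \<in> space M. S n \<omega> - S k \<omega> \<in> B}"
    using \<open>A \<subseteq> space M\<close> by (auto simp: indicator_def)
  moreover have "(\<lambda>\<omega>. S n \<omega> - S k \<omega>) -` B \<inter> space M = {\<omega> \<in> space M. S n \<omega> - S k \<omega> \<in> B}"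
    by auto
  ultimately show ?thesis
    using indep_varD[OF iv[unfolded W0 WS], of "{1}" B] B by simp
qed

text \<open>Decompose by the first index \<open>k\<close> at which the walk exceeds
  \<open>y\<close>; this event \<open>A k\<close> lies in \<open>F k\<close>. The remaining
  increment is independent of it and stays above \<open>- d\<close> with probability at least
  \<open>1 - v / (4 * c * d)\<close>, whatever \<open>k\<close> is, and then \<open>S n\<close> is
  still above \<open>y - d\<close>.\<close>

lemma ottaviani:
  assumes "c > 0" "d > 0"
  shows "(1 - v / (4 * c * d)) * prob {\<omega> \<in> space M. \<exists>k\<le>n. S k \<omega> > y} \<le> prob {\<omega> \<in> space M. S n \<omega> > y - d}"
proof -
  define p where "p = 1 - v / (4 * c * d)"
  define A where "A k = {\<omega> \<in> space M. S k \<omega> > y \<and> (\<forall>j<k. S j \<omega> \<le> y)}" for k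
  have v: "v \<ge> 0" using variance_positive[of "\<lambda>\<omega>. S (Suc 0) \<omega> - S 0 \<omega>"] var by simp
  have A_F: "A k \<in> sets (F k)" for k
  proof -
    have [measurable]: "j \<le> k \<Longrightarrow> S j \<in> borel_measurable (F k)" for j
      by (rule measurable_F_mono[OF _ adapted])
    have "A k = {\<omega> \<in> space (F k). S k \<omega> > y} - (\<Union>j<k. {\<omega> \<in> space (F k). S j \<omega> > y})"
      by (auto simp: A_def not_less)
    moreover have "{\<omega> \<in> space (F k). S j \<omega> > y} \<in> sets (F k)" if "j \<le> k" for j
      using that by measurable
    ultimately show ?thesis by (auto intro!: sets.Diff sets.finite_UN)
  qed
  have [measurable]: "A k \<in> events" for k using sets_F[OF A_F] .
  have dev: "p \<le> prob {\<omega> \<in> space M. S n \<omega> - S k \<omega> > - d}" if "k \<le> n" for k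
  proof -
    define j where "j = real (n - k)"
    have j: "j \<ge> 0" by (simp add: j_def)
    have pos: "j * c + d > 0" using j assms by (simp add: add_nonneg_pos)
    have "prob {\<omega> \<in> space M. (S n \<omega> - S k \<omega> - j * c)\<^sup>2 \<ge> (j * c + d)\<^sup>2} \<le> j * v / (j * c + d)\<^sup>2"
      using integral_Markov_inequality_measure[OF increments_second_moment(1)[OF that], of "{}" "(j * c + d)\<^sup>2"]
        pos increments_second_moment(2)[OF that] by (simp add: j_def)
    \<comment> \<open>Chebyshev's bound depends on the number \<open>j\<close> of remaining steps.
      By the inequality of arithmetic and geometric means the drift beats the variance uniformly in
      \<open>j\<close>, which is the origin of the factor 4.\<close>
    moreover have "j * v / (j * c + d)\<^sup>2 \<le> v / (4 * c * d)"
    proof -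
      have "4 * (c * j) * d \<le> (j * c + d)\<^sup>2"
        using sum_squares_bound[of "j * c" d] by (simp add: power2_eq_square algebra_simps)
      from mult_left_mono[OF this v] show ?thesis
        using assms pos by (simp add: divide_simps mult_ac)
    qed
    moreover have "1 - prob {\<omega> \<in> space M. (S n \<omega> - S k \<omega> - j * c)\<^sup>2 \<ge> (j * c + d)\<^sup>2} =
        prob {\<omega> \<in> space M. \<not> (S n \<omega> - S k \<omega> - j * c)\<^sup>2 \<ge> (j * c + d)\<^sup>2}"
      by (rule prob_neg[symmetric]) simp
    moreover have "prob {\<omega> \<in> space M. \<not> (S n \<omega> - S k \<omega> - j * c)\<^sup>2 \<ge> (j * c + d)\<^sup>2} \<le>
        prob {\<omega> \<in> space M. S n \<omega> - S k \<omega> > - d}"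
    proof (intro finite_measure_mono, safe)
      fix \<omega> assume "\<not> (S n \<omega> - S k \<omega> - j * c)\<^sup>2 \<ge> (j * c + d)\<^sup>2"
      then have "\<bar>S n \<omega> - S k \<omega> - j * c\<bar> < j * c + d"
        using pos abs_le_square_iff[of "j * c + d" "S n \<omega> - S k \<omega> - j * c"] by linarith
      then show "- d < S n \<omega> - S k \<omega>" by linarith
    qed simp
    ultimately show ?thesis by (simp add: p_def)
  qed
  have A_disj: "A i \<inter> A j = {}" if "i \<noteq> j" for i j
  proof -
    have "A i \<inter> A j = {}" if "i < j" for i j
      using that by (auto simp: A_def not_le[symmetric])
    with that show ?thesis by (metis Int_commute linorder_neqE_nat)
  qed
  then have disj: "disjoint_family_on (\<lambda>k. A k \<inter> {\<omega> \<in> space M. S n \<omega> - S k \<omega> > - d}) {..n}"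
      "disjoint_family_on A {..n}"
    unfolding disjoint_family_on_def by blast+
  have "{\<omega> \<in> space M. \<exists>k\<le>n. S k \<omega> > y} = (\<Union>k\<le>n. A k)"
  proof safe
    fix \<omega> k assume "\<omega> \<in> space M" "k \<le> n" "S k \<omega> > y"
    define l where "l = (LEAST k. S k \<omega> > y)"
    have "S l \<omega> > y" "l \<le> k" "\<And>j. j < l \<Longrightarrow> \<not> S j \<omega> > y"
      unfolding l_def using \<open>S k \<omega> > y\<close> by (auto intro: LeastI Least_le dest: not_less_Least)
    then show "\<omega> \<in> (\<Union>k\<le>n. A k)"
      using \<open>\<omega> \<in> space M\<close> \<open>k \<le> n\<close> by (auto simp: A_def not_less intro!: bexI[of _ l])
  qed (auto simp: A_def)
  then have "p * prob {\<omega> \<in> space M. \<exists>k\<le>n. S k \<omega> > y} = (\<Sum>k\<le>n. p * prob (A k))"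
    using disj(2) by (simp add: finite_measure_finite_Union sum_distrib_left image_subset_iff)
  also have "\<dots> \<le> (\<Sum>k\<le>n. prob (A k \<inter> {\<omega> \<in> space M. S n \<omega> - S k \<omega> > - d}))"
  proof (rule sum_mono)
    fix k assume "k \<in> {..n}"
    then have "prob (A k \<inter> {\<omega> \<in> space M. S n \<omega> - S k \<omega> > - d}) =
        prob (A k) * prob {\<omega> \<in> space M. S n \<omega> - S k \<omega> > - d}"
      using past_indep_increment[OF A_F, of k n "{- d<..}"] by simp
    then show "p * prob (A k) \<le> prob (A k \<inter> {\<omega> \<in> space M. S n \<omega> - S k \<omega> > - d})"
      using mult_left_mono[OF dev[of k] measure_nonneg[of M "A k"]] \<open>k \<in> {..n}\<close> by (simp add: mult.commute)
  qed
  also have "\<dots> = prob (\<Union>k\<le>n. A k \<inter> {\<omega> \<in> space M. S n \<omega> - S k \<omega> > - d})"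
    using disj(1) by (intro finite_measure_finite_Union[symmetric]) auto
  also have "\<dots> \<le> prob {\<omega> \<in> space M. S n \<omega> > y - d}"
    by (intro finite_measure_mono) (auto simp: A_def)
  finally show ?thesis by (simp add: p_def)
qed

end

subsection \<open>Real functions and sequences\<close>

text \<open>The equation at 0 gives integrability over the half-line. Then \<open>G\<close> is a
  constant minus an indefinite integral, hence continuous, hence differentiable with derivative
  \<open>- G\<close>, so that \<open>G y * exp y\<close> is constant.\<close>

lemma exponential_tail_unique:
  fixes G :: "real \<Rightarrow> real"
  assumes nonneg: "\<And>x. G x \<ge> 0" and [measurable]: "G \<in> borel_measurable borel"
    and eq: "\<And>x. x \<ge> 0 \<Longrightarrow> (\<integral>\<^sup>+y\<in>{x..}. ennreal (G y) \<partial>lborel) = ennreal (G x)"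
    and "x \<ge> 0"
  shows "G x = G 0 * exp (- x)"
proof -
  have int: "set_integrable lborel {0..} G"
    unfolding set_integrable_def
    by (rule integrableI_nonneg) (use eq[of 0] nonneg in
      \<open>auto simp: nn_integral_set_ennreal mult.commute ennreal_less_top intro: le_less_trans\<close>)
  have G: "G y = (LINT z:{y..}|lborel. G z)" if "y \<ge> 0" for y
  proof -
    have "set_integrable lborel {y..} G" using int by (rule set_integrable_subset) (use that in auto)
    then have "(\<integral>\<^sup>+z. ennreal (indicator {y..} z *\<^sub>R G z) \<partial>lborel) = ennreal (LINT z:{y..}|lborel. G z)"
      unfolding set_integrable_def set_lebesgue_integral_def
      by (rule nn_integral_eq_integral) (simp add: nonneg)
    then have "ennreal (G y) = ennreal (LINT z:{y..}|lborel. G z)"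
      using eq[OF that] by (simp add: nn_integral_set_ennreal mult.commute)
    then show ?thesis
      using nonneg by (subst (asm) ennreal_inj) (auto simp: set_lebesgue_integral_def intro!: Bochner_Integration.integral_nonneg)
  qed
  have G_int: "G y = G 0 - integral {0..y} G" and int_on: "G integrable_on {0..y}" if "y \<ge> 0" for y
  proof -
    have i1: "set_integrable lborel {0..<y} G" and i2: "set_integrable lborel {y..} G" and i3: "set_integrable lborel {0..y} G"
      by (rule set_integrable_subset[OF int], use that in auto)+
    have "{0..} = {0..<y} \<union> {y..}" using that by auto
    then have "(LINT z:{0..}|lborel. G z) = (LINT z:{0..<y}|lborel. G z) + (LINT z:{y..}|lborel. G z)"
      using set_integral_Un[OF _ i1 i2] by (metis ivl_disj_int_one(7) ivl_disj_int_two(7) disjoint_iff atLeastLessThan_iff atLeast_iff not_le)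
    moreover have "(LINT z:{0..<y}|lborel. G z) = (LINT z:{0..y}|lborel. G z)"
      unfolding set_lebesgue_integral_def
    proof (rule integral_cong_AE)
      show "AE z in lborel. indicator {0..<y} z *\<^sub>R G z = indicator {0..y} z *\<^sub>R G z"
        using AE_lborel_singleton[of y] by eventually_elim (auto simp: indicator_def)
    qed auto
    moreover have "(LINT z:{0..y}|lborel. G z) = integral {0..y} G"
      by (rule set_borel_integral_eq_integral(2)[OF i3])
    ultimately show "G y = G 0 - integral {0..y} G"
      using G[of 0] G[of y] that by simp
    show "G integrable_on {0..y}"
      by (rule set_borel_integral_eq_integral(1)[OF i3])
  qed
  have cont: "continuous_on {0..x} G"
  proof -
    have "continuous_on {0..x} (\<lambda>y. G 0 - integral {0..y} G)"
      using indefinite_integral_continuous_1[OF int_on[OF \<open>x \<ge> 0\<close>]] by (intro continuous_intros)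
    then show ?thesis by (rule continuous_on_eq) (simp add: G_int[symmetric])
  qed
  have "G y * exp y = G 0" if "y \<in> {0..x}" for y
  proof -
    have deriv: "((\<lambda>y. G y * exp y) has_derivative (\<lambda>h. 0)) (at y within {0..x})" if y: "y \<in> {0..x}" for y
    proof -
      have "((\<lambda>y. integral {0..y} G) has_real_derivative G y) (at y within {0..x})"
        using integral_has_vector_derivative[OF cont y] by (simp add: has_real_derivative_iff_has_vector_derivative)
      then have "((\<lambda>y. G 0 - integral {0..y} G) has_real_derivative - G y) (at y within {0..x})"
        by (auto intro!: derivative_eq_intros)
      then have "(G has_real_derivative - G y) (at y within {0..x})"
        by (rule has_field_derivative_transform_within[OF _ zero_less_one y]) (simp add: G_int[symmetric])
      then have "((\<lambda>y. G y * exp y) has_real_derivative 0) (at y within {0..x})"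
        by (auto intro!: derivative_eq_intros)
      then show ?thesis by (simp add: has_field_derivative_def lambda_zero)
    qed
    obtain c where "\<And>y. y \<in> {0..x} \<Longrightarrow> G y * exp y = c"
      using has_derivative_zero_constant[of "{0..x}" "\<lambda>y. G y * exp y", OF _ deriv] by auto
    from this[of y] this[of 0] that show ?thesis by auto
  qed
  from this[of x] \<open>x \<ge> 0\<close> show ?thesis by (simp add: exp_minus field_simps)
qed

text \<open>Monotonicity replaces uniform convergence: the moving argument is trapped by a fixed
  point on either side of \<open>w\<close>, chosen so close that continuity of \<open>f\<close>
  controls the limit there.\<close>

lemma tendsto_mono_functions_moving:
  fixes F :: "'n \<Rightarrow> real \<Rightarrow> real" and z :: "'t \<Rightarrow> real"
  assumes mono: "\<And>n. mono (F n)" and lim: "\<And>x. ((\<lambda>n. F n x) \<longlongrightarrow> f x) N"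
    and cont: "isCont f w" and z: "(z \<longlongrightarrow> w) T" and n: "filterlim n N T"
  shows "((\<lambda>t. F (n t) (z t)) \<longlongrightarrow> f w) T"
proof (rule order_tendstoI)
  have f: "(f \<longlongrightarrow> f w) (at w)" using cont by (simp add: isCont_def)
  have lim': "((\<lambda>t. F (n t) x) \<longlongrightarrow> f x) T" for x
    by (rule filterlim_compose[OF lim n])
  fix a assume "a < f w"
  then have "eventually (\<lambda>x. a < f x) (at_left w)"
    using order_tendstoD(1)[OF f] eventually_at_split by blast
  then obtain x where x: "x < w" "a < f x"
    by (metis (mono_tags, lifting) dense eventually_at_left_field)
  show "eventually (\<lambda>t. a < F (n t) (z t)) T"
    using order_tendstoD(1)[OF lim' x(2)] order_tendstoD(1)[OF z x(1)]
  proof eventually_elim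
    case (elim t)
    then show ?case using monoD[OF mono, of x "z t" "n t"] by linarith
  qed
next
  have f: "(f \<longlongrightarrow> f w) (at w)" using cont by (simp add: isCont_def)
  have lim': "((\<lambda>t. F (n t) x) \<longlongrightarrow> f x) T" for x
    by (rule filterlim_compose[OF lim n])
  fix a assume "f w < a"
  then have "eventually (\<lambda>x. f x < a) (at_right w)"
    using order_tendstoD(2)[OF f] eventually_at_split by blast
  then obtain x where x: "w < x" "f x < a"
    by (metis (mono_tags, lifting) dense eventually_at_right_field)
  show "eventually (\<lambda>t. F (n t) (z t) < a) T"
    using order_tendstoD(2)[OF lim' x(2)] order_tendstoD(2)[OF z x(1)]
  proof eventually_elim
    case (elim t)
    then show ?case using monoD[OF mono, of "z t" x "n t"] by linarith
  qed
qed

lemma sum_inverse_sqrt_le: "(\<Sum>k<n. 1 / sqrt (real (Suc k))) \<le> 2 * sqrt (real n)"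
proof (induction n)
  case (Suc n)
  have "0 \<le> (sqrt (real (Suc n)) - sqrt (real n))\<^sup>2" by simp
  then have "2 * sqrt (real n) * sqrt (real (Suc n)) + 1 \<le> 2 * real (Suc n)"
    by (simp add: power2_diff mult_ac)
  then have "2 * sqrt (real n) + 1 / sqrt (real (Suc n)) \<le> 2 * sqrt (real (Suc n))"
    by (simp add: field_simps)
  with Suc show ?case by simp
qed simp

text \<open>Beyond some index the terms are below a small multiple of \<open>1 / sqrt k\<close>,
  whose partial sums grow like \<open>sqrt n\<close>; the remaining terms are finitely many and
  vanish after division. The tail condition of the theorem enters through this lemma, with
  \<open>f\<close> the mean tail at integer times.\<close>

lemma sum_o_sqrt:
  fixes f :: "nat \<Rightarrow> real"
  assumes nonneg: "\<And>k. f k \<ge> 0" and lim: "(\<lambda>k. sqrt (real k) * f k) \<longlonglongrightarrow> 0"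
  shows "(\<lambda>n. (\<Sum>k<n. f k) / sqrt (real n)) \<longlonglongrightarrow> 0"
proof (rule LIMSEQ_I)
  fix r :: real assume "r > 0"
  \<comment> \<open>Replacing \<open>k\<close> by \<open>Suc k\<close> under the root, which avoids
    a division by 0, costs at most a factor 2 and turns r / 8 into r / 4;
    \<open>sum_inverse_sqrt_le\<close> doubles this to r / 2. The early terms receive another r /
    4.\<close>
  obtain N where N: "\<And>k. k \<ge> N \<Longrightarrow> norm (sqrt (real k) * f k - 0) < r / 8"
    using LIMSEQ_D[OF lim, of "r / 8"] \<open>r > 0\<close> by auto
  define C where "C = (\<Sum>k\<le>N. f k)"
  have bound: "f k \<le> (if k \<le> N then f k else 0) + r / 4 * (1 / sqrt (real (Suc k)))" for k
  proof (cases "k \<le> N")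
    case True then show ?thesis using \<open>r > 0\<close> by simp
  next
    case False
    then have k: "k \<ge> 1" "k \<ge> N" by auto
    have "sqrt (real (Suc k)) \<le> sqrt (4 * real k)" using k by (intro real_sqrt_le_mono) simp
    then have "sqrt (real (Suc k)) * f k \<le> 2 * (sqrt (real k) * f k)"
      using mult_right_mono[OF _ nonneg[of k]] by (fastforce simp: real_sqrt_mult)
    also have "\<dots> \<le> r / 4" using N[OF k(2)] nonneg[of k] by simp
    finally show ?thesis using False by (simp add: field_simps)
  qed
  obtain N' where N': "\<And>n. n \<ge> N' \<Longrightarrow> n > 0 \<and> C / sqrt (real n) < r / 4"
  proof -
    have "((\<lambda>n. C / sqrt (real n)) \<longlongrightarrow> 0) sequentially"
      by (intro tendsto_divide_0[OF tendsto_const] filterlim_at_top_imp_at_infinity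
          filterlim_compose[OF sqrt_at_top] filterlim_real_sequentially)
    then have "eventually (\<lambda>n. C / sqrt (real n) < r / 4) sequentially"
      using \<open>r > 0\<close> by (intro order_tendstoD(2)[where y = 0]) auto
    from eventually_conj[OF eventually_gt_at_top[of 0] this] show ?thesis
      using that unfolding eventually_sequentially by auto
  qed
  show "\<exists>no. \<forall>n\<ge>no. norm ((\<Sum>k<n. f k) / sqrt (real n) - 0) < r"
  proof (intro exI allI impI)
    fix n assume "n \<ge> N'"
    then have n: "n > 0" "C / sqrt (real n) < r / 4" using N' by auto
    have "(\<Sum>k<n. f k) \<le> (\<Sum>k<n. (if k \<le> N then f k else 0) + r / 4 * (1 / sqrt (real (Suc k))))"
      by (intro sum_mono bound)
    also have "\<dots> = (\<Sum>k<n. if k \<le> N then f k else 0) + r / 4 * (\<Sum>k<n. 1 / sqrt (real (Suc k)))"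
      by (simp add: sum.distrib sum_distrib_left)
    also have "(\<Sum>k<n. if k \<le> N then f k else 0) \<le> C"
      unfolding C_def sum.If_cases[OF finite_lessThan]
      by (simp, intro sum_mono2) (auto simp: nonneg)
    also have "r / 4 * (\<Sum>k<n. 1 / sqrt (real (Suc k))) \<le> r / 4 * (2 * sqrt (real n))"
      using sum_inverse_sqrt_le[of n] \<open>r > 0\<close> by (intro mult_left_mono) auto
    finally have "(\<Sum>k<n. f k) / sqrt (real n) \<le> C / sqrt (real n) + r / 2"
      using n by (simp add: field_simps)
    moreover have "(\<Sum>k<n. f k) / sqrt (real n) \<ge> 0"
      using nonneg by (simp add: sum_nonneg)
    ultimately show "norm ((\<Sum>k<n. f k) / sqrt (real n) - 0) < r"
      using n(2) \<open>r > 0\<close> unfolding real_norm_def by linarith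
  qed
qed

subsection \<open>The excitation kernel\<close>

context marked_hawkes
begin

text \<open>As \<open>h\<close> is measurable only on nonnegative times, clipping the time at 0 is
  what makes it composable with arbitrary measurable maps.\<close>

lemma measurable_excitation_max:
  assumes [measurable]: "f \<in> borel_measurable N" and [measurable]: "g \<in> measurable N q"
  shows "(\<lambda>z. h (max 0 (f z)) (g z)) \<in> borel_measurable N"
proof -
  have "(\<lambda>z. (max 0 (f z), g z)) \<in> measurable N (restrict_space borel {0..} \<Otimes>\<^sub>M q)"
    by (intro measurable_Pair measurable_restrict_space2) auto
  from measurable_compose[OF this h_measurable] show ?thesis by simp
qed

lemma measurable_nn_excitation [measurable]:
  "(\<lambda>x. \<integral>\<^sup>+s\<in>{0..}. ennreal (h s x) \<partial>lborel) \<in> borel_measurable q"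
proof -
  have [measurable]: "(\<lambda>z. h (max 0 (snd z)) (fst z)) \<in> borel_measurable (q \<Otimes>\<^sub>M lborel)"
    by (rule measurable_excitation_max) auto
  have "(\<lambda>x. \<integral>\<^sup>+s. ennreal (h (max 0 s) x) * indicator {0..} s \<partial>lborel) \<in> borel_measurable q"
    by measurable
  also have "(\<lambda>x. \<integral>\<^sup>+s. ennreal (h (max 0 s) x) * indicator {0..} s \<partial>lborel) =
      (\<lambda>x. \<integral>\<^sup>+s\<in>{0..}. ennreal (h s x) \<partial>lborel)"
    by (auto intro!: ext nn_integral_cong simp: indicator_def max_def)
  finally show ?thesis .
qed

lemma AE_excitation_finite: "AE x in q. (\<integral>\<^sup>+s\<in>{0..}. ennreal (h s x) \<partial>lborel) < \<infinity>"
proof -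
  interpret P: pair_sigma_finite lborel q ..
  have [measurable]: "(\<lambda>z. h (max 0 (fst z)) (snd z)) \<in> borel_measurable (lborel \<Otimes>\<^sub>M q)"
    by (rule measurable_excitation_max) auto
  have "(\<integral>\<^sup>+x. (\<integral>\<^sup>+s\<in>{0..}. ennreal (h s x) \<partial>lborel) \<partial>q) =
      (\<integral>\<^sup>+x. (\<integral>\<^sup>+s. ennreal (h (max 0 s) x) * indicator {0..} s \<partial>lborel) \<partial>q)"
    by (intro nn_integral_cong) (auto simp: indicator_def max_def)
  also have "\<dots> = (\<integral>\<^sup>+s. (\<integral>\<^sup>+x. ennreal (h (max 0 s) x) * indicator {0..} s \<partial>q) \<partial>lborel)"
    using P.Fubini[of "\<lambda>z. ennreal (h (max 0 (fst z)) (snd z)) * indicator {0..} (fst z)"] by simp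
  also have "\<dots> = (\<integral>\<^sup>+s\<in>{0..}. (\<integral>\<^sup>+x. ennreal (h s x) \<partial>q) \<partial>lborel)"
    by (intro nn_integral_cong) (auto simp: indicator_def max_def)
  also have "\<dots> < \<infinity>" by (rule h_integrable)
  finally show ?thesis
    using nn_integral_noteq_infinite[OF measurable_nn_excitation]
    by (auto simp: less_top)
qed

text \<open>A version of \<open>h\<close> that is integrable in time for every mark, not only for almost every one, and vanishes
  at times \<open>t \<le> 0\<close>, so that sums over the past of a time \<open>r\<close> become sums over all arrivals.\<close>

definition kern :: "real \<Rightarrow> 'x \<Rightarrow> real" where
  "kern t x =
    (if 0 < t \<and> x \<in> space q \<and> (\<integral>\<^sup>+s\<in>{0..}. ennreal (h s x) \<partial>lborel) < \<infinity> then h t x else 0)"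

definition kern_mass :: "'x \<Rightarrow> real" where
  "kern_mass x = (LINT s|lborel. kern s x)"

definition kern_upto :: "real \<Rightarrow> 'x \<Rightarrow> real" where
  "kern_upto u x = (LINT s:{..u}|lborel. kern s x)"

lemma kern_nonneg [simp]: "kern t x \<ge> 0"
  by (simp add: kern_def h_nonneg)

lemma kern_nonpos_time [simp]: "t \<le> 0 \<Longrightarrow> kern t x = 0"
  by (simp add: kern_def)

lemma measurable_kern [measurable (raw)]:
  assumes [measurable]: "f \<in> borel_measurable N" and g[measurable]: "g \<in> measurable N q"
  shows "(\<lambda>z. kern (f z) (g z)) \<in> borel_measurable N"
proof -
  have [measurable]: "(\<lambda>z. h (max 0 (f z)) (g z)) \<in> borel_measurable N"
    by (rule measurable_excitation_max) auto
  have [measurable]: "(\<lambda>z. \<integral>\<^sup>+s\<in>{0..}. ennreal (h s (g z)) \<partial>lborel) \<in> borel_measurable N"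
    by (rule measurable_compose[OF g measurable_nn_excitation])
  have "(\<lambda>z. if 0 < f z \<and> (\<integral>\<^sup>+s\<in>{0..}. ennreal (h s (g z)) \<partial>lborel) < \<infinity>
      then h (max 0 (f z)) (g z) else 0) \<in> borel_measurable N"
    by measurable
  then show ?thesis
    by (rule measurable_cong[THEN iffD1, rotated])
       (auto simp: kern_def max_def measurable_space[OF g])
qed

lemma measurable_kern_time [measurable]: "(\<lambda>s. kern s x) \<in> borel_measurable borel"
proof (cases "x \<in> space q")
  case False then show ?thesis by (simp add: kern_def)
qed measurable

lemma nn_kern_finite: "(\<integral>\<^sup>+s. ennreal (kern s x) \<partial>lborel) < \<infinity>"
proof (cases "x \<in> space q \<and> (\<integral>\<^sup>+s\<in>{0..}. ennreal (h s x) \<partial>lborel) < \<infinity>")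
  case True
  have "(\<integral>\<^sup>+s. ennreal (kern s x) \<partial>lborel) \<le> (\<integral>\<^sup>+s\<in>{0..}. ennreal (h s x) \<partial>lborel)"
    by (intro nn_integral_mono) (auto simp: kern_def indicator_def)
  with True show ?thesis by (auto intro: le_less_trans)
qed (auto simp: kern_def)

lemma kern_integrable: "integrable lborel (\<lambda>s. kern s x)"
  using nn_kern_finite[of x] by (intro integrableI_nonneg) auto

lemma kern_set_integrable: "A \<in> sets borel \<Longrightarrow> set_integrable lborel A (\<lambda>s. kern s x)"
  unfolding set_integrable_def by (intro integrable_mult_indicator kern_integrable) auto

text \<open>This holds at every mark, not merely almost everywhere: where \<open>h\<close> fails to
  be integrable in time, the Bochner integral in \<open>total_excitation\<close> takes its default
  value 0, and \<open>kern\<close> has been set to 0.\<close>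

lemma total_excitation_eq: "x \<in> space q \<Longrightarrow> total_excitation h x = kern_mass x"
proof (cases "(\<integral>\<^sup>+s\<in>{0..}. ennreal (h s x) \<partial>lborel) < \<infinity>")
  assume x: "x \<in> space q"
  then have [measurable]: "(\<lambda>s. h (max 0 s) x) \<in> borel_measurable borel"
    by (intro measurable_excitation_max) auto
  have eq: "indicator {0..} s *\<^sub>R h s x = indicator {0..} s *\<^sub>R h (max 0 s) x" for s
    by (auto simp: indicator_def max_def)
  {
    case True
    then show ?thesis
      unfolding total_excitation_def kern_mass_def set_lebesgue_integral_def eq
    proof (intro integral_cong_AE)
      \<comment> \<open>\<open>kern\<close> drops time 0, which \<open>{0..}\<close> contains; this
        is a null set.\<close>
      show "AE s in lborel. indicator {0..} s *\<^sub>R h (max 0 s) x = kern s x"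
        using AE_lborel_singleton[of 0] by eventually_elim (use x True in \<open>auto simp: indicator_def kern_def\<close>)
    qed auto
  next
    case False
    have "\<not> integrable lborel (\<lambda>s. indicator {0..} s *\<^sub>R h s x)"
    proof
      assume "integrable lborel (\<lambda>s. indicator {0..} s *\<^sub>R h s x)"
      then have "(\<integral>\<^sup>+s. ennreal (norm (indicator {0..} s *\<^sub>R h s x)) \<partial>lborel) < \<infinity>"
        by (simp add: integrable_iff_bounded)
      also have "(\<integral>\<^sup>+s. ennreal (norm (indicator {0..} s *\<^sub>R h s x)) \<partial>lborel) =
          (\<integral>\<^sup>+s\<in>{0..}. ennreal (h s x) \<partial>lborel)"
        using x by (intro nn_integral_cong) (auto simp: indicator_def h_nonneg)
      finally show False using False by simp
    qed
    then have "total_excitation h x = 0"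
      unfolding total_excitation_def set_lebesgue_integral_def by (rule not_integrable_integral_eq)
    moreover have "kern_mass x = 0" using False by (simp add: kern_mass_def kern_def)
    ultimately show ?thesis by simp
  }
qed

lemma nn_kern_set: "A \<in> sets borel \<Longrightarrow>
    (\<integral>\<^sup>+s\<in>A. ennreal (kern s x) \<partial>lborel) = ennreal (LINT s:A|lborel. kern s x)"
proof -
  assume A: "A \<in> sets borel"
  have "(\<integral>\<^sup>+s\<in>A. ennreal (kern s x) \<partial>lborel) = (\<integral>\<^sup>+s. ennreal (indicator A s *\<^sub>R kern s x) \<partial>lborel)"
    by (intro nn_integral_cong) (auto simp: indicator_def)
  also have "\<dots> = ennreal (LINT s:A|lborel. kern s x)"
    unfolding set_lebesgue_integral_def
    using kern_set_integrable[OF A, of x, unfolded set_integrable_def]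
    by (rule nn_integral_eq_integral) simp
  finally show ?thesis .
qed

lemma nn_kern_mass: "(\<integral>\<^sup>+s. ennreal (kern s x) \<partial>lborel) = ennreal (kern_mass x)"
  unfolding kern_mass_def by (rule nn_integral_eq_integral[OF kern_integrable]) simp

lemma kern_mass_nonneg [simp]: "kern_mass x \<ge> 0"
  by (simp add: kern_mass_def)

lemma kern_upto_nonneg [simp]: "kern_upto u x \<ge> 0"
  by (simp add: kern_upto_def set_lebesgue_integral_def)

lemma kern_upto_diff:
  assumes "u \<le> v"
  shows "kern_upto v x - kern_upto u x = (LINT s:{u<..v}|lborel. kern s x)"
proof -
  have "{..v} = {..u} \<union> {u<..v}" "{..u} \<inter> {u<..v} = {}" using assms by auto
  then show ?thesis
    unfolding kern_upto_def
    using set_integral_Un[OF _ kern_set_integrable[of "{..u}" x] kern_set_integrable[of "{u<..v}" x]]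
    by simp
qed

lemma kern_upto_mono: "u \<le> v \<Longrightarrow> kern_upto u x \<le> kern_upto v x"
  using kern_upto_diff[of u v x]
  by (smt (verit) set_lebesgue_integral_def Bochner_Integration.integral_nonneg kern_nonneg scaleR_nonneg_nonneg indicator_pos_le)

lemma kern_upto_nonpos [simp]: "u \<le> 0 \<Longrightarrow> kern_upto u x = 0"
proof -
  assume "u \<le> 0"
  then have "(\<lambda>s. indicat_real {..u} s *\<^sub>R kern s x) = (\<lambda>s. 0)"
    by (auto simp: indicator_def)
  then show ?thesis by (simp add: kern_upto_def set_lebesgue_integral_def)
qed

lemma kern_tail: "(LINT s:{u<..}|lborel. kern s x) = kern_mass x - kern_upto u x"
proof -
  have "{..u} \<union> {u<..} = UNIV" "{..u} \<inter> {u<..} = {}" by auto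
  then have "(LINT s:UNIV|lborel. kern s x) = kern_upto u x + (LINT s:{u<..}|lborel. kern s x)"
    unfolding kern_upto_def
    using set_integral_Un[OF _ kern_set_integrable[of "{..u}" x] kern_set_integrable[of "{u<..}" x]]
    by simp
  then show ?thesis by (simp add: kern_mass_def set_lebesgue_integral_def)
qed

lemma kern_upto_le_mass: "kern_upto u x \<le> kern_mass x"
  using kern_tail[of u x]
  by (smt (verit) set_lebesgue_integral_def Bochner_Integration.integral_nonneg kern_nonneg scaleR_nonneg_nonneg indicator_pos_le)

lemma measurable_kern_upto [measurable (raw)]:
  assumes [measurable]: "f \<in> borel_measurable N" "g \<in> measurable N q"
  shows "(\<lambda>z. kern_upto (f z) (g z)) \<in> borel_measurable N"
proof -
  have "kern_upto (f z) (g z) = (LINT s|lborel. (if s \<le> f z then kern s (g z) else 0))" for z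
    unfolding kern_upto_def set_lebesgue_integral_def
    by (rule Bochner_Integration.integral_cong) auto
  then show ?thesis by simp
qed

lemma measurable_kern_mass [measurable]: "kern_mass \<in> borel_measurable q"
  unfolding kern_mass_def by measurable

lemma kern_upto_continuous: "continuous_on UNIV (\<lambda>u. kern_upto u x)"
  unfolding continuous_on_sequentially comp_def
proof safe
  fix u :: "nat \<Rightarrow> real" and w assume u: "u \<longlonglongrightarrow> w"
  show "(\<lambda>n. kern_upto (u n) x) \<longlonglongrightarrow> kern_upto w x"
    unfolding kern_upto_def set_lebesgue_integral_def
  proof (rule integral_dominated_convergence[where w = "\<lambda>s. kern s x"])
    show "AE s in lborel. (\<lambda>n. indicator {..u n} s *\<^sub>R kern s x) \<longlonglongrightarrow> indicator {..w} s *\<^sub>R kern s x"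
      using AE_lborel_singleton[of w]
    proof eventually_elim
      case (elim s)
      have "eventually (\<lambda>n. indicator {..u n} s *\<^sub>R kern s x = indicator {..w} s *\<^sub>R kern s x) sequentially"
      proof (cases "s < w")
        case True
        from order_tendstoD(1)[OF u this] show ?thesis
          by eventually_elim (use True in auto)
      next
        case False
        with elim have "w < s" by auto
        from order_tendstoD(2)[OF u this] show ?thesis
          by eventually_elim (use \<open>w < s\<close> in auto)
      qed
      then show ?case by (rule tendsto_eventually)
    qed
  qed (auto simp: kern_integrable indicator_def)
qed


subsection \<open>The compensator formula on predictable sets\<close>

declare arrival_measurable [measurable] mark_measurable [measurable]

lemma finite_arrivals: "\<omega> \<in> space M \<Longrightarrow> finite {i. \<tau> i \<omega> \<le> u}"
proof -
  assume "\<omega> \<in> space M"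
  then have "eventually (\<lambda>i. u < \<tau> i \<omega>) sequentially"
    using locally_finite by (auto simp: filterlim_at_top_dense)
  then obtain N where "\<And>i. i \<ge> N \<Longrightarrow> u < \<tau> i \<omega>" by (auto simp: eventually_sequentially)
  then have "{i. \<tau> i \<omega> \<le> u} \<subseteq> {..<N}" by (auto simp: not_le[symmetric] intro: leI)
  then show ?thesis by (rule finite_subset) simp
qed

lemma arrival_less_iff: "\<omega> \<in> space M \<Longrightarrow> \<tau> i \<omega> < \<tau> j \<omega> \<longleftrightarrow> i < j"
  by (rule strict_mono_less[OF arrival_strict_mono])

lemma arrival_le_iff: "\<omega> \<in> space M \<Longrightarrow> \<tau> i \<omega> \<le> \<tau> j \<omega> \<longleftrightarrow> i \<le> j"
  by (rule strict_mono_less_eq[OF arrival_strict_mono])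

lemma num_points_suminf:
  assumes "\<omega> \<in> space M"
  shows "ennreal (real (num_points \<tau> s u \<omega>)) = (\<Sum>i. indicator {s<..u} (\<tau> i \<omega>))"
proof -
  have fin: "finite {i. s < \<tau> i \<omega> \<and> \<tau> i \<omega> \<le> u}"
    by (rule finite_subset[OF _ finite_arrivals[OF assms, of u]]) auto
  have "(\<Sum>i. indicator {s<..u} (\<tau> i \<omega>)) = (\<Sum>i\<in>{i. s < \<tau> i \<omega> \<and> \<tau> i \<omega> \<le> u}. (1::ennreal))"
    by (subst suminf_finite[OF fin]) (auto simp: indicator_def)
  then show ?thesis by (simp add: num_points_def ennreal_of_nat_eq_real_of_nat)
qed

text \<open>The intensity with values in \<open>[0, \<infinity>]\<close>, so that sums and integrals
  can be exchanged without integrability conditions. The series may run over all arrivals because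
  \<open>kern\<close> ignores those at or after time \<open>r\<close>.\<close>

definition rate :: "real \<Rightarrow> 'w \<Rightarrow> ennreal" where
  "rate r \<omega> = ennreal \<nu> + (\<Sum>i. ennreal (kern (r - \<tau> i \<omega>) (a i \<omega>)))"

lemma measurable_rate [measurable (raw)]:
  assumes [measurable]: "f \<in> borel_measurable N" "g \<in> measurable N M"
  shows "(\<lambda>z. rate (f z) (g z)) \<in> borel_measurable N"
proof -
  have [measurable]: "(\<lambda>z. \<tau> i (g z)) \<in> borel_measurable N" "(\<lambda>z. a i (g z)) \<in> measurable N q" for i
    by (rule measurable_compose[OF assms(2)], simp)+
  show ?thesis unfolding rate_def by measurable
qed

text \<open>A sum over the random set of earlier arrivals is not visibly measurable; a series over
  all indices with clipped times is.\<close>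

lemma hawkes_intensity_suminf:
  assumes "\<omega> \<in> space M"
  shows "hawkes_intensity \<nu> h \<tau> a r \<omega> =
    \<nu> + (\<Sum>i. if \<tau> i \<omega> < r then h (max 0 (r - \<tau> i \<omega>)) (a i \<omega>) else 0)"
proof -
  have "finite {i. \<tau> i \<omega> < r}"
    by (rule finite_subset[OF _ finite_arrivals[OF assms, of r]]) auto
  then have "(\<Sum>i. if \<tau> i \<omega> < r then h (max 0 (r - \<tau> i \<omega>)) (a i \<omega>) else 0) =
      (\<Sum>i\<in>{i. \<tau> i \<omega> < r}. if \<tau> i \<omega> < r then h (max 0 (r - \<tau> i \<omega>)) (a i \<omega>) else 0)"
    by (intro suminf_finite) auto
  also have "\<dots> = (\<Sum>i | \<tau> i \<omega> < r. h (r - \<tau> i \<omega>) (a i \<omega>))"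
    by (intro sum.cong) auto
  finally show ?thesis by (simp add: hawkes_intensity_def)
qed

lemma measurable_nn_intensity [measurable]:
  "(\<lambda>\<omega>. \<integral>\<^sup>+r\<in>{s<..u}. ennreal (hawkes_intensity \<nu> h \<tau> a r \<omega>) \<partial>lborel) \<in> borel_measurable M"
proof -
  have [measurable]: "(\<lambda>z. h (max 0 (snd z - \<tau> i (fst z))) (a i (fst z))) \<in> borel_measurable (M \<Otimes>\<^sub>M lborel)" for i
    by (rule measurable_excitation_max) measurable
  have "(\<lambda>\<omega>. \<integral>\<^sup>+r\<in>{s<..u}. ennreal (\<nu> + (\<Sum>i. if \<tau> i \<omega> < r then h (max 0 (r - \<tau> i \<omega>)) (a i \<omega>) else 0)) \<partial>lborel)
      \<in> borel_measurable M"
    by measurable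
  then show ?thesis
    by (rule measurable_cong[THEN iffD1, rotated]) (simp add: hawkes_intensity_suminf)
qed

lemma AE_marks_regular: "AE \<omega> in M. \<forall>i. (\<integral>\<^sup>+s\<in>{0..}. ennreal (h s (a i \<omega>)) \<partial>lborel) < \<infinity>"
proof (subst AE_all_countable, rule allI)
  fix i
  have "AE x in distr M q (a i). (\<integral>\<^sup>+s\<in>{0..}. ennreal (h s x) \<partial>lborel) < \<infinity>"
    unfolding mark_distr by (rule AE_excitation_finite)
  then show "AE \<omega> in M. (\<integral>\<^sup>+s\<in>{0..}. ennreal (h s (a i \<omega>)) \<partial>lborel) < \<infinity>"
    by (subst (asm) AE_distr_iff) auto
qed

text \<open>One null set serves all times \<open>r\<close>, since the exceptional event concerns
  only the marks.\<close>

lemma AE_intensity_eq_rate: "AE \<omega> in M. \<forall>r. ennreal (hawkes_intensity \<nu> h \<tau> a r \<omega>) = rate r \<omega>"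
  using AE_marks_regular AE_space
proof eventually_elim
  case (elim \<omega>)
  show ?case
  proof
    fix r
    have a: "a i \<omega> \<in> space q" for i using elim(2) measurable_space[OF mark_measurable] by blast
    have fin: "finite {i. \<tau> i \<omega> < r}"
      by (rule finite_subset[OF _ finite_arrivals[OF elim(2), of r]]) auto
    have "(\<Sum>i. ennreal (kern (r - \<tau> i \<omega>) (a i \<omega>))) =
        (\<Sum>i | \<tau> i \<omega> < r. ennreal (kern (r - \<tau> i \<omega>) (a i \<omega>)))"
      using fin by (intro suminf_finite) auto
    also have "\<dots> = (\<Sum>i | \<tau> i \<omega> < r. ennreal (h (r - \<tau> i \<omega>) (a i \<omega>)))"
      using elim(1) a by (intro sum.cong) (auto simp: kern_def)
    also have "\<dots> = ennreal (\<Sum>i | \<tau> i \<omega> < r. h (r - \<tau> i \<omega>) (a i \<omega>))"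
      using a by (intro sum_ennreal) (auto intro: h_nonneg)
    finally show "ennreal (hawkes_intensity \<nu> h \<tau> a r \<omega>) = rate r \<omega>"
      using base_rate_pos a unfolding rate_def hawkes_intensity_def
      by (subst ennreal_plus) (auto intro!: sum_nonneg h_nonneg)
  qed
qed

section \<open>Histories and the predictable \<sigma>-algebra\<close>

lemma space_history [simp]: "space (history M q \<tau> a s) = space M"
  using subalgebra_history[of s] by (simp add: subalgebra_def)

lemma sets_history_events: "D \<in> sets (history M q \<tau> a s) \<Longrightarrow> D \<in> events"
  using subalgebra_history[of s] by (auto simp: subalgebra_def)

lemma history_basic: "r \<le> s \<Longrightarrow> B \<in> sets q \<Longrightarrow> {\<omega> \<in> space M. \<tau> i \<omega> \<le> r \<and> a i \<omega> \<in> B} \<in> sets (history M q \<tau> a s)"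
  unfolding history_def by (rule in_measure_of) auto

lemma history_mono: "s \<le> t \<Longrightarrow> sets (history M q \<tau> a s) \<subseteq> sets (history M q \<tau> a t)"
  unfolding history_def
  by (subst (1 2) sets_measure_of) (auto intro!: sigma_sets_mono' intro: order_trans)

text \<open>The assumption \<open>compensator\<close> freed from conditional expectations:
  integrating over an event of the history at time \<open>s\<close> removes them on both
  sides.\<close>

lemma expected_points_rate:
  assumes "0 \<le> s" and D: "D \<in> sets (history M q \<tau> a s)"
  shows "(\<integral>\<^sup>+\<omega>\<in>D. (\<Sum>i. indicator {s<..u} (\<tau> i \<omega>)) \<partial>M) = (\<integral>\<^sup>+\<omega>\<in>D. (\<integral>\<^sup>+r\<in>{s<..u}. rate r \<omega> \<partial>lborel) \<partial>M)"
proof (cases "s < u")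
  case True
  let ?H = "history M q \<tau> a s"
  interpret fsub: finite_measure_subalgebra M ?H
    by unfold_locales (rule subalgebra_history)
  have [measurable]: "D \<in> events" using sets_history_events[OF D] .
  have [measurable]: "indicator D \<in> borel_measurable ?H" using D by simp
  have np: "(\<lambda>\<omega>. ennreal (real (num_points \<tau> s u \<omega>))) \<in> borel_measurable M"
    by (rule measurable_cong[THEN iffD2, OF num_points_suminf]) auto
  have "(\<integral>\<^sup>+\<omega>\<in>D. (\<Sum>i. indicator {s<..u} (\<tau> i \<omega>)) \<partial>M) =
      (\<integral>\<^sup>+\<omega>. indicator D \<omega> * ennreal (real (num_points \<tau> s u \<omega>)) \<partial>M)"
    by (intro nn_integral_cong) (simp add: num_points_suminf mult.commute)
  also have "\<dots> = (\<integral>\<^sup>+\<omega>. indicator D \<omega> * nn_cond_exp M ?H (\<lambda>\<omega>. ennreal (real (num_points \<tau> s u \<omega>))) \<omega> \<partial>M)"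
    using np by (intro fsub.nn_cond_exp_intg[symmetric]) auto
  also have "\<dots> = (\<integral>\<^sup>+\<omega>. indicator D \<omega> * nn_cond_exp M ?H
      (\<lambda>\<omega>. \<integral>\<^sup>+r\<in>{s<..u}. ennreal (hawkes_intensity \<nu> h \<tau> a r \<omega>) \<partial>lborel) \<omega> \<partial>M)"
    using compensator[OF \<open>0 \<le> s\<close> True] by (intro nn_integral_cong_AE) auto
  also have "\<dots> = (\<integral>\<^sup>+\<omega>. indicator D \<omega> * (\<integral>\<^sup>+r\<in>{s<..u}. ennreal (hawkes_intensity \<nu> h \<tau> a r \<omega>) \<partial>lborel) \<partial>M)"
    by (intro fsub.nn_cond_exp_intg) auto
  also have "\<dots> = (\<integral>\<^sup>+\<omega>\<in>D. (\<integral>\<^sup>+r\<in>{s<..u}. rate r \<omega> \<partial>lborel) \<partial>M)"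
    using AE_intensity_eq_rate by (intro nn_integral_cong_AE) (auto simp: mult.commute)
  finally show ?thesis .
qed simp

definition predictable :: "(real \<times> 'w) measure" where
  "predictable = sigma (UNIV \<times> space M) {{s<..u} \<times> D | s u D. D \<in> sets (history M q \<tau> a s)}"

lemma predictable_generators_subset:
  "{{s<..u} \<times> D | s u D. D \<in> sets (history M q \<tau> a s)} \<subseteq> Pow (UNIV \<times> space M)"
  using sets.sets_into_space sets_history_events by blast

lemma space_predictable [simp]: "space predictable = UNIV \<times> space M"
  unfolding predictable_def by (rule space_measure_of[OF predictable_generators_subset])

lemma sets_predictable:
  "sets predictable = sigma_sets (UNIV \<times> space M) {{s<..u} \<times> D | s u D. D \<in> sets (history M q \<tau> a s)}"
  unfolding predictable_def by (rule sets_measure_of[OF predictable_generators_subset])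

lemma predictable_rectangle: "D \<in> sets (history M q \<tau> a s) \<Longrightarrow> {s<..u} \<times> D \<in> sets predictable"
  unfolding sets_predictable by (rule sigma_sets.Basic) auto

lemma predictable_half_line:
  assumes "D \<in> sets (history M q \<tau> a s)"
  shows "{s<..} \<times> D \<in> sets predictable"
proof -
  have "{s<..} \<times> D = (\<Union>k. {s<..s + real k} \<times> D)"
    by (auto, metis add.commute diff_le_eq real_arch_simple)
  then show ?thesis using predictable_rectangle[OF assms] by auto
qed

lemma sets_predictable_product: "E \<in> sets predictable \<Longrightarrow> E \<in> sets (borel \<Otimes>\<^sub>M M)"
proof -
  have "sigma_sets (UNIV \<times> space M) {{s<..u} \<times> D | s u D. D \<in> sets (history M q \<tau> a s)} \<subseteq> sets (borel \<Otimes>\<^sub>M M)"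
    using sets_history_events
    by (intro sets.sigma_sets_subset[of _ "borel \<Otimes>\<^sub>M M", simplified space_pair_measure space_borel]) auto
  then show "E \<in> sets predictable \<Longrightarrow> E \<in> sets (borel \<Otimes>\<^sub>M M)"
    unfolding sets_predictable by (rule subsetD)
qed

lemma measurable_to_predictable:
  "f \<in> measurable N (borel \<Otimes>\<^sub>M M) \<Longrightarrow> f \<in> measurable N predictable"
proof (rule measurableI)
  assume f: "f \<in> measurable N (borel \<Otimes>\<^sub>M M)"
  show "x \<in> space N \<Longrightarrow> f x \<in> space predictable" for x
    using measurable_space[OF f] by (simp add: space_pair_measure)
  show "A \<in> sets predictable \<Longrightarrow> f -` A \<inter> space N \<in> sets N" for A
    by (rule measurable_sets[OF f sets_predictable_product])
qed

text \<open>As functions of \<open>E\<close> both sides are measures, \<mu> counting the arrivals in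
  \<open>E\<close> and \<rho> integrating the rate over it. They agree on the rectangles, which are
  stable under intersection because the histories increase, and \<open>count_integrable\<close>
  makes them finite on the rectangles with time sides \<open>{- real k<..real k}\<close>; so they
  agree on the generated \<sigma>-algebra.\<close>

theorem predictable_formula:
  assumes E: "E \<in> sets predictable"
  shows "(\<integral>\<^sup>+\<omega>. (\<Sum>i. indicator E (\<tau> i \<omega>, \<omega>)) \<partial>M) =
    (\<integral>\<^sup>+\<omega>. (\<integral>\<^sup>+r\<in>{0<..}. rate r \<omega> * indicator E (r, \<omega>) \<partial>lborel) \<partial>M)"
proof -
  define \<mu> where "\<mu> = distr (count_space UNIV \<Otimes>\<^sub>M M) predictable (\<lambda>(i, \<omega>). (\<tau> i \<omega>, \<omega>))"
  define \<rho> where "\<rho> = distr (density (lborel \<Otimes>\<^sub>M M) (\<lambda>(r, \<omega>). indicator {0<..} r * rate r \<omega>)) predictable (\<lambda>p. p)"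
  interpret N: sigma_finite_measure "count_space (UNIV :: nat set)"
    by (rule sigma_finite_measure_count_space_countable) simp
  interpret N: pair_sigma_finite "count_space (UNIV :: nat set)" M ..
  interpret L: pair_sigma_finite lborel M ..
  have [measurable]: "(\<lambda>p. (\<tau> (fst p) (snd p), snd p)) \<in> measurable (count_space (UNIV :: nat set) \<Otimes>\<^sub>M M) (borel \<Otimes>\<^sub>M M)"
    by (rule measurable_pair_measure_countable1) simp_all
  have [measurable]: "(\<lambda>p. (\<tau> (fst p) (snd p), snd p)) \<in> measurable (count_space (UNIV :: nat set) \<Otimes>\<^sub>M M) predictable"
    by (rule measurable_to_predictable) simp
  have id[measurable]: "(\<lambda>p. p) \<in> measurable (lborel \<Otimes>\<^sub>M M) predictable"
    by (rule measurable_to_predictable) simp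
  have \<mu>: "emeasure \<mu> E = (\<integral>\<^sup>+\<omega>. (\<Sum>i. indicator E (\<tau> i \<omega>, \<omega>)) \<partial>M)" if E[measurable]: "E \<in> sets predictable" for E
  proof -
    have [measurable]: "E \<in> sets (borel \<Otimes>\<^sub>M M)" by (rule sets_predictable_product[OF E])
    have "emeasure \<mu> E = (\<integral>\<^sup>+p. indicator E p \<partial>\<mu>)"
      using E by (simp add: \<mu>_def)
    also have "\<dots> = (\<integral>\<^sup>+p. indicator E (\<tau> (fst p) (snd p), snd p) \<partial>(count_space UNIV \<Otimes>\<^sub>M M))"
      unfolding \<mu>_def case_prod_beta by (rule nn_integral_distr) simp_all
    also have "\<dots> = (\<integral>\<^sup>+\<omega>. \<integral>\<^sup>+i. indicator E (\<tau> i \<omega>, \<omega>) \<partial>count_space UNIV \<partial>M)"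
      by (subst N.nn_integral_snd[symmetric]) (simp_all add: case_prod_beta)
    finally show ?thesis by (simp add: nn_integral_count_space_nat)
  qed
  have \<rho>: "emeasure \<rho> E = (\<integral>\<^sup>+\<omega>. (\<integral>\<^sup>+r\<in>{0<..}. rate r \<omega> * indicator E (r, \<omega>) \<partial>lborel) \<partial>M)"
    if E[measurable]: "E \<in> sets predictable" for E
  proof -
    have [measurable]: "E \<in> sets (borel \<Otimes>\<^sub>M M)" by (rule sets_predictable_product[OF E])
    have "emeasure \<rho> E = (\<integral>\<^sup>+p. indicator E p \<partial>\<rho>)"
      using E by (simp add: \<rho>_def)
    also have "\<dots> = (\<integral>\<^sup>+p. indicator E p \<partial>density (lborel \<Otimes>\<^sub>M M) (\<lambda>(r, \<omega>). indicator {0<..} r * rate r \<omega>))"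
      unfolding \<rho>_def using id by (intro nn_integral_distr) simp_all
    also have "\<dots> = (\<integral>\<^sup>+p. (indicator {0<..} (fst p) * rate (fst p) (snd p)) * indicator E p \<partial>(lborel \<Otimes>\<^sub>M M))"
      by (subst nn_integral_density) (simp_all add: case_prod_beta)
    also have "\<dots> = (\<integral>\<^sup>+\<omega>. \<integral>\<^sup>+r. (indicator {0<..} r * rate r \<omega>) * indicator E (r, \<omega>) \<partial>lborel \<partial>M)"
      by (subst L.nn_integral_snd[symmetric]) (simp_all add: case_prod_beta)
    finally show ?thesis by (simp add: mult_ac)
  qed
  have "\<mu> = \<rho>"
  proof (rule measure_eqI_generator_eq[where \<Omega> = "UNIV \<times> space M"
        and E = "{{s<..u} \<times> D | s u D. D \<in> sets (history M q \<tau> a s)}"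
        and A = "\<lambda>k. {- real k<..real k} \<times> space M"])
    show "Int_stable {{s<..u} \<times> D | s u D. D \<in> sets (history M q \<tau> a s)}"
    proof (rule Int_stableI, clarify)
      fix s u D s' u' D'
      assume D: "D \<in> sets (history M q \<tau> a s)" "D' \<in> sets (history M q \<tau> a s')"
      have "D \<inter> D' \<in> sets (history M q \<tau> a (max s s'))"
        using D history_mono[of s "max s s'"] history_mono[of s' "max s s'"] by auto
      moreover have "{s<..u} \<times> D \<inter> {s'<..u'} \<times> D' = {max s s'<..min u u'} \<times> (D \<inter> D')" by auto
      ultimately show "\<exists>s'' u'' D''. {s<..u} \<times> D \<inter> {s'<..u'} \<times> D' = {s''<..u''} \<times> D'' \<and> D'' \<in> sets (history M q \<tau> a s'')"
        by blast
    qed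
    show "emeasure \<mu> X = emeasure \<rho> X" if X: "X \<in> {{s<..u} \<times> D | s u D. D \<in> sets (history M q \<tau> a s)}" for X
    proof -
      obtain s u D where X_eq: "X = {s<..u} \<times> D" and D: "D \<in> sets (history M q \<tau> a s)" using X by blast
      have Xp: "X \<in> sets predictable" unfolding X_eq by (rule predictable_rectangle[OF D])
      \<comment> \<open>The compensator identity starts from nonnegative times only. Since arrivals
        are positive and \<rho> charges positive times only, the left end can be raised to
        \<open>max 0 s\<close>.\<close>
      have D0: "D \<in> sets (history M q \<tau> a (max 0 s))" using D history_mono[of s "max 0 s"] by auto
      have "emeasure \<mu> X = (\<integral>\<^sup>+\<omega>\<in>D. (\<Sum>i. indicator {max 0 s<..u} (\<tau> i \<omega>)) \<partial>M)"
        unfolding X_eq \<mu>[OF Xp[unfolded X_eq]] using arrival_pos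
        by (intro nn_integral_cong) (auto simp: indicator_def intro!: suminf_cong)
      also have "\<dots> = (\<integral>\<^sup>+\<omega>\<in>D. (\<integral>\<^sup>+r\<in>{max 0 s<..u}. rate r \<omega> \<partial>lborel) \<partial>M)"
        by (rule expected_points_rate[OF _ D0]) simp
      also have "\<dots> = emeasure \<rho> X"
        unfolding X_eq \<rho>[OF Xp[unfolded X_eq]]
        by (intro nn_integral_cong) (auto simp: indicator_def intro!: nn_integral_cong)
      finally show ?thesis .
    qed
    show "sets \<mu> = sigma_sets (UNIV \<times> space M) {{s<..u} \<times> D | s u D. D \<in> sets (history M q \<tau> a s)}"
      "sets \<rho> = sigma_sets (UNIV \<times> space M) {{s<..u} \<times> D | s u D. D \<in> sets (history M q \<tau> a s)}"
      unfolding \<mu>_def \<rho>_def by (simp_all add: sets_predictable)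
    show "range (\<lambda>k. {- real k<..real k} \<times> space M) \<subseteq> {{s<..u} \<times> D | s u D. D \<in> sets (history M q \<tau> a s)}"
      using sets.top[of "history M q \<tau> a _"] by auto
    show "(\<Union>k. {- real k<..real k} \<times> space M) = UNIV \<times> space M"
    proof safe
      fix x :: real and \<omega> assume "\<omega> \<in> space M"
      obtain k :: nat where "\<bar>x\<bar> < real k" using reals_Archimedean2 by blast
      with \<open>\<omega> \<in> space M\<close> show "(x, \<omega>) \<in> (\<Union>k. {- real k<..real k} \<times> space M)"
        by (intro UN_I[of k]) auto
    qed auto
    fix k :: nat
    have "{- real k<..real k} \<times> space M \<in> sets predictable"
      using sets.top[of "history M q \<tau> a (- real k)"] by (intro predictable_rectangle) simp
    from \<mu>[OF this] have "emeasure \<mu> ({- real k<..real k} \<times> space M) =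
        (\<integral>\<^sup>+\<omega>. ennreal (real (num_points \<tau> 0 (real k) \<omega>)) \<partial>M)"
    proof (simp, intro nn_integral_cong)
      fix \<omega> assume \<omega>: "\<omega> \<in> space M"
      have "- real k < \<tau> i \<omega>" for i
        using arrival_pos[OF \<omega>, of i] of_nat_0_le_iff[of k, where 'a = real] by linarith
      then show "(\<Sum>i. indicator ({- real k<..real k} \<times> space M) (\<tau> i \<omega>, \<omega>)) =
          ennreal (real (num_points \<tau> 0 (real k) \<omega>))"
        unfolding num_points_suminf[OF \<omega>]
        using \<omega> arrival_pos[OF \<omega>] by (intro suminf_cong) (auto simp: indicator_def)
    qed
    also have "\<dots> = ennreal (expectation (\<lambda>\<omega>. real (num_points \<tau> 0 (real k) \<omega>)))"
      by (rule nn_integral_eq_integral[OF count_integrable]) simp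
    finally show "emeasure \<mu> ({- real k<..real k} \<times> space M) \<noteq> \<infinity>" by simp
  qed (rule predictable_generators_subset)
  then show ?thesis using \<mu>[OF E] \<rho>[OF E] by simp
qed


subsection \<open>Random time change\<close>

text \<open>The arrival times and marks up to and including those with index \<open>n\<close>; below, \<open>premark n\<close> leaves out the
  mark of the \<open>n\<close>-th arrival.\<close>

definition past :: "nat \<Rightarrow> 'w measure" where
  "past n = sigma (space M) {{\<omega> \<in> space M. \<tau> j \<omega> \<le> r \<and> a j \<omega> \<in> B} | j r B. j \<le> n \<and> B \<in> sets q}"

lemma past_generators_subset:
  "{{\<omega> \<in> space M. \<tau> j \<omega> \<le> r \<and> a j \<omega> \<in> B} | j r B. j \<le> n \<and> B \<in> sets q} \<subseteq> Pow (space M)"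
  by auto

lemma space_past [simp]: "space (past n) = space M"
  unfolding past_def by (rule space_measure_of[OF past_generators_subset])

lemma past_basic: "j \<le> n \<Longrightarrow> B \<in> sets q \<Longrightarrow> {\<omega> \<in> space M. \<tau> j \<omega> \<le> r \<and> a j \<omega> \<in> B} \<in> sets (past n)"
  unfolding past_def by (rule in_measure_of) auto

lemma mark_in_space: "\<omega> \<in> space M \<Longrightarrow> a j \<omega> \<in> space q"
  by (rule measurable_space[OF mark_measurable])

lemma measurable_arrival_past: "j \<le> n \<Longrightarrow> \<tau> j \<in> borel_measurable (past n)"
proof (rule borel_measurableI_le)
  fix y assume "j \<le> n"
  have "{\<omega> \<in> space (past n). \<tau> j \<omega> \<le> y} = {\<omega> \<in> space M. \<tau> j \<omega> \<le> y \<and> a j \<omega> \<in> space q}"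
    using mark_in_space by auto
  then show "{\<omega> \<in> space (past n). \<tau> j \<omega> \<le> y} \<in> sets (past n)"
    using past_basic[OF \<open>j \<le> n\<close>] by simp
qed

lemma measurable_mark_past: "j \<le> n \<Longrightarrow> a j \<in> measurable (past n) q"
proof (rule measurableI)
  fix B assume "j \<le> n" and B: "B \<in> sets q"
  have "a j -` B \<inter> space (past n) = (\<Union>k::nat. {\<omega> \<in> space M. \<tau> j \<omega> \<le> real k \<and> a j \<omega> \<in> B})"
    by (auto intro: real_arch_simple)
  then show "a j -` B \<inter> space (past n) \<in> sets (past n)"
    using past_basic[OF \<open>j \<le> n\<close> B] by auto
qed (simp add: mark_in_space)

lemma past_subalgebra: "subalgebra M (past n)"
proof -
  have "sets (past n) = sigma_sets (space M) {{\<omega> \<in> space M. \<tau> j \<omega> \<le> r \<and> a j \<omega> \<in> B} | j r B. j \<le> n \<and> B \<in> sets q}"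
    unfolding past_def by (rule sets_measure_of[OF past_generators_subset])
  also have "\<dots> \<subseteq> events"
    by (intro sets.sigma_sets_subset) auto
  finally show ?thesis by (simp add: subalgebra_def)
qed

lemma sets_past_events: "A \<in> sets (past n) \<Longrightarrow> A \<in> events"
  using past_subalgebra[of n] by (auto simp: subalgebra_def)

text \<open>A rational \<open>c\<close> between the arrival \<open>\<tau> n\<close> and the current
  time splits the set into countably many half-line rectangles, each with an event decided at time
  \<open>c\<close>. Nothing is lost by requiring \<open>\<tau> j \<le> c\<close> as well, since
  arrival \<open>j\<close> does not come after arrival \<open>n\<close>.\<close>

lemma predictable_after_arrival:
  assumes "j \<le> n" and B: "B \<in> sets q"
  shows "{p \<in> UNIV \<times> space M. \<tau> n (snd p) < fst p \<and> \<tau> j (snd p) \<le> y \<and> a j (snd p) \<in> B} \<in> sets predictable"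
proof -
  have "{p \<in> UNIV \<times> space M. \<tau> n (snd p) < fst p \<and> \<tau> j (snd p) \<le> y \<and> a j (snd p) \<in> B} =
     (\<Union>c\<in>\<rat>. {c<..} \<times> ({\<omega> \<in> space M. \<tau> n \<omega> \<le> c \<and> a n \<omega> \<in> space q} \<inter>
        {\<omega> \<in> space M. \<tau> j \<omega> \<le> min y c \<and> a j \<omega> \<in> B}))" (is "?L = ?R")
  proof
    show "?L \<subseteq> ?R"
    proof
      fix p assume p: "p \<in> ?L"
      then obtain c where "c \<in> \<rat>" "\<tau> n (snd p) < c" "c < fst p"
        using Rats_dense_in_real[of "\<tau> n (snd p)" "fst p"] by auto
      moreover have "\<tau> j (snd p) \<le> \<tau> n (snd p)"
        using p arrival_le_iff[of "snd p" j n] \<open>j \<le> n\<close> by auto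
      ultimately show "p \<in> ?R"
        using p by (intro UN_I[of c]) (auto simp: mem_Times_iff mark_in_space)
    qed
  qed (auto simp: mem_Times_iff)
  also have "\<dots> \<in> sets predictable"
    by (intro sets.countable_UN'' countable_rat predictable_half_line sets.Int history_basic B) auto
  finally show ?thesis .
qed

text \<open>After the arrival \<open>n\<close> everything known at that arrival may be used together
  with the current time: on the predictable set where \<open>\<tau> n\<close> has passed, the two
  projections are measurable into \<open>borel\<close> and \<open>past n\<close>, so
  \<open>E\<close> is pulled back along their pair.\<close>

lemma predictable_after:
  assumes E: "E \<in> sets (borel \<Otimes>\<^sub>M past n)"
  shows "{p \<in> E. \<tau> n (snd p) < fst p} \<in> sets predictable"
proof -
  define \<Omega> where "\<Omega> = {p \<in> UNIV \<times> space M. \<tau> n (snd p) < fst p}"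
  let ?P = "restrict_space predictable \<Omega>"
  have "\<Omega> = (\<Union>k::nat. {p \<in> UNIV \<times> space M. \<tau> n (snd p) < fst p \<and> \<tau> n (snd p) \<le> real k \<and> a n (snd p) \<in> space q})"
    unfolding \<Omega>_def by (auto simp: mark_in_space intro: real_arch_simple)
  also have "\<dots> \<in> sets predictable"
    using predictable_after_arrival[of n n "space q"] by auto
  finally have \<Omega>[measurable]: "\<Omega> \<in> sets predictable" .
  have space_P: "space ?P = \<Omega>" by (auto simp: space_restrict_space \<Omega>_def)
  have sets_P: "A \<in> sets ?P \<longleftrightarrow> A \<subseteq> \<Omega> \<and> A \<in> sets predictable" for A
  proof -
    have "\<Omega> \<inter> space predictable = \<Omega>" by (auto simp: \<Omega>_def)
    with \<Omega> show ?thesis by (simp add: sets_restrict_space_iff)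
  qed
  have "fst \<in> borel_measurable predictable"
  proof (rule borel_measurableI_greater)
    fix y :: real
    have "{x \<in> space predictable. y < fst x} = {y<..} \<times> space M" by auto
    then show "{x \<in> space predictable. y < fst x} \<in> sets predictable"
      using predictable_half_line[OF sets.top[of "history M q \<tau> a y"]] by simp
  qed
  then have fst: "fst \<in> borel_measurable ?P" by (rule measurable_restrict_space1)
  have snd: "snd \<in> measurable ?P (past n)"
    unfolding past_def
  proof (rule measurable_measure_of[OF past_generators_subset])
    show "snd \<in> space ?P \<rightarrow> space M" unfolding space_P by (auto simp: \<Omega>_def)
    fix A assume "A \<in> {{\<omega> \<in> space M. \<tau> j \<omega> \<le> r \<and> a j \<omega> \<in> B} | j r B. j \<le> n \<and> B \<in> sets q}"
    then obtain j r B where A: "A = {\<omega> \<in> space M. \<tau> j \<omega> \<le> r \<and> a j \<omega> \<in> B}" and "j \<le> n" "B \<in> sets q" by auto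
    have "snd -` A \<inter> space ?P =
        {p \<in> UNIV \<times> space M. \<tau> n (snd p) < fst p \<and> \<tau> j (snd p) \<le> r \<and> a j (snd p) \<in> B}"
      unfolding A space_P by (auto simp: \<Omega>_def)
    moreover have "\<dots> \<in> sets predictable"
      by (rule predictable_after_arrival) fact+
    ultimately show "snd -` A \<inter> space ?P \<in> sets ?P"
      unfolding sets_P by (auto simp: \<Omega>_def)
  qed
  have "(\<lambda>p. (fst p, snd p)) \<in> measurable ?P (borel \<Otimes>\<^sub>M past n)"
    by (rule measurable_Pair[OF fst snd])
  from measurable_sets[OF this E] have "E \<inter> \<Omega> \<in> sets predictable"
    by (simp add: sets_P space_P vimage_def)
  moreover have "E \<inter> \<Omega> = {p \<in> E. \<tau> n (snd p) < fst p}"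
    using sets.sets_into_space[OF E] by (auto simp: \<Omega>_def space_pair_measure)
  ultimately show ?thesis by simp
qed

lemma nn_integral_kern_shift:
  assumes "u \<le> v"
  shows "(\<integral>\<^sup>+r\<in>{u<..v}. ennreal (kern (r - t) x) \<partial>lborel) = ennreal (kern_upto (v - t) x - kern_upto (u - t) x)"
proof -
  have "(\<integral>\<^sup>+r\<in>{u<..v}. ennreal (kern (r - t) x) \<partial>lborel) =
      (\<integral>\<^sup>+r. ennreal (kern (t + 1 * r - t) x) * indicator {u<..v} (t + 1 * r) \<partial>lborel)"
    by (subst nn_integral_real_affine[where t = t and c = 1]) auto
  also have "\<dots> = (\<integral>\<^sup>+r\<in>{u - t<..v - t}. ennreal (kern r x) \<partial>lborel)"
    by (intro nn_integral_cong) (auto simp: indicator_def)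
  finally show ?thesis
    using assms by (simp add: nn_kern_set kern_upto_diff)
qed

text \<open>The compensator at time \<open>s\<close> of the process whose only exciting points are the first \<open>n\<close> arrivals.  It is the
  true compensator up to the arrival with index \<open>n\<close>.\<close>

definition pcomp :: "nat \<Rightarrow> real \<Rightarrow> 'w \<Rightarrow> real" where
  "pcomp n s \<omega> = \<nu> * s + (\<Sum>i<n. kern_upto (s - \<tau> i \<omega>) (a i \<omega>))"

text \<open>The integral of the intensity between the arrivals \<open>n\<close> and
  \<open>Suc n\<close>. The index of \<open>pcomp\<close> is \<open>Suc n\<close> because on this
  stretch exactly the arrivals \<open>0..n\<close> excite. The stretch before arrival 0 is not a
  gap; it becomes the start of the walk.\<close>

definition gap :: "nat \<Rightarrow> 'w \<Rightarrow> real" where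
  "gap n \<omega> = pcomp (Suc n) (\<tau> (Suc n) \<omega>) \<omega> - pcomp (Suc n) (\<tau> n \<omega>) \<omega>"

lemma pcomp_Suc_arrival: "pcomp (Suc n) (\<tau> n \<omega>) \<omega> = pcomp n (\<tau> n \<omega>) \<omega>"
  by (simp add: pcomp_def)

lemma pcomp_increment: "u \<le> v \<Longrightarrow> \<nu> * (v - u) \<le> pcomp n v \<omega> - pcomp n u \<omega>"
proof -
  assume "u \<le> v"
  then have "(\<Sum>i<n. kern_upto (u - \<tau> i \<omega>) (a i \<omega>)) \<le> (\<Sum>i<n. kern_upto (v - \<tau> i \<omega>) (a i \<omega>))"
    by (intro sum_mono kern_upto_mono) simp
  then show ?thesis by (simp add: pcomp_def algebra_simps)
qed

lemma pcomp_strict_mono: "u < v \<Longrightarrow> pcomp n u \<omega> < pcomp n v \<omega>"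
proof -
  assume "u < v"
  then have "0 < \<nu> * (v - u)" using base_rate_pos by simp
  with \<open>u < v\<close> show ?thesis using pcomp_increment[of u v n \<omega>] by linarith
qed

lemma pcomp_mono: "u \<le> v \<Longrightarrow> pcomp n u \<omega> \<le> pcomp n v \<omega>"
  using pcomp_strict_mono[of u v n \<omega>] by (cases "u = v") auto

lemma pcomp_continuous: "continuous_on S (\<lambda>s. pcomp n s \<omega>)"
proof -
  have "continuous_on S (\<lambda>s. kern_upto (s - t) x)" for t x
    by (rule continuous_on_compose2[OF kern_upto_continuous]) (auto intro!: continuous_intros)
  then show ?thesis unfolding pcomp_def by (intro continuous_intros)
qed

lemma nn_integral_pcomp:
  assumes "u \<le> v"
  shows "(\<integral>\<^sup>+r\<in>{u<..v}. (ennreal \<nu> + (\<Sum>i<n. ennreal (kern (r - \<tau> i \<omega>) (a i \<omega>)))) \<partial>lborel) =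
    ennreal (pcomp n v \<omega> - pcomp n u \<omega>)"
proof -
  have "(\<integral>\<^sup>+r\<in>{u<..v}. (ennreal \<nu> + (\<Sum>i<n. ennreal (kern (r - \<tau> i \<omega>) (a i \<omega>)))) \<partial>lborel) =
      (\<integral>\<^sup>+r. ennreal \<nu> * indicator {u<..v} r +
        (\<Sum>i<n. ennreal (kern (r - \<tau> i \<omega>) (a i \<omega>)) * indicator {u<..v} r) \<partial>lborel)"
    by (simp only: distrib_right sum_distrib_right)
  also have "\<dots> = ennreal \<nu> * ennreal (v - u) +
      (\<Sum>i<n. \<integral>\<^sup>+r\<in>{u<..v}. ennreal (kern (r - \<tau> i \<omega>) (a i \<omega>)) \<partial>lborel)"
    using assms
    by (subst nn_integral_add, simp, simp, subst nn_integral_sum, simp) (simp add: nn_integral_cmult_indicator)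
  also have "\<dots> = ennreal (\<nu> * (v - u)) +
      (\<Sum>i<n. ennreal (kern_upto (v - \<tau> i \<omega>) (a i \<omega>) - kern_upto (u - \<tau> i \<omega>) (a i \<omega>)))"
    using assms base_rate_pos by (simp add: nn_integral_kern_shift ennreal_mult)
  also have "\<dots> = ennreal (\<nu> * (v - u)) +
      ennreal (\<Sum>i<n. kern_upto (v - \<tau> i \<omega>) (a i \<omega>) - kern_upto (u - \<tau> i \<omega>) (a i \<omega>))"
    using assms by (subst sum_ennreal) (auto intro!: kern_upto_mono)
  also have "\<dots> = ennreal (\<nu> * (v - u) +
      (\<Sum>i<n. kern_upto (v - \<tau> i \<omega>) (a i \<omega>) - kern_upto (u - \<tau> i \<omega>) (a i \<omega>)))"
    using assms base_rate_pos by (intro ennreal_plus[symmetric]) (auto intro!: sum_nonneg kern_upto_mono)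
  also have "\<dots> = ennreal (pcomp n v \<omega> - pcomp n u \<omega>)"
    by (simp add: pcomp_def sum_subtractf algebra_simps)
  finally show ?thesis .
qed

text \<open>As \<open>pcomp\<close> is strictly increasing and continuous in time, the set of times at which it
  has gained more than \<open>x\<close> is a half-line.\<close>

lemma nn_integral_pcomp_above:
  assumes "u \<le> v" "x \<ge> 0"
  shows "(\<integral>\<^sup>+r\<in>{u<..v}. ((ennreal \<nu> + (\<Sum>i<n. ennreal (kern (r - \<tau> i \<omega>) (a i \<omega>)))) *
      indicator {r. x < pcomp n r \<omega> - pcomp n u \<omega>} r) \<partial>lborel) =
    ennreal (pcomp n v \<omega> - pcomp n u \<omega> - x)"
proof (cases "x < pcomp n v \<omega> - pcomp n u \<omega>")
  case True
  have "\<exists>w. u \<le> w \<and> w \<le> v \<and> pcomp n w \<omega> = pcomp n u \<omega> + x"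
    using True assms by (intro IVT' pcomp_continuous) auto
  then obtain w where w: "u \<le> w" "w \<le> v" "pcomp n w \<omega> = pcomp n u \<omega> + x" by blast
  have "x < pcomp n r \<omega> - pcomp n u \<omega> \<longleftrightarrow> w < r" for r
    using w(3) pcomp_strict_mono[of w r n \<omega>] pcomp_mono[of r w n \<omega>] by (cases "w < r") auto
  then have "(\<integral>\<^sup>+r\<in>{u<..v}. ((ennreal \<nu> + (\<Sum>i<n. ennreal (kern (r - \<tau> i \<omega>) (a i \<omega>)))) *
      indicator {r. x < pcomp n r \<omega> - pcomp n u \<omega>} r) \<partial>lborel) =
    (\<integral>\<^sup>+r\<in>{w<..v}. (ennreal \<nu> + (\<Sum>i<n. ennreal (kern (r - \<tau> i \<omega>) (a i \<omega>)))) \<partial>lborel)"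
    using w by (intro nn_integral_cong) (auto simp: indicator_def)
  also have "\<dots> = ennreal (pcomp n v \<omega> - pcomp n u \<omega> - x)"
    unfolding nn_integral_pcomp[OF w(2)] using w(3) by (simp add: algebra_simps)
  finally show ?thesis .
next
  case False
  have "(\<integral>\<^sup>+r\<in>{u<..v}. ((ennreal \<nu> + (\<Sum>i<n. ennreal (kern (r - \<tau> i \<omega>) (a i \<omega>)))) *
      indicator {r. x < pcomp n r \<omega> - pcomp n u \<omega>} r) \<partial>lborel) = (\<integral>\<^sup>+r. 0 \<partial>(lborel :: real measure))"
  proof (intro nn_integral_cong)
    fix r
    show "(ennreal \<nu> + (\<Sum>i<n. ennreal (kern (r - \<tau> i \<omega>) (a i \<omega>)))) *
      indicator {r. x < pcomp n r \<omega> - pcomp n u \<omega>} r * indicator {u<..v} r = 0"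
      using False pcomp_mono[of r v n \<omega>] by (auto simp: indicator_def)
  qed
  then show ?thesis using False by (simp add: ennreal_neg)
qed

text \<open>The case \<open>r = \<tau> n \<omega>\<close> is included because \<open>kern\<close>
  vanishes at time 0: an arrival does not raise the rate at its own instant.\<close>

lemma rate_before_arrival:
  assumes \<omega>: "\<omega> \<in> space M" and r: "r \<le> \<tau> n \<omega>"
  shows "rate r \<omega> = ennreal \<nu> + (\<Sum>i<n. ennreal (kern (r - \<tau> i \<omega>) (a i \<omega>)))"
proof -
  have "(\<Sum>i. ennreal (kern (r - \<tau> i \<omega>) (a i \<omega>))) = (\<Sum>i<n. ennreal (kern (r - \<tau> i \<omega>) (a i \<omega>)))"
  proof (rule suminf_finite)
    fix i assume "i \<notin> {..<n}"
    then have "\<tau> n \<omega> \<le> \<tau> i \<omega>" using arrival_le_iff[OF \<omega>] by simp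
    with r show "ennreal (kern (r - \<tau> i \<omega>) (a i \<omega>)) = 0" by simp
  qed simp
  then show ?thesis by (simp add: rate_def)
qed

lemma measurable_pcomp:
  assumes [measurable]: "f \<in> borel_measurable N" and "\<And>i. i < n \<Longrightarrow> (\<lambda>z. \<tau> i (g z)) \<in> borel_measurable N"
    and "\<And>i. i < n \<Longrightarrow> (\<lambda>z. a i (g z)) \<in> measurable N q"
  shows "(\<lambda>z. pcomp n (f z) (g z)) \<in> borel_measurable N"
  unfolding pcomp_def using assms
  by (intro borel_measurable_add borel_measurable_sum measurable_kern_upto borel_measurable_diff) auto

lemma measurable_gap [measurable]: "gap n \<in> borel_measurable M"
  unfolding gap_def by (intro borel_measurable_diff measurable_pcomp) auto

lemma gap_pos: "\<omega> \<in> space M \<Longrightarrow> gap n \<omega> > 0"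
  unfolding gap_def using pcomp_strict_mono arrival_less_iff by simp

text \<open>The compensator formula is applied to the times after arrival \<open>n\<close>, up to
  and including the next arrival, at which the compensator has gained more than \<open>x\<close>.
  The only arrival that can fall into this set is the one with index \<open>Suc n\<close>, and it
  does so iff the gap exceeds \<open>x\<close>; the rate integrated over the set gives the positive
  part of \<open>gap n - x\<close>, which \<open>ennreal\<close> takes by truncation.\<close>

lemma gap_tail_recursion:
  assumes A: "A \<in> sets (past n)" and "x \<ge> 0"
  shows "emeasure M (A \<inter> {\<omega> \<in> space M. x < gap n \<omega>}) = (\<integral>\<^sup>+\<omega>\<in>A. ennreal (gap n \<omega> - x) \<partial>M)"
proof -
  define L where "L r \<omega> = pcomp (Suc n) r \<omega> - pcomp (Suc n) (\<tau> n \<omega>) \<omega>" for r \<omega>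
  \<comment> \<open>The right end at the next arrival is imposed by removing the times strictly
    after it, which form a predictable set by the same lemma; the next arrival itself thus stays
    inside.\<close>
  define E where "E = {p \<in> {p \<in> UNIV \<times> A. x < L (fst p) (snd p)}. \<tau> n (snd p) < fst p} -
    {p \<in> UNIV \<times> space M. \<tau> (Suc n) (snd p) < fst p}"
  have sp: "A \<subseteq> space M" using sets.sets_into_space[OF A] by simp
  have ev: "A \<in> events" using sets_past_events[OF A] .
  have "{p \<in> UNIV \<times> A. x < L (fst p) (snd p)} \<in> sets (borel \<Otimes>\<^sub>M past n)"
  proof -
    have [measurable]: "A \<in> sets (past n)" by (rule A)
    have ts: "(\<lambda>p. \<tau> i (snd p)) \<in> borel_measurable (borel \<Otimes>\<^sub>M past n)"
      and as: "(\<lambda>p. a i (snd p)) \<in> measurable (borel \<Otimes>\<^sub>M past n) q" if "i < Suc n" for i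
      using that by (auto intro!: measurable_compose[OF measurable_snd] measurable_arrival_past measurable_mark_past)
    have [measurable]: "(\<lambda>p. L (fst p) (snd p)) \<in> borel_measurable (borel \<Otimes>\<^sub>M past n)"
      unfolding L_def using ts as by (intro borel_measurable_diff measurable_pcomp) auto
    have "{p \<in> UNIV \<times> A. x < L (fst p) (snd p)} =
        (UNIV \<times> A) \<inter> {p \<in> space (borel \<Otimes>\<^sub>M past n). x < L (fst p) (snd p)}"
      using sp by (auto simp: space_pair_measure)
    also have "\<dots> \<in> sets (borel \<Otimes>\<^sub>M past n)" by (intro sets.Int pair_measureI) measurable
    finally show ?thesis .
  qed
  from predictable_after[OF this]
  have E_pred: "E \<in> sets predictable"
    using predictable_after[of "UNIV \<times> space M" "Suc n"] sets.top[of "borel \<Otimes>\<^sub>M past (Suc n)"]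
    unfolding E_def by (intro sets.Diff) (auto simp: space_pair_measure)
  have E_iff: "(r, \<omega>) \<in> E \<longleftrightarrow> \<omega> \<in> A \<and> \<tau> n \<omega> < r \<and> r \<le> \<tau> (Suc n) \<omega> \<and> x < L r \<omega>" for r \<omega>
    using sp by (auto simp: E_def)
  have "emeasure M (A \<inter> {\<omega> \<in> space M. x < gap n \<omega>}) =
      (\<integral>\<^sup>+\<omega>. indicator (A \<inter> {\<omega> \<in> space M. x < gap n \<omega>}) \<omega> \<partial>M)"
    using ev by simp
  also have "\<dots> = (\<integral>\<^sup>+\<omega>. (\<Sum>i. indicator E (\<tau> i \<omega>, \<omega>)) \<partial>M)"
  proof (intro nn_integral_cong)
    fix \<omega> assume \<omega>: "\<omega> \<in> space M"
    have "(\<Sum>i. indicator E (\<tau> i \<omega>, \<omega>)) = (\<Sum>i\<in>{Suc n}. indicator E (\<tau> i \<omega>, \<omega>) :: ennreal)"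
      using \<omega> by (intro suminf_finite) (auto simp: indicator_def E_iff arrival_less_iff arrival_le_iff)
    then show "indicator (A \<inter> {\<omega> \<in> space M. x < gap n \<omega>}) \<omega> = (\<Sum>i. indicator E (\<tau> i \<omega>, \<omega>) :: ennreal)"
      using \<omega> by (auto simp: indicator_def E_iff arrival_less_iff L_def gap_def)
  qed
  also have "\<dots> = (\<integral>\<^sup>+\<omega>. (\<integral>\<^sup>+r\<in>{0<..}. rate r \<omega> * indicator E (r, \<omega>) \<partial>lborel) \<partial>M)"
    by (rule predictable_formula[OF E_pred])
  also have "\<dots> = (\<integral>\<^sup>+\<omega>\<in>A. ennreal (gap n \<omega> - x) \<partial>M)"
  proof (intro nn_integral_cong)
    fix \<omega> assume \<omega>: "\<omega> \<in> space M"
    have "(\<integral>\<^sup>+r\<in>{0<..}. rate r \<omega> * indicator E (r, \<omega>) \<partial>lborel) =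
       (\<integral>\<^sup>+r\<in>{\<tau> n \<omega><..\<tau> (Suc n) \<omega>}. ((ennreal \<nu> + (\<Sum>i<Suc n. ennreal (kern (r - \<tau> i \<omega>) (a i \<omega>)))) *
        indicator {r. x < pcomp (Suc n) r \<omega> - pcomp (Suc n) (\<tau> n \<omega>) \<omega>} r) \<partial>lborel)" if "\<omega> \<in> A"
    proof (intro nn_integral_cong)
      fix r
      show "rate r \<omega> * indicator E (r, \<omega>) * indicator {0<..} r =
          (ennreal \<nu> + (\<Sum>i<Suc n. ennreal (kern (r - \<tau> i \<omega>) (a i \<omega>)))) *
          indicator {r. x < pcomp (Suc n) r \<omega> - pcomp (Suc n) (\<tau> n \<omega>) \<omega>} r * indicator {\<tau> n \<omega><..\<tau> (Suc n) \<omega>} r"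
        using that rate_before_arrival[OF \<omega>, of r "Suc n"] arrival_pos[OF \<omega>, of n]
        by (auto simp: indicator_def E_iff L_def)
    qed
    also have "\<dots> = ennreal (gap n \<omega> - x)" if "\<omega> \<in> A"
      unfolding gap_def using \<omega> \<open>x \<ge> 0\<close>
      by (intro nn_integral_pcomp_above) (auto simp: arrival_le_iff)
    finally have "(\<integral>\<^sup>+r\<in>{0<..}. rate r \<omega> * indicator E (r, \<omega>) \<partial>lborel) = ennreal (gap n \<omega> - x)" if "\<omega> \<in> A"
      using that by simp
    then show "(\<integral>\<^sup>+r\<in>{0<..}. rate r \<omega> * indicator E (r, \<omega>) \<partial>lborel) = ennreal (gap n \<omega> - x) * indicator A \<omega>"
      by (cases "\<omega> \<in> A") (simp_all add: E_iff)
  qed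
  finally show ?thesis .
qed

text \<open>By Tonelli the right side of \<open>gap_tail_recursion\<close> is the integral of the
  tail over \<open>{x..}\<close>, so the tail satisfies the equation of
  \<open>exponential_tail_unique\<close>. Carrying an arbitrary \<open>A\<close> along yields the
  exponential law and the independence from the past at once.\<close>

lemma gap_exponential:
  assumes A: "A \<in> sets (past n)" and "x \<ge> 0"
  shows "prob (A \<inter> {\<omega> \<in> space M. x < gap n \<omega>}) = prob A * exp (- x)"
proof -
  define G where "G x = prob (A \<inter> {\<omega> \<in> space M. x < gap n \<omega>})" for x
  have [measurable]: "A \<in> events" using sets_past_events[OF A] .
  interpret P: pair_sigma_finite lborel M ..
  have G_em: "ennreal (G x) = (\<integral>\<^sup>+\<omega>. indicator A \<omega> * indicator {..<gap n \<omega>} x \<partial>M)" for x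
  proof -
    have "ennreal (G x) = (\<integral>\<^sup>+\<omega>. indicator (A \<inter> {\<omega> \<in> space M. x < gap n \<omega>}) \<omega> \<partial>M)"
      by (simp add: G_def emeasure_eq_measure)
    also have "\<dots> = (\<integral>\<^sup>+\<omega>. indicator A \<omega> * indicator {..<gap n \<omega>} x \<partial>M)"
      by (intro nn_integral_cong) (auto simp: indicator_def)
    finally show ?thesis .
  qed
  have "G x = G 0 * exp (- x)"
  proof (rule exponential_tail_unique[OF _ _ _ \<open>x \<ge> 0\<close>])
    show "G x \<ge> 0" for x by (simp add: G_def)
    have "mono (\<lambda>x. - G x)"
      unfolding G_def by (intro monoI le_imp_neg_le finite_measure_mono) auto
    then have "(\<lambda>x. - (- G x)) \<in> borel_measurable borel"
      by (intro borel_measurable_uminus borel_measurable_mono)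
    then show G_meas[measurable]: "G \<in> borel_measurable borel" by simp
    fix x :: real assume "x \<ge> 0"
    have "(\<integral>\<^sup>+y\<in>{x..}. ennreal (G y) \<partial>lborel) =
        (\<integral>\<^sup>+y. \<integral>\<^sup>+\<omega>. indicator A \<omega> * (if y < gap n \<omega> then 1 else 0) * indicator {x..} y \<partial>M \<partial>lborel)"
      unfolding G_em by (intro nn_integral_cong, subst nn_integral_multc[symmetric])
        (auto intro!: nn_integral_cong simp: indicator_def)
    also have "\<dots> = (\<integral>\<^sup>+\<omega>. \<integral>\<^sup>+y. indicator A \<omega> * (if y < gap n \<omega> then 1 else 0) * indicator {x..} y \<partial>lborel \<partial>M)"
      by (rule P.Fubini'[symmetric]) measurable
    also have "\<dots> = (\<integral>\<^sup>+\<omega>. \<integral>\<^sup>+y. indicator A \<omega> * indicator {x..<gap n \<omega>} y \<partial>lborel \<partial>M)"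
      by (intro nn_integral_cong) (auto simp: indicator_def)
    also have "\<dots> = (\<integral>\<^sup>+\<omega>\<in>A. ennreal (gap n \<omega> - x) \<partial>M)"
    proof (intro nn_integral_cong)
      fix \<omega>
      show "(\<integral>\<^sup>+y. indicator A \<omega> * indicator {x..<gap n \<omega>} y \<partial>lborel) = ennreal (gap n \<omega> - x) * indicator A \<omega>"
        by (cases "x \<le> gap n \<omega>") (simp_all add: nn_integral_cmult mult.commute ennreal_neg)
    qed
    also have "\<dots> = ennreal (G x)"
      using gap_tail_recursion[OF A \<open>x \<ge> 0\<close>] by (simp add: G_def emeasure_eq_measure)
    finally show "(\<integral>\<^sup>+y\<in>{x..}. ennreal (G y) \<partial>lborel) = ennreal (G x)" .
  qed
  moreover have "A \<inter> {\<omega> \<in> space M. 0 < gap n \<omega>} = A"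
    using gap_pos sets.sets_into_space[OF \<open>A \<in> events\<close>] by auto
  ultimately show ?thesis by (simp add: G_def)
qed


subsection \<open>The embedded random walk\<close>

text \<open>Written as in \<open>mark_indep_past\<close>, so that this assumption applies verbatim.
  Step \<open>n\<close> of the walk uses the mark \<open>a n\<close>, hence the filtration has to
  stop just before that mark.\<close>

definition premark :: "nat \<Rightarrow> 'w measure" where
  "premark n = vimage_algebra (space M) (\<lambda>\<omega>. (\<lambda>j\<in>{..n}. \<tau> j \<omega>, \<lambda>j\<in>{..<n}. a j \<omega>))
    ((\<Pi>\<^sub>M j\<in>{..n}. borel) \<Otimes>\<^sub>M (\<Pi>\<^sub>M j\<in>{..<n}. q))"

lemma space_premark [simp]: "space (premark n) = space M"
  by (simp add: premark_def)

lemma measurable_premark_map: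
  assumes "space N = space M"
    and "\<And>j. j \<le> n \<Longrightarrow> \<tau> j \<in> borel_measurable N" and "\<And>j. j < n \<Longrightarrow> a j \<in> measurable N q"
  shows "(\<lambda>\<omega>. (\<lambda>j\<in>{..n}. \<tau> j \<omega>, \<lambda>j\<in>{..<n}. a j \<omega>)) \<in>
    measurable N ((\<Pi>\<^sub>M j\<in>{..n}. borel) \<Otimes>\<^sub>M (\<Pi>\<^sub>M j\<in>{..<n}. q))"
  using assms by (intro measurable_Pair measurable_restrict) auto

lemma sets_premark_subset:
  assumes "space N = space M"
    and "\<And>j. j \<le> n \<Longrightarrow> \<tau> j \<in> borel_measurable N" and "\<And>j. j < n \<Longrightarrow> a j \<in> measurable N q"
  shows "sets (premark n) \<subseteq> sets N"
  unfolding premark_def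
  by (rule sets_image_in_sets[OF assms(1) measurable_premark_map[OF assms]])

lemma premark_map_measurable:
  "(\<lambda>\<omega>. (\<lambda>j\<in>{..n}. \<tau> j \<omega>, \<lambda>j\<in>{..<n}. a j \<omega>)) \<in>
    measurable (premark n) ((\<Pi>\<^sub>M j\<in>{..n}. borel) \<Otimes>\<^sub>M (\<Pi>\<^sub>M j\<in>{..<n}. q))"
  unfolding premark_def
  by (intro measurable_vimage_algebra1) (auto simp: space_pair_measure space_PiM mark_in_space)

lemma measurable_arrival_premark:
  assumes "j \<le> n" shows "\<tau> j \<in> borel_measurable (premark n)"
proof -
  have "(\<lambda>f. f j) \<in> measurable (\<Pi>\<^sub>M j\<in>{..n}. borel) borel"
    using assms by (intro measurable_component_singleton) simp
  from measurable_compose[OF measurable_compose[OF premark_map_measurable measurable_fst] this]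
  show ?thesis using assms by simp
qed

lemma measurable_mark_premark:
  assumes "j < n" shows "a j \<in> measurable (premark n) q"
proof -
  have "(\<lambda>f. f j) \<in> measurable (\<Pi>\<^sub>M j\<in>{..<n}. q) q"
    using assms by (intro measurable_component_singleton) simp
  from measurable_compose[OF measurable_compose[OF premark_map_measurable measurable_snd] this]
  show ?thesis using assms by simp
qed

lemma premark_subalgebra: "subalgebra M (premark n)"
  using sets_premark_subset[of M n] by (simp add: subalgebra_def)

lemma premark_mono: "m \<le> n \<Longrightarrow> sets (premark m) \<subseteq> sets (premark n)"
  by (intro sets_premark_subset measurable_arrival_premark measurable_mark_premark) auto

lemma premark_past: "sets (premark n) \<subseteq> sets (past n)"
  by (intro sets_premark_subset measurable_arrival_past measurable_mark_past) auto

lemma mark_indep_premark: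
  assumes A: "A \<in> sets (premark n)" and B: "B \<in> sets q"
  shows "prob (A \<inter> {\<omega> \<in> space M. a n \<omega> \<in> B}) = prob A * measure q B"
proof -
  have eq: "{\<omega> \<in> space M. a n \<omega> \<in> B} = a n -` B \<inter> space M" by auto
  have "a n -` B \<inter> space M \<in> sets (vimage_algebra (space M) (a n) q)"
    by (rule in_vimage_algebra[OF B])
  from indep_setD[OF mark_indep_past this A[unfolded premark_def]]
  have "prob (A \<inter> {\<omega> \<in> space M. a n \<omega> \<in> B}) = prob A * prob (a n -` B \<inter> space M)"
    unfolding eq by (simp add: Int_commute mult.commute)
  also have "prob (a n -` B \<inter> space M) = measure q B"
    using measure_distr[OF mark_measurable B, of n] by (simp add: mark_distr)
  finally show ?thesis .
qed

section \<open>Joint law of a gap and the mark at its left end\<close>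

lemma gap_distributed: "distributed M lborel (gap n) (exponential_density 1)"
proof (subst exponential_distributed_iff, simp, intro conjI allI impI)
  fix x :: real assume "0 \<le> x"
  have "\<P>(\<omega> in M. gap n \<omega> \<le> x) = 1 - \<P>(\<omega> in M. \<not> gap n \<omega> \<le> x)"
    by (subst prob_neg) auto
  also have "\<dots> = 1 - exp (- x)"
    using gap_exponential[of "space M" n x] sets.top[of "past n"] \<open>0 \<le> x\<close>
    by (simp add: not_le Int_absorb1 Int_Collect prob_space conj_commute Collect_conj_eq)
  finally show "\<P>(\<omega> in M. gap n \<omega> \<le> x) = 1 - exp (- x * 1)" by simp
qed simp

text \<open>\<open>gap_exponential\<close> is this statement for half-lines. Both sides are finite
  measures in \<open>B\<close>, so half-lines suffice; those starting below 0 are trivial because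
  the gap is positive.\<close>

lemma gap_indep_past:
  assumes A: "A \<in> sets (past n)" and B: "B \<in> sets borel"
  shows "prob (A \<inter> {\<omega> \<in> space M. gap n \<omega> \<in> B}) = prob A * prob {\<omega> \<in> space M. gap n \<omega> \<in> B}"
proof -
  have [measurable]: "A \<in> events" by (rule sets_past_events[OF A])
  define \<mu>1 where "\<mu>1 = distr (density M (indicator A)) borel (gap n)"
  define \<mu>2 where "\<mu>2 = density (distr M borel (gap n)) (\<lambda>_. ennreal (prob A))"
  have \<mu>1: "emeasure \<mu>1 C = ennreal (prob (A \<inter> {\<omega> \<in> space M. gap n \<omega> \<in> C}))" if [measurable]: "C \<in> sets borel" for C
  proof -
    have "emeasure \<mu>1 C = emeasure (density M (indicator A)) (gap n -` C \<inter> space M)"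
      unfolding \<mu>1_def by (subst emeasure_distr) auto
    also have "\<dots> = emeasure M (A \<inter> (gap n -` C \<inter> space M))"
      by (subst emeasure_density) (auto simp: indicator_inter_arith[symmetric])
    also have "A \<inter> (gap n -` C \<inter> space M) = A \<inter> {\<omega> \<in> space M. gap n \<omega> \<in> C}" by auto
    finally show ?thesis by (simp add: emeasure_eq_measure)
  qed
  have \<mu>2: "emeasure \<mu>2 C = ennreal (prob A * prob {\<omega> \<in> space M. gap n \<omega> \<in> C})" if [measurable]: "C \<in> sets borel" for C
  proof -
    have "emeasure \<mu>2 C = ennreal (prob A) * emeasure M (gap n -` C \<inter> space M)"
      unfolding \<mu>2_def by (subst emeasure_density_const) (auto simp: emeasure_distr)
    also have "gap n -` C \<inter> space M = {\<omega> \<in> space M. gap n \<omega> \<in> C}" by auto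
    finally show ?thesis by (simp add: emeasure_eq_measure ennreal_mult)
  qed
  have "\<mu>1 = \<mu>2"
  proof (rule measure_eqI_lessThan)
    show "sets \<mu>1 = sets borel" "sets \<mu>2 = sets borel" by (simp_all add: \<mu>1_def \<mu>2_def)
    fix x :: real
    show "emeasure \<mu>1 {x<..} < \<infinity>" by (simp add: \<mu>1)
    have "prob (A' \<inter> {\<omega> \<in> space M. gap n \<omega> \<in> {x<..}}) = prob A' * (if x \<ge> 0 then exp (- x) else 1)"
      if A': "A' \<in> sets (past n)" for A'
    proof (cases "x \<ge> 0")
      case True then show ?thesis using gap_exponential[OF A'] by simp
    next
      case False
      have "A' \<inter> {\<omega> \<in> space M. gap n \<omega> \<in> {x<..}} = A'"
        using False gap_pos[of _ n] sets.sets_into_space[OF A'] by fastforce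
      then show ?thesis using False by simp
    qed
    from this[OF A] this[OF sets.top]
    show "emeasure \<mu>1 {x<..} = emeasure \<mu>2 {x<..}"
      by (simp add: \<mu>1 \<mu>2 prob_space Int_absorb1 Int_Collect conj_commute)
  qed
  then have "ennreal (prob (A \<inter> {\<omega> \<in> space M. gap n \<omega> \<in> B})) = ennreal (prob A * prob {\<omega> \<in> space M. gap n \<omega> \<in> B})"
    using \<mu>1[OF B] \<mu>2[OF B] by simp
  then show ?thesis by simp
qed

text \<open>Two independences are chained: the mark is independent of \<open>premark n\<close>, and
  \<open>gap n\<close> is independent of \<open>past n\<close>, which contains both. In particular
  the gap is independent of \<open>a n\<close>, although the kernel of that mark enters its
  definition.\<close>

lemma gap_mark_indep_premark:
  assumes A: "A \<in> sets (premark n)" and B: "B \<in> sets borel" and C: "C \<in> sets q"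
  shows "prob (A \<inter> {\<omega> \<in> space M. gap n \<omega> \<in> B \<and> a n \<omega> \<in> C}) =
    prob A * (prob {\<omega> \<in> space M. gap n \<omega> \<in> B} * measure q C)"
proof -
  have sp: "A \<subseteq> space M" using sets.sets_into_space[OF A] by simp
  have "a n -` C \<inter> space (past n) \<in> sets (past n)"
    by (rule measurable_sets[OF measurable_mark_past C]) simp
  then have "A \<inter> {\<omega> \<in> space M. a n \<omega> \<in> C} \<in> sets (past n)"
    using A premark_past[of n] by (intro sets.Int) (auto simp: vimage_def Int_def conj_commute)
  from gap_indep_past[OF this B] mark_indep_premark[OF A C]
  have "prob ((A \<inter> {\<omega> \<in> space M. a n \<omega> \<in> C}) \<inter> {\<omega> \<in> space M. gap n \<omega> \<in> B}) =
    prob A * measure q C * prob {\<omega> \<in> space M. gap n \<omega> \<in> B}" by simp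
  moreover have "(A \<inter> {\<omega> \<in> space M. a n \<omega> \<in> C}) \<inter> {\<omega> \<in> space M. gap n \<omega> \<in> B} =
     A \<inter> {\<omega> \<in> space M. gap n \<omega> \<in> B \<and> a n \<omega> \<in> C}" by auto
  ultimately show ?thesis by (simp add: mult_ac)
qed

text \<open>Rectangles determine the joint law. The passage to all product-measurable sets is what
  makes functions of the pair, in particular the difference of gap and excitation, independent of
  \<open>premark n\<close>.\<close>

lemma gap_mark_law_on_premark:
  assumes A: "A \<in> sets (premark n)"
  shows "distr (density M (indicator A)) (borel \<Otimes>\<^sub>M q) (\<lambda>\<omega>. (gap n \<omega>, a n \<omega>)) =
    density (distr M borel (gap n)) (\<lambda>_. ennreal (prob A)) \<Otimes>\<^sub>M q"
proof (rule pair_measure_eqI[symmetric])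
  have [measurable]: "A \<in> events"
    using A premark_subalgebra[of n] by (auto simp: subalgebra_def)
  interpret D: prob_space "distr M borel (gap n)" by (rule prob_space_distr) simp
  show "sigma_finite_measure (density (distr M borel (gap n)) (\<lambda>_. ennreal (prob A)))"
    by (intro finite_measure.axioms(1) finite_measureI)
       (simp add: emeasure_density_const emeasure_distr ennreal_mult_eq_top_iff emeasure_eq_measure)
  show "sigma_finite_measure q" ..
  show "sets (density (distr M borel (gap n)) (\<lambda>_. ennreal (prob A)) \<Otimes>\<^sub>M q) =
      sets (distr (density M (indicator A)) (borel \<Otimes>\<^sub>M q) (\<lambda>\<omega>. (gap n \<omega>, a n \<omega>)))"
    by (simp cong: sets_pair_measure_cong)
  fix B C assume "B \<in> sets (density (distr M borel (gap n)) (\<lambda>_. ennreal (prob A)))" and C[measurable]: "C \<in> sets q"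
  then have B[measurable]: "B \<in> sets borel" by simp
  have "emeasure (density (distr M borel (gap n)) (\<lambda>_. ennreal (prob A))) B * emeasure q C =
      ennreal (prob A * (prob {\<omega> \<in> space M. gap n \<omega> \<in> B} * measure q C))"
    by (simp add: emeasure_density_const emeasure_distr emeasure_eq_measure mark.emeasure_eq_measure ennreal_mult
        vimage_def Int_def conj_commute mult.assoc)
  also have "\<dots> = emeasure M (A \<inter> {\<omega> \<in> space M. gap n \<omega> \<in> B \<and> a n \<omega> \<in> C})"
    by (simp add: gap_mark_indep_premark[OF A B C, symmetric] emeasure_eq_measure)
  also have "A \<inter> {\<omega> \<in> space M. gap n \<omega> \<in> B \<and> a n \<omega> \<in> C} =
      A \<inter> ((\<lambda>\<omega>. (gap n \<omega>, a n \<omega>)) -` (B \<times> C) \<inter> space M)" by auto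
  also have "emeasure M \<dots> = emeasure (density M (indicator A)) ((\<lambda>\<omega>. (gap n \<omega>, a n \<omega>)) -` (B \<times> C) \<inter> space M)"
    by (subst emeasure_density) (auto simp: indicator_inter_arith[symmetric])
  also have "\<dots> = emeasure (distr (density M (indicator A)) (borel \<Otimes>\<^sub>M q) (\<lambda>\<omega>. (gap n \<omega>, a n \<omega>))) (B \<times> C)"
    by (subst emeasure_distr) auto
  finally show "emeasure (density (distr M borel (gap n)) (\<lambda>_. ennreal (prob A))) B * emeasure q C =
     emeasure (distr (density M (indicator A)) (borel \<Otimes>\<^sub>M q) (\<lambda>\<omega>. (gap n \<omega>, a n \<omega>))) (B \<times> C)" .
qed

lemma gap_distr: "distr M borel (gap n) = density lborel (exponential_density 1)"
proof -
  have "distr M borel (gap n) = distr M lborel (gap n)" by (rule distr_cong) auto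
  with gap_distributed[of n] show ?thesis by (simp add: distributed_def)
qed

lemma gap_mark_emeasure:
  assumes A: "A \<in> sets (premark n)" and X[measurable]: "X \<in> sets (borel \<Otimes>\<^sub>M q)"
  shows "emeasure M (A \<inter> {\<omega> \<in> space M. (gap n \<omega>, a n \<omega>) \<in> X}) =
    ennreal (prob A) * emeasure (density lborel (exponential_density 1) \<Otimes>\<^sub>M q) X"
proof -
  have [measurable]: "A \<in> events"
    using A premark_subalgebra[of n] by (auto simp: subalgebra_def)
  have "A \<inter> {\<omega> \<in> space M. (gap n \<omega>, a n \<omega>) \<in> X} = A \<inter> ((\<lambda>\<omega>. (gap n \<omega>, a n \<omega>)) -` X \<inter> space M)" by auto
  also have "emeasure M \<dots> = emeasure (density M (indicator A)) ((\<lambda>\<omega>. (gap n \<omega>, a n \<omega>)) -` X \<inter> space M)"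
    by (subst emeasure_density) (auto simp: indicator_inter_arith[symmetric])
  also have "\<dots> = emeasure (distr (density M (indicator A)) (borel \<Otimes>\<^sub>M q) (\<lambda>\<omega>. (gap n \<omega>, a n \<omega>))) X"
    by (subst emeasure_distr) auto
  also have "\<dots> = (\<integral>\<^sup>+x. emeasure q (Pair x -` X) \<partial>density (distr M borel (gap n)) (\<lambda>_. ennreal (prob A)))"
    unfolding gap_mark_law_on_premark[OF A]
    by (rule mark.emeasure_pair_measure_alt) (simp cong: sets_pair_measure_cong)
  also have "\<dots> = ennreal (prob A) * (\<integral>\<^sup>+x. emeasure q (Pair x -` X) \<partial>distr M borel (gap n))"
    by (subst nn_integral_density) (auto intro!: nn_integral_cmult mark.measurable_emeasure_Pair)
  also have "(\<integral>\<^sup>+x. emeasure q (Pair x -` X) \<partial>distr M borel (gap n)) =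
      emeasure (density lborel (exponential_density 1) \<Otimes>\<^sub>M q) X"
    unfolding gap_distr by (rule mark.emeasure_pair_measure_alt[symmetric]) (simp cong: sets_pair_measure_cong)
  finally show ?thesis .
qed

lemma gap_mark_law:
  "distr M (borel \<Otimes>\<^sub>M q) (\<lambda>\<omega>. (gap n \<omega>, a n \<omega>)) = density lborel (exponential_density 1) \<Otimes>\<^sub>M q"
proof (rule measure_eqI)
  show "sets (distr M (borel \<Otimes>\<^sub>M q) (\<lambda>\<omega>. (gap n \<omega>, a n \<omega>))) = sets (density lborel (exponential_density 1) \<Otimes>\<^sub>M q)"
    by (simp cong: sets_pair_measure_cong)
  fix X assume "X \<in> sets (distr M (borel \<Otimes>\<^sub>M q) (\<lambda>\<omega>. (gap n \<omega>, a n \<omega>)))"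
  then have X: "X \<in> sets (borel \<Otimes>\<^sub>M q)" by simp
  have "(\<lambda>\<omega>. (gap n \<omega>, a n \<omega>)) -` X \<inter> space M = space M \<inter> {\<omega> \<in> space M. (gap n \<omega>, a n \<omega>) \<in> X}" by auto
  then show "emeasure (distr M (borel \<Otimes>\<^sub>M q) (\<lambda>\<omega>. (gap n \<omega>, a n \<omega>))) X =
      emeasure (density lborel (exponential_density 1) \<Otimes>\<^sub>M q) X"
    using gap_mark_emeasure[OF _ X, of "space M" n] sets.top[of "premark n"] X
    by (simp add: emeasure_distr prob_space)
qed

lemma gap_mark_indep:
  "indep_var borel (gap n) borel (\<lambda>\<omega>. kern_mass (a n \<omega>))"
proof (subst indep_var_distribution_eq, intro conjI)
  show "distr M borel (gap n) \<Otimes>\<^sub>M distr M borel (\<lambda>\<omega>. kern_mass (a n \<omega>)) =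
      distr M (borel \<Otimes>\<^sub>M borel) (\<lambda>\<omega>. (gap n \<omega>, kern_mass (a n \<omega>)))"
  proof (rule pair_measure_eqI)
    interpret D1: prob_space "distr M borel (gap n)" by (rule prob_space_distr) simp
    interpret D2: prob_space "distr M borel (\<lambda>\<omega>. kern_mass (a n \<omega>))" by (rule prob_space_distr) simp
    show "sigma_finite_measure (distr M borel (gap n))"
      "sigma_finite_measure (distr M borel (\<lambda>\<omega>. kern_mass (a n \<omega>)))" ..
    fix B C assume "B \<in> sets (distr M borel (gap n))" "C \<in> sets (distr M borel (\<lambda>\<omega>. kern_mass (a n \<omega>)))"
    then have [measurable]: "B \<in> sets borel" "C \<in> sets borel" by auto
    have C': "kern_mass -` C \<inter> space q \<in> sets q" by measurable
    have "prob {\<omega> \<in> space M. gap n \<omega> \<in> B \<and> kern_mass (a n \<omega>) \<in> C} =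
        prob {\<omega> \<in> space M. gap n \<omega> \<in> B} * measure q (kern_mass -` C \<inter> space q)"
      using gap_mark_indep_premark[OF sets.top \<open>B \<in> sets borel\<close> C', of n]
      by (simp add: mark_in_space prob_space Int_absorb1 Int_Collect conj_ac cong: conj_cong)
    also have "measure q (kern_mass -` C \<inter> space q) = prob {\<omega> \<in> space M. kern_mass (a n \<omega>) \<in> C}"
      using mark_indep_premark[OF sets.top C', of n]
      by (simp add: mark_in_space prob_space Int_absorb1 Int_Collect conj_ac cong: conj_cong)
    finally show "emeasure (distr M borel (gap n)) B * emeasure (distr M borel (\<lambda>\<omega>. kern_mass (a n \<omega>))) C =
        emeasure (distr M (borel \<Otimes>\<^sub>M borel) (\<lambda>\<omega>. (gap n \<omega>, kern_mass (a n \<omega>)))) (B \<times> C)"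
      by (simp add: emeasure_distr emeasure_eq_measure ennreal_mult[symmetric] vimage_def Int_def conj_ac)
  qed simp
qed auto

section \<open>The walk and the moments of its steps\<close>

definition walk :: "nat \<Rightarrow> 'w \<Rightarrow> real" where
  "walk n \<omega> = pcomp n (\<tau> n \<omega>) \<omega> - (\<Sum>i<n. kern_mass (a i \<omega>))"

lemma walk_increment: "walk (Suc n) \<omega> - walk n \<omega> = gap n \<omega> - kern_mass (a n \<omega>)"
  by (simp add: walk_def gap_def pcomp_Suc_arrival)

lemma walk_0: "walk 0 \<omega> = \<nu> * \<tau> 0 \<omega>"
  by (simp add: walk_def pcomp_def)

lemma walk_le: "walk n \<omega> \<le> \<nu> * \<tau> n \<omega>"
  using sum_mono[of "{..<n}" "\<lambda>i. kern_upto (\<tau> n \<omega> - \<tau> i \<omega>) (a i \<omega>)" "\<lambda>i. kern_mass (a i \<omega>)"] kern_upto_le_mass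
  by (simp add: walk_def pcomp_def)

lemma walk_increment_distr:
  "distr M borel (\<lambda>\<omega>. walk (Suc n) \<omega> - walk n \<omega>) =
    distr (density lborel (exponential_density 1) \<Otimes>\<^sub>M q) borel (\<lambda>(y, x). y - kern_mass x)"
  unfolding walk_increment gap_mark_law[of n, symmetric]
  by (subst distr_distr) (auto simp: comp_def)

lemma mark_integral:
  fixes f :: "'x \<Rightarrow> real"
  assumes [measurable]: "f \<in> borel_measurable q"
  shows "expectation (\<lambda>\<omega>. f (a n \<omega>)) = mark.expectation f"
    and "integrable M (\<lambda>\<omega>. f (a n \<omega>)) \<longleftrightarrow> integrable q f"
  using integral_distr[OF mark_measurable[of n] assms] integrable_distr_eq[OF mark_measurable[of n] assms]
  by (simp_all add: mark_distr)

text \<open>Up to index \<open>n\<close> the walk involves the arrivals up to \<open>n\<close> but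
  only the marks below \<open>n\<close>, so it is adapted to \<open>premark\<close>; the mark
  \<open>a n\<close> first enters through the next step. Gap and mark are independent, so their
  variances add, the exponential gap contributing 1.\<close>

lemma adapted_walk:
  assumes sq: "integrable q (\<lambda>x. (kern_mass x)\<^sup>2)"
  shows "adapted_walk M premark walk (1 - mark.expectation kern_mass) (1 + mark.variance kern_mass)"
proof
  fix n
  show "subalgebra M (premark n)" by (rule premark_subalgebra)
  show "m \<le> n \<Longrightarrow> sets (premark m) \<subseteq> sets (premark n)" for m by (rule premark_mono)
  show "walk n \<in> borel_measurable (premark n)"
    unfolding walk_def
    by (intro borel_measurable_diff measurable_pcomp borel_measurable_sum
        measurable_compose[OF measurable_mark_premark measurable_kern_mass])
       (auto intro: measurable_arrival_premark measurable_mark_premark)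
  let ?H = "\<lambda>\<omega>. kern_mass (a n \<omega>)"
  let ?m = "mark.expectation kern_mass" and ?v = "mark.variance kern_mass"
  have intq: "integrable q kern_mass"
    by (rule mark.square_integrable_imp_integrable[OF _ sq]) simp
  have H: "integrable M ?H" "expectation ?H = ?m"
    using mark_integral[of kern_mass n] intq by simp_all
  have H2: "integrable M (\<lambda>\<omega>. (?H \<omega>)\<^sup>2)"
    using mark_integral(2)[of "\<lambda>x. (kern_mass x)\<^sup>2" n] sq by simp
  have Hv: "expectation (\<lambda>\<omega>. (?H \<omega> - ?m)\<^sup>2) = ?v"
    by (rule mark_integral(1)) simp
  have g: "integrable M (gap n)" "expectation (gap n) = 1" "integrable M (\<lambda>\<omega>. (gap n \<omega>)\<^sup>2)"
    using has_bochner_integral_erlang_ith_moment[OF _ gap_distributed, of n 1]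
      has_bochner_integral_erlang_ith_moment[OF _ gap_distributed, of n 2]
    by (auto simp: has_bochner_integral_iff)
  have gv: "variance (gap n) = 1"
    using exponential_distributed_variance[OF _ gap_distributed, of n] by simp
  show E: "expectation (\<lambda>\<omega>. walk (Suc n) \<omega> - walk n \<omega>) = 1 - ?m"
    unfolding walk_increment using H g by simp
  have sq_diff: "(x - y)\<^sup>2 = x\<^sup>2 - 2 * (x * y) + y\<^sup>2" for x y :: real
    by (simp add: power2_eq_square algebra_simps)
  have prod: "integrable M (\<lambda>\<omega>. gap n \<omega> * ?H \<omega>)" "expectation (\<lambda>\<omega>. gap n \<omega> * ?H \<omega>) = ?m"
    using indep_var_integrable[OF gap_mark_indep g(1) H(1)]
      indep_var_lebesgue_integral[OF gap_mark_indep g(1) H(1)] g H by simp_all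
  show int: "integrable M (\<lambda>\<omega>. (walk (Suc n) \<omega> - walk n \<omega>)\<^sup>2)"
    unfolding walk_increment sq_diff using g H2 prod by simp
  \<comment> \<open>With \<open>?m\<close> and \<open>?v\<close> the mean and variance of the
    excitation, the second moments combine to 2 - 2 m + (v + m^2) - (1 - m)^2 = 1 + v.\<close>
  have "variance (\<lambda>\<omega>. walk (Suc n) \<omega> - walk n \<omega>) =
      expectation (\<lambda>\<omega>. (gap n \<omega> - ?H \<omega>)\<^sup>2) - (1 - ?m)\<^sup>2"
    using variance_eq[OF _ int] E H g unfolding walk_increment by simp
  also have "expectation (\<lambda>\<omega>. (gap n \<omega> - ?H \<omega>)\<^sup>2) =
      expectation (\<lambda>\<omega>. (gap n \<omega>)\<^sup>2) - 2 * ?m + expectation (\<lambda>\<omega>. (?H \<omega>)\<^sup>2)"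
    unfolding sq_diff using g H2 prod by simp
  also have "expectation (\<lambda>\<omega>. (gap n \<omega>)\<^sup>2) = 2"
    using variance_eq[OF g(1,3)] gv g(2) by simp
  also have "expectation (\<lambda>\<omega>. (?H \<omega>)\<^sup>2) = ?v + ?m\<^sup>2"
    using variance_eq[OF H(1) H2] Hv H(2) by simp
  finally show "variance (\<lambda>\<omega>. walk (Suc n) \<omega> - walk n \<omega>) = 1 + ?v"
    by (simp add: power2_eq_square algebra_simps)
  fix A and B :: "real set" assume A: "A \<in> sets (premark n)" and [measurable]: "B \<in> sets borel"
  \<comment> \<open>The step is a measurable function of the pair of gap and mark, so
    \<open>B\<close> is pulled back to the product space, where the law of the pair is
    known.\<close>
  define X where "X = {z \<in> space (borel \<Otimes>\<^sub>M q). fst z - kern_mass (snd z) \<in> B}"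
  have X: "X \<in> sets (borel \<Otimes>\<^sub>M q)" unfolding X_def by measurable
  have X_iff: "{\<omega> \<in> space M. (gap n \<omega>, a n \<omega>) \<in> X} = {\<omega> \<in> space M. walk (Suc n) \<omega> - walk n \<omega> \<in> B}"
    unfolding walk_increment by (auto simp: X_def space_pair_measure mark_in_space)
  have sp: "space M \<inter> {\<omega> \<in> space M. walk (Suc n) \<omega> - walk n \<omega> \<in> B} = {\<omega> \<in> space M. walk (Suc n) \<omega> - walk n \<omega> \<in> B}"
    by auto
  have "ennreal (prob (A \<inter> {\<omega> \<in> space M. walk (Suc n) \<omega> - walk n \<omega> \<in> B})) =
      ennreal (prob A * prob {\<omega> \<in> space M. walk (Suc n) \<omega> - walk n \<omega> \<in> B})"
    using gap_mark_emeasure[OF A X] gap_mark_emeasure[OF sets.top X, of n]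
    unfolding X_iff by (simp add: sp prob_space emeasure_eq_measure ennreal_mult)
  then show "prob (A \<inter> {\<omega> \<in> space M. walk (Suc n) \<omega> - walk n \<omega> \<in> B}) =
      prob A * prob {\<omega> \<in> space M. walk (Suc n) \<omega> - walk n \<omega> \<in> B}"
    by simp
qed


subsection \<open>Excitation outstanding at a fixed time\<close>

text \<open>The arrival time \<open>\<tau> i\<close> is measurable with respect to
  \<open>premark i\<close>, hence independent of its mark, and the law of the pair is a product.
  This lets the mark be averaged out at a random time.\<close>

lemma nn_integral_mark:
  assumes [measurable]: "f \<in> borel_measurable (borel \<Otimes>\<^sub>M q)"
  shows "(\<integral>\<^sup>+\<omega>. f (\<tau> i \<omega>, a i \<omega>) \<partial>M) = (\<integral>\<^sup>+\<omega>. (\<integral>\<^sup>+x. f (\<tau> i \<omega>, x) \<partial>q) \<partial>M)"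
proof -
  have "distr M borel (\<tau> i) \<Otimes>\<^sub>M q = distr M (borel \<Otimes>\<^sub>M q) (\<lambda>\<omega>. (\<tau> i \<omega>, a i \<omega>))"
  proof (rule pair_measure_eqI)
    interpret D: prob_space "distr M borel (\<tau> i)" by (rule prob_space_distr) simp
    show "sigma_finite_measure (distr M borel (\<tau> i))" "sigma_finite_measure q" ..
    show "sets (distr M borel (\<tau> i) \<Otimes>\<^sub>M q) = sets (distr M (borel \<Otimes>\<^sub>M q) (\<lambda>\<omega>. (\<tau> i \<omega>, a i \<omega>)))"
      by (simp cong: sets_pair_measure_cong)
    fix B C assume "B \<in> sets (distr M borel (\<tau> i))" and C[measurable]: "C \<in> sets q"
    then have B[measurable]: "B \<in> sets borel" by simp
    have "{\<omega> \<in> space M. \<tau> i \<omega> \<in> B} \<in> sets (premark i)"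
      using measurable_sets[OF measurable_arrival_premark[of i i] B] by (simp add: vimage_def Int_def conj_commute)
    from mark_indep_premark[OF this C]
    show "emeasure (distr M borel (\<tau> i)) B * emeasure q C =
        emeasure (distr M (borel \<Otimes>\<^sub>M q) (\<lambda>\<omega>. (\<tau> i \<omega>, a i \<omega>))) (B \<times> C)"
      by (simp add: emeasure_distr emeasure_eq_measure mark.emeasure_eq_measure ennreal_mult[symmetric]
          vimage_def Int_def conj_ac)
  qed
  then have "(\<integral>\<^sup>+\<omega>. f (\<tau> i \<omega>, a i \<omega>) \<partial>M) = (\<integral>\<^sup>+z. f z \<partial>(distr M borel (\<tau> i) \<Otimes>\<^sub>M q))"
    by (simp add: nn_integral_distr)
  also have "\<dots> = (\<integral>\<^sup>+t. (\<integral>\<^sup>+x. f (t, x) \<partial>q) \<partial>distr M borel (\<tau> i))"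
    by (rule mark.nn_integral_fst[symmetric]) (simp cong: measurable_cong_sets sets_pair_measure_cong)
  also have "\<dots> = (\<integral>\<^sup>+\<omega>. (\<integral>\<^sup>+x. f (\<tau> i \<omega>, x) \<partial>q) \<partial>M)"
    by (rule nn_integral_distr) simp_all
  finally show ?thesis .
qed

section \<open>Expected number of points in a unit window\<close>

definition window :: "real \<Rightarrow> ennreal" where
  "window v = (\<integral>\<^sup>+\<omega>. (\<Sum>i. indicator {v<..v + 1} (\<tau> i \<omega>)) \<partial>M)"

definition mean_kern :: "real \<Rightarrow> ennreal" where
  "mean_kern t = (\<integral>\<^sup>+x. ennreal (kern t x) \<partial>q)"

lemma measurable_mean_kern [measurable]: "mean_kern \<in> borel_measurable borel"
  unfolding mean_kern_def by measurable

lemma nn_integral_mean_kern: "(\<integral>\<^sup>+t. mean_kern t \<partial>lborel) = (\<integral>\<^sup>+x. ennreal (kern_mass x) \<partial>q)"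
proof -
  interpret P: pair_sigma_finite lborel q ..
  show ?thesis
    unfolding mean_kern_def nn_kern_mass[symmetric] by (rule P.Fubini'[symmetric]) measurable
qed

text \<open>The expected number of points is the expected integral of the rate. After averaging over
  its mark, a point at \<open>\<tau> i\<close> contributes \<open>mean_kern\<close> at lag
  \<open>y\<close>, and the lag moves the window back by \<open>y\<close>. The result is a renewal
  inequality with a kernel of total mass E H.\<close>

lemma window_renewal:
  "window v \<le> ennreal \<nu> + (\<integral>\<^sup>+y. mean_kern y * window (v - y) \<partial>lborel)"
proof -
  interpret P: pair_sigma_finite lborel q ..
  interpret L: pair_sigma_finite lborel M ..
  have "window v = (\<integral>\<^sup>+\<omega>\<in>space M. (\<Sum>i. indicator {max 0 v<..v + 1} (\<tau> i \<omega>)) \<partial>M)"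
    unfolding window_def
    by (intro nn_integral_cong) (auto simp: indicator_def arrival_pos intro!: suminf_cong)
  also have "\<dots> = (\<integral>\<^sup>+\<omega>\<in>space M. (\<integral>\<^sup>+r\<in>{max 0 v<..v + 1}. rate r \<omega> \<partial>lborel) \<partial>M)"
    using sets.top[of "history M q \<tau> a (max 0 v)"] by (intro expected_points_rate) simp_all
  \<comment> \<open>Dropping \<open>max 0\<close> also counts the base rate at negative times; this
    is why the lemma is an inequality, and it gives the window its full length 1.\<close>
  also have "\<dots> \<le> (\<integral>\<^sup>+\<omega>. (\<integral>\<^sup>+r\<in>{v<..v + 1}. rate r \<omega> \<partial>lborel) \<partial>M)"
    by (intro nn_integral_mono) (auto simp: indicator_def intro!: nn_integral_mono)
  also have "\<dots> = (\<integral>\<^sup>+\<omega>. ennreal \<nu> + (\<Sum>i. \<integral>\<^sup>+r. ennreal (kern (r - \<tau> i \<omega>) (a i \<omega>)) * indicator {v<..v + 1} r \<partial>lborel) \<partial>M)"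
  proof (intro nn_integral_cong)
    fix \<omega>
    have "(\<integral>\<^sup>+r\<in>{v<..v + 1}. rate r \<omega> \<partial>lborel) =
      (\<integral>\<^sup>+r. ennreal \<nu> * indicator {v<..v + 1} r +
        (\<Sum>i. ennreal (kern (r - \<tau> i \<omega>) (a i \<omega>)) * indicator {v<..v + 1} r) \<partial>lborel)"
      by (simp only: rate_def distrib_right ennreal_suminf_multc)
    also have "\<dots> = ennreal \<nu> + (\<Sum>i. \<integral>\<^sup>+r. ennreal (kern (r - \<tau> i \<omega>) (a i \<omega>)) * indicator {v<..v + 1} r \<partial>lborel)"
      by (subst nn_integral_add, simp, simp, subst nn_integral_suminf, simp) (simp add: nn_integral_cmult_indicator)
    finally show "(\<integral>\<^sup>+r\<in>{v<..v + 1}. rate r \<omega> \<partial>lborel) =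
      ennreal \<nu> + (\<Sum>i. \<integral>\<^sup>+r. ennreal (kern (r - \<tau> i \<omega>) (a i \<omega>)) * indicator {v<..v + 1} r \<partial>lborel)" .
  qed
  also have "\<dots> = ennreal \<nu> + (\<Sum>i. \<integral>\<^sup>+\<omega>. (\<integral>\<^sup>+r. ennreal (kern (r - \<tau> i \<omega>) (a i \<omega>)) * indicator {v<..v + 1} r \<partial>lborel) \<partial>M)"
    by (subst nn_integral_add, simp, measurable, subst nn_integral_suminf, measurable) (simp add: emeasure_space_1)
  also have "(\<Sum>i. \<integral>\<^sup>+\<omega>. (\<integral>\<^sup>+r. ennreal (kern (r - \<tau> i \<omega>) (a i \<omega>)) * indicator {v<..v + 1} r \<partial>lborel) \<partial>M) =
      (\<Sum>i. \<integral>\<^sup>+y. mean_kern y * (\<integral>\<^sup>+\<omega>. indicator {v - y<..v - y + 1} (\<tau> i \<omega>) \<partial>M) \<partial>lborel)"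
  proof (intro suminf_cong)
    fix i
    have "(\<integral>\<^sup>+\<omega>. (\<integral>\<^sup>+r. ennreal (kern (r - \<tau> i \<omega>) (a i \<omega>)) * indicator {v<..v + 1} r \<partial>lborel) \<partial>M) =
        (\<integral>\<^sup>+\<omega>. (\<integral>\<^sup>+x. (\<integral>\<^sup>+r. ennreal (kern (r - \<tau> i \<omega>) x) * indicator {v<..v + 1} r \<partial>lborel) \<partial>q) \<partial>M)"
      using nn_integral_mark[of "\<lambda>z. \<integral>\<^sup>+r. ennreal (kern (r - fst z) (snd z)) * indicator {v<..v + 1} r \<partial>lborel" i]
      by simp
    \<comment> \<open>Substituting r = \<tau> + y turns the condition on \<open>r\<close> into one
      on the arrival, which must lie in the window shifted back by \<open>y\<close>.\<close>
    also have "\<dots> = (\<integral>\<^sup>+\<omega>. (\<integral>\<^sup>+x. (\<integral>\<^sup>+y. ennreal (kern y x) * (if v - y < \<tau> i \<omega> \<and> \<tau> i \<omega> \<le> v - y + 1 then 1 else 0) \<partial>lborel) \<partial>q) \<partial>M)"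
    proof (rule nn_integral_cong, rule nn_integral_cong)
      fix \<omega> x assume [measurable]: "x \<in> space q"
      have "(\<integral>\<^sup>+r. ennreal (kern (r - \<tau> i \<omega>) x) * indicator {v<..v + 1} r \<partial>lborel) =
          (\<integral>\<^sup>+y. ennreal (kern (\<tau> i \<omega> + 1 * y - \<tau> i \<omega>) x) * indicator {v<..v + 1} (\<tau> i \<omega> + 1 * y) \<partial>lborel)"
        by (subst nn_integral_real_affine[where t = "\<tau> i \<omega>" and c = 1]) auto
      also have "\<dots> = (\<integral>\<^sup>+y. ennreal (kern y x) * (if v - y < \<tau> i \<omega> \<and> \<tau> i \<omega> \<le> v - y + 1 then 1 else 0) \<partial>lborel)"
        by (intro nn_integral_cong) (auto simp: indicator_def)
      finally show "(\<integral>\<^sup>+r. ennreal (kern (r - \<tau> i \<omega>) x) * indicator {v<..v + 1} r \<partial>lborel) =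
        (\<integral>\<^sup>+y. ennreal (kern y x) * (if v - y < \<tau> i \<omega> \<and> \<tau> i \<omega> \<le> v - y + 1 then 1 else 0) \<partial>lborel)" .
    qed
    also have "\<dots> = (\<integral>\<^sup>+\<omega>. (\<integral>\<^sup>+y. (\<integral>\<^sup>+x. ennreal (kern y x) * (if v - y < \<tau> i \<omega> \<and> \<tau> i \<omega> \<le> v - y + 1 then 1 else 0) \<partial>q) \<partial>lborel) \<partial>M)"
      by (intro nn_integral_cong P.Fubini') measurable
    also have "\<dots> = (\<integral>\<^sup>+\<omega>. (\<integral>\<^sup>+y. mean_kern y * (if v - y < \<tau> i \<omega> \<and> \<tau> i \<omega> \<le> v - y + 1 then 1 else 0) \<partial>lborel) \<partial>M)"
      unfolding mean_kern_def by (subst nn_integral_multc) measurable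
    also have "\<dots> = (\<integral>\<^sup>+y. (\<integral>\<^sup>+\<omega>. mean_kern y * (if v - y < \<tau> i \<omega> \<and> \<tau> i \<omega> \<le> v - y + 1 then 1 else 0) \<partial>M) \<partial>lborel)"
      by (rule L.Fubini') measurable
    also have "\<dots> = (\<integral>\<^sup>+y. mean_kern y * (\<integral>\<^sup>+\<omega>. (if v - y < \<tau> i \<omega> \<and> \<tau> i \<omega> \<le> v - y + 1 then 1 else 0) \<partial>M) \<partial>lborel)"
      by (subst nn_integral_cmult) measurable
    also have "\<dots> = (\<integral>\<^sup>+y. mean_kern y * (\<integral>\<^sup>+\<omega>. indicator {v - y<..v - y + 1} (\<tau> i \<omega>) \<partial>M) \<partial>lborel)"
      by (intro nn_integral_cong arg_cong2[where f = "(*)"] refl) (auto simp: indicator_def)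
    finally show "(\<integral>\<^sup>+\<omega>. (\<integral>\<^sup>+r. ennreal (kern (r - \<tau> i \<omega>) (a i \<omega>)) * indicator {v<..v + 1} r \<partial>lborel) \<partial>M) = \<dots>" .
  qed
  also have "\<dots> = (\<integral>\<^sup>+y. (\<Sum>i. mean_kern y * (\<integral>\<^sup>+\<omega>. indicator {v - y<..v - y + 1} (\<tau> i \<omega>) \<partial>M)) \<partial>lborel)"
  proof (rule nn_integral_suminf[symmetric])
    fix i
    have "(\<lambda>y. mean_kern y * (\<integral>\<^sup>+\<omega>. (if v - y < \<tau> i \<omega> \<and> \<tau> i \<omega> \<le> v - y + 1 then 1 else 0) \<partial>M)) \<in> borel_measurable lborel"
      by measurable
    also have "(\<lambda>y. mean_kern y * (\<integral>\<^sup>+\<omega>. (if v - y < \<tau> i \<omega> \<and> \<tau> i \<omega> \<le> v - y + 1 then 1 else 0) \<partial>M)) =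
        (\<lambda>y. mean_kern y * (\<integral>\<^sup>+\<omega>. indicator {v - y<..v - y + 1} (\<tau> i \<omega>) \<partial>M))"
      by (intro ext arg_cong2[where f = "(*)"] refl nn_integral_cong) (auto simp: indicator_def)
    finally show "(\<lambda>y. mean_kern y * (\<integral>\<^sup>+\<omega>. indicator {v - y<..v - y + 1} (\<tau> i \<omega>) \<partial>M)) \<in> borel_measurable lborel" .
  qed
  also have "\<dots> = (\<integral>\<^sup>+y. mean_kern y * window (v - y) \<partial>lborel)"
    unfolding window_def
    by (subst nn_integral_suminf) (simp_all add: ennreal_suminf_cmult)
  finally show ?thesis .
qed

lemma window_finite: "v \<le> V \<Longrightarrow> window v \<le> ennreal (expectation (\<lambda>\<omega>. real (num_points \<tau> 0 (V + 1) \<omega>)))"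
proof -
  assume "v \<le> V"
  have "window v \<le> (\<integral>\<^sup>+\<omega>. ennreal (real (num_points \<tau> 0 (V + 1) \<omega>)) \<partial>M)"
    unfolding window_def
  proof (rule nn_integral_mono)
    fix \<omega> assume \<omega>: "\<omega> \<in> space M"
    show "(\<Sum>i. indicator {v<..v + 1} (\<tau> i \<omega>)) \<le> ennreal (real (num_points \<tau> 0 (V + 1) \<omega>))"
      unfolding num_points_suminf[OF \<omega>]
      using arrival_pos[OF \<omega>] \<open>v \<le> V\<close> by (intro suminf_le) (auto simp: indicator_def)
  qed
  also have "\<dots> = ennreal (expectation (\<lambda>\<omega>. real (num_points \<tau> 0 (V + 1) \<omega>)))"
    by (rule nn_integral_eq_integral[OF count_integrable]) simp
  finally show ?thesis .
qed

text \<open>The supremum \<open>W\<close> over all windows starting up to \<open>v\<close> satisfies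
  W <= \<nu> + m W with m = E H < 1, because \<open>mean_kern\<close> vanishes at nonpositive lags
  and so only looks back. It is finite by \<open>window_finite\<close>, that is, by integrability of
  the counts, and only therefore may the inequality be solved for it.\<close>

lemma window_bound:
  assumes int: "integrable q kern_mass" and sub: "mark.expectation kern_mass < 1"
  shows "window v \<le> ennreal (\<nu> / (1 - mark.expectation kern_mass))"
proof -
  let ?m = "mark.expectation kern_mass"
  have m0: "?m \<ge> 0" by simp
  define W where "W = (SUP u\<in>{..v}. window u)"
  have "W \<le> ennreal (expectation (\<lambda>\<omega>. real (num_points \<tau> 0 (v + 1) \<omega>)))"
    unfolding W_def by (intro SUP_least window_finite) simp
  then have "W < top" by (rule le_less_trans) simp
  then obtain w where w: "W = ennreal w" "w \<ge> 0" by (cases W) auto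
  have "window u \<le> ennreal \<nu> + ennreal ?m * W" if "u \<le> v" for u
  proof -
    have "window u \<le> ennreal \<nu> + (\<integral>\<^sup>+y. mean_kern y * window (u - y) \<partial>lborel)"
      by (rule window_renewal)
    also have "(\<integral>\<^sup>+y. mean_kern y * window (u - y) \<partial>lborel) \<le> (\<integral>\<^sup>+y. mean_kern y * W \<partial>lborel)"
    proof (rule nn_integral_mono)
      fix y
      show "mean_kern y * window (u - y) \<le> mean_kern y * W"
      proof (cases "y \<le> 0")
        case True then show ?thesis by (simp add: mean_kern_def)
      next
        case False
        then have "window (u - y) \<le> W" unfolding W_def using that by (intro SUP_upper) simp
        then show ?thesis by (rule mult_left_mono) simp
      qed
    qed
    also have "\<dots> = ennreal ?m * W"
      using nn_integral_eq_integral[OF int] by (simp add: nn_integral_multc nn_integral_mean_kern)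
    finally show ?thesis by (simp add: add_left_mono)
  qed
  then have "W \<le> ennreal \<nu> + ennreal ?m * W"
    unfolding W_def by (intro SUP_least) auto
  then have "w \<le> \<nu> + ?m * w"
    using w m0 base_rate_pos by (simp add: ennreal_mult[symmetric] ennreal_plus[symmetric] del: ennreal_plus)
  then have "w \<le> \<nu> / (1 - ?m)" using sub by (simp add: field_simps)
  moreover have "window v \<le> W" unfolding W_def by (intro SUP_upper) simp
  ultimately show ?thesis using w(1) ennreal_leI order_trans by blast
qed

section \<open>Mean of the outstanding excitation\<close>

definition mean_tail :: "real \<Rightarrow> real" where
  "mean_tail u = mark.expectation (\<lambda>x. kern_mass x - kern_upto u x)"

text \<open>The excitation that the points up to time \<open>t\<close> hold in store for the time
  after \<open>t\<close>: the remainder of the overview, taken at a fixed time instead of an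
  arrival.\<close>

definition future :: "real \<Rightarrow> 'w \<Rightarrow> ennreal" where
  "future t \<omega> = (\<Sum>i. ennreal (kern_mass (a i \<omega>) - kern_upto (t - \<tau> i \<omega>) (a i \<omega>)) * indicator {..t} (\<tau> i \<omega>))"

lemma measurable_future [measurable]: "future t \<in> borel_measurable M"
proof -
  have "(\<lambda>\<omega>. \<Sum>i. ennreal (kern_mass (a i \<omega>) - kern_upto (t - \<tau> i \<omega>) (a i \<omega>)) * indicator {..t} (\<tau> i \<omega>)) \<in> borel_measurable M"
    by measurable
  then show ?thesis by (simp add: future_def[abs_def])
qed

lemma tail_integrable: "integrable q kern_mass \<Longrightarrow> integrable q (\<lambda>x. kern_mass x - kern_upto u x)"
  by (rule Bochner_Integration.integrable_bound[where f = kern_mass])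
     (auto simp: kern_upto_le_mass intro!: borel_measurable_diff)

lemma mean_tail_nonneg: "mean_tail u \<ge> 0"
  unfolding mean_tail_def by (rule Bochner_Integration.integral_nonneg) (simp add: kern_upto_le_mass)

lemma mean_tail_antimono: "integrable q kern_mass \<Longrightarrow> u \<le> v \<Longrightarrow> mean_tail v \<le> mean_tail u"
  unfolding mean_tail_def by (intro integral_mono tail_integrable diff_left_mono kern_upto_mono)

text \<open>Points are sorted by age at time \<open>t\<close>. One of age in [k, k + 1) lies in the
  window starting at \<open>t - real k - 1\<close>, and its mean outstanding excitation is at most
  \<open>mean_tail (real k)\<close> because \<open>mean_tail\<close> decreases. By
  \<open>window_bound\<close> all windows obey the same bound; as arrivals are positive,
  \<open>n\<close> age classes with \<open>t \<le> real n\<close> suffice.\<close>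

lemma future_expectation:
  assumes int: "integrable q kern_mass" and sub: "mark.expectation kern_mass < 1" and n: "t \<le> real n"
  shows "(\<integral>\<^sup>+\<omega>. future t \<omega> \<partial>M) \<le> ennreal (\<nu> / (1 - mark.expectation kern_mass) * (\<Sum>k<n. mean_tail (real k)))"
proof -
  have "(\<integral>\<^sup>+\<omega>. future t \<omega> \<partial>M) = (\<Sum>i. \<integral>\<^sup>+\<omega>. ennreal (kern_mass (a i \<omega>) - kern_upto (t - \<tau> i \<omega>) (a i \<omega>)) * indicator {..t} (\<tau> i \<omega>) \<partial>M)"
    unfolding future_def by (rule nn_integral_suminf) measurable
  also have "\<dots> = (\<Sum>i. \<integral>\<^sup>+\<omega>. ennreal (mean_tail (t - \<tau> i \<omega>)) * indicator {..t} (\<tau> i \<omega>) \<partial>M)"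
  proof (intro suminf_cong)
    fix i
    have "(\<integral>\<^sup>+\<omega>. ennreal (kern_mass (a i \<omega>) - kern_upto (t - \<tau> i \<omega>) (a i \<omega>)) * indicator {..t} (\<tau> i \<omega>) \<partial>M) =
      (\<integral>\<^sup>+\<omega>. (\<integral>\<^sup>+x. ennreal (kern_mass x - kern_upto (t - \<tau> i \<omega>) x) * indicator {..t} (\<tau> i \<omega>) \<partial>q) \<partial>M)"
      using nn_integral_mark[of "\<lambda>z. ennreal (kern_mass (snd z) - kern_upto (t - fst z) (snd z)) * indicator {..t} (fst z)" i]
      by simp
    also have "\<dots> = (\<integral>\<^sup>+\<omega>. ennreal (mean_tail (t - \<tau> i \<omega>)) * indicator {..t} (\<tau> i \<omega>) \<partial>M)"
      unfolding mean_tail_def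
      by (intro nn_integral_cong, subst nn_integral_multc, measurable, subst nn_integral_eq_integral[OF tail_integrable[OF int]])
         (simp_all add: kern_upto_le_mass)
    finally show "(\<integral>\<^sup>+\<omega>. ennreal (kern_mass (a i \<omega>) - kern_upto (t - \<tau> i \<omega>) (a i \<omega>)) * indicator {..t} (\<tau> i \<omega>) \<partial>M) = \<dots>" .
  qed
  also have "\<dots> \<le> (\<Sum>i. \<integral>\<^sup>+\<omega>. (\<Sum>k<n. ennreal (mean_tail (real k)) * indicator {t - real k - 1<..t - real k - 1 + 1} (\<tau> i \<omega>)) \<partial>M)"
  proof (intro suminf_le nn_integral_mono)
    fix i \<omega> assume \<omega>: "\<omega> \<in> space M"
    show "ennreal (mean_tail (t - \<tau> i \<omega>)) * indicator {..t} (\<tau> i \<omega>) \<le>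
        (\<Sum>k<n. ennreal (mean_tail (real k)) * indicator {t - real k - 1<..t - real k - 1 + 1} (\<tau> i \<omega>))"
    proof (cases "\<tau> i \<omega> \<le> t")
      case True
      define k where "k = nat \<lfloor>t - \<tau> i \<omega>\<rfloor>"
      have k: "real k \<le> t - \<tau> i \<omega>" "t - \<tau> i \<omega> < real k + 1"
        unfolding k_def using True by (auto simp: of_nat_nat)
      with n arrival_pos[OF \<omega>, of i] have "k < n" by linarith
      have "ennreal (mean_tail (t - \<tau> i \<omega>)) * indicator {..t} (\<tau> i \<omega>) \<le>
          ennreal (mean_tail (real k)) * indicator {t - real k - 1<..t - real k - 1 + 1} (\<tau> i \<omega>)"
        using True k mean_tail_antimono[OF int k(1)] by (auto simp: indicator_def intro: ennreal_leI)
      also have "\<dots> \<le> (\<Sum>k<n. ennreal (mean_tail (real k)) * indicator {t - real k - 1<..t - real k - 1 + 1} (\<tau> i \<omega>))"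
        using \<open>k < n\<close> by (intro member_le_sum) auto
      finally show ?thesis .
    qed simp
  qed simp_all
  also have "\<dots> = (\<integral>\<^sup>+\<omega>. (\<Sum>i. \<Sum>k<n. ennreal (mean_tail (real k)) * indicator {t - real k - 1<..t - real k - 1 + 1} (\<tau> i \<omega>)) \<partial>M)"
    by (rule nn_integral_suminf[symmetric]) measurable
  also have "\<dots> = (\<integral>\<^sup>+\<omega>. (\<Sum>k<n. ennreal (mean_tail (real k)) * (\<Sum>i. indicator {t - real k - 1<..t - real k - 1 + 1} (\<tau> i \<omega>))) \<partial>M)"
    by (intro nn_integral_cong) (simp only: suminf_sum[OF summableI] ennreal_suminf_cmult)
  also have "\<dots> = (\<Sum>k<n. ennreal (mean_tail (real k)) * window (t - real k - 1))"
    unfolding window_def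
    by (subst nn_integral_sum, measurable, intro sum.cong refl nn_integral_cmult, measurable)
  also have "\<dots> \<le> (\<Sum>k<n. ennreal (mean_tail (real k)) * ennreal (\<nu> / (1 - mark.expectation kern_mass)))"
    by (intro sum_mono mult_left_mono window_bound int sub) simp
  also have "\<dots> = ennreal (\<nu> / (1 - mark.expectation kern_mass) * (\<Sum>k<n. mean_tail (real k)))"
    using sub base_rate_pos mean_tail_nonneg
    by (simp add: ennreal_mult[symmetric] sum_ennreal sum_distrib_left sum_divide_distrib mult.commute)
  finally show ?thesis .
qed

lemma mean_tail_eq:
  assumes int: "integrable q kern_mass" and "t > 0"
  shows "(LINT s:{t..}|lborel. mark.expectation (\<lambda>x. h s x)) = mean_tail t"
proof -
  interpret P: pair_sigma_finite lborel q ..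
  have h_kern: "mark.expectation (\<lambda>x. h s x) = mark.expectation (\<lambda>x. kern s x)" if "s > 0" for s
  proof (rule integral_cong_AE)
    have "(\<lambda>x. h (max 0 s) x) \<in> borel_measurable q" by (rule measurable_excitation_max) auto
    with that show "(\<lambda>x. h s x) \<in> borel_measurable q" by (simp add: max_def)
    show "(\<lambda>x. kern s x) \<in> borel_measurable q" by measurable
    show "AE x in q. h s x = kern s x"
      using AE_excitation_finite AE_space by eventually_elim (use that in \<open>simp add: kern_def\<close>)
  qed
  have "integrable (lborel \<Otimes>\<^sub>M q) (\<lambda>(s, x). indicator {t..} s * kern s x)"
  proof (rule integrableI_nonneg)
    show "(\<lambda>(s, x). indicator {t..} s * kern s x) \<in> borel_measurable (lborel \<Otimes>\<^sub>M q)" by measurable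
    have "(\<integral>\<^sup>+z. ennreal (case z of (s, x) \<Rightarrow> indicator {t..} s * kern s x) \<partial>(lborel \<Otimes>\<^sub>M q)) \<le>
        (\<integral>\<^sup>+z. ennreal (kern (fst z) (snd z)) \<partial>(lborel \<Otimes>\<^sub>M q))"
      by (intro nn_integral_mono) (auto simp: indicator_def)
    also have "\<dots> = (\<integral>\<^sup>+s. mean_kern s \<partial>lborel)"
      unfolding mean_kern_def by (subst mark.nn_integral_fst[symmetric]) simp_all
    also have "\<dots> < \<infinity>"
      using nn_integral_eq_integral[OF int] by (simp add: nn_integral_mean_kern)
    finally show "(\<integral>\<^sup>+z. ennreal (case z of (s, x) \<Rightarrow> indicator {t..} s * kern s x) \<partial>(lborel \<Otimes>\<^sub>M q)) < \<infinity>" .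
  qed (auto split: prod.split)
  from P.Fubini_integral[OF this]
  have "(LINT s|lborel. (LINT x|q. indicator {t..} s * kern s x)) = (LINT x|q. (LINT s|lborel. indicator {t..} s * kern s x))"
    by simp
  moreover have "(LINT s:{t..}|lborel. mark.expectation (\<lambda>x. h s x)) = (LINT s|lborel. (LINT x|q. indicator {t..} s * kern s x))"
    unfolding set_lebesgue_integral_def
  proof (rule Bochner_Integration.integral_cong[OF refl])
    fix s
    show "indicator {t..} s *\<^sub>R mark.expectation (\<lambda>x. h s x) = (LINT x|q. indicator {t..} s * kern s x)"
      using h_kern[of s] \<open>t > 0\<close> by (auto simp: indicator_def)
  qed
  moreover have "(LINT s|lborel. indicator {t..} s * kern s x) = kern_mass x - kern_upto t x" for x
  proof -
    have "(LINT s|lborel. indicator {t..} s * kern s x) = (LINT s:{t<..}|lborel. kern s x)"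
      unfolding set_lebesgue_integral_def
    proof (rule integral_cong_AE)
      show "AE s in lborel. indicator {t..} s * kern s x = indicator {t<..} s *\<^sub>R kern s x"
        using AE_lborel_singleton[of t] by eventually_elim (auto simp: indicator_def)
    qed measurable
    then show ?thesis by (simp add: kern_tail)
  qed
  ultimately show ?thesis by (simp add: mean_tail_def)
qed

end

subsection \<open>The central limit theorem\<close>

text \<open>The reflected form is the one in which the limit appears later: few points by time
  \<open>t\<close> means a late arrival, hence an upper tail of the walk. The proof uses that the
  scaled normal law is the image of the standard one under multiplication by \<open>- s\<close>, and
  that single points have mass 0.\<close>

lemma cdf_scaled_normal:
  assumes "s > 0"
  shows "cdf (density lborel (normal_density 0 s)) x = 1 - cdf std_normal_distribution (- x / s)"
proof -
  interpret N: real_distribution std_normal_distribution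
    by (rule real_dist_normal_dist)
  have "distributed std_normal_distribution lborel (\<lambda>z. z) (normal_density 0 1)"
    by (simp add: distributed_def distr_id2)
  from N.normal_density_affine[OF this, of "- s" 0]
  have "distributed std_normal_distribution lborel (\<lambda>z. - s * z) (normal_density 0 s)"
    using assms by simp
  then have "density lborel (normal_density 0 s) = distr std_normal_distribution lborel (\<lambda>z. - s * z)"
    by (simp add: distributed_def)
  then have "cdf (density lborel (normal_density 0 s)) x = measure std_normal_distribution {z. - s * z \<le> x}"
    by (simp add: cdf_def measure_distr vimage_def)
  also have "{z. - s * z \<le> x} = space std_normal_distribution - {..< - x / s}"
    using assms by (auto simp: field_simps not_less)
  also have "measure std_normal_distribution \<dots> = 1 - measure std_normal_distribution {..< - x / s}"
    by (rule N.prob_compl) simp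
  also have "measure std_normal_distribution {..< - x / s} = cdf std_normal_distribution (- x / s)"
  proof -
    have "emeasure std_normal_distribution {- x / s} = 0"
      by (subst emeasure_density) (auto intro!: nn_integral_null_set)
    then have "measure std_normal_distribution {- x / s} = 0" by (simp add: measure_def)
    moreover have "measure std_normal_distribution ({..< - x / s} \<union> {- x / s}) =
        measure std_normal_distribution {..< - x / s} + measure std_normal_distribution {- x / s}"
      by (rule N.finite_measure_Union) auto
    moreover have "{..< - x / s} \<union> {- x / s} = {..- x / s}" by auto
    ultimately show ?thesis unfolding cdf_def by simp
  qed
  finally show ?thesis .
qed

lemma isCont_cdf_std_normal: "isCont (cdf std_normal_distribution) x"
proof -
  interpret N: real_distribution std_normal_distribution
    by (rule real_dist_normal_dist)
  have "emeasure std_normal_distribution {x} = 0"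
    by (subst emeasure_density) (auto intro!: nn_integral_null_set)
  then show ?thesis by (simp add: N.isCont_cdf measure_def)
qed

context marked_hawkes
begin

section \<open>Comparison of counts, arrivals and the walk\<close>

lemma num_points_le_iff:
  assumes \<omega>: "\<omega> \<in> space M"
  shows "num_points \<tau> 0 t \<omega> \<le> n \<longleftrightarrow> t < \<tau> n \<omega>"
proof -
  have S: "{i. 0 < \<tau> i \<omega> \<and> \<tau> i \<omega> \<le> t} = {i. \<tau> i \<omega> \<le> t}" using arrival_pos[OF \<omega>] by auto
  show ?thesis
  proof (cases "t < \<tau> n \<omega>")
    case True
    have "{i. \<tau> i \<omega> \<le> t} \<subseteq> {..<n}"
    proof safe
      fix i assume "\<tau> i \<omega> \<le> t"
      with True have "\<tau> i \<omega> < \<tau> n \<omega>" by linarith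
      then show "i < n" using arrival_less_iff[OF \<omega>] by simp
    qed
    from card_mono[OF _ this] True show ?thesis by (simp add: num_points_def S)
  next
    case False
    have "{..n} \<subseteq> {i. \<tau> i \<omega> \<le> t}"
    proof safe
      fix i assume "i \<le> n"
      then have "\<tau> i \<omega> \<le> \<tau> n \<omega>" using arrival_le_iff[OF \<omega>] by simp
      with False show "\<tau> i \<omega> \<le> t" by linarith
    qed
    from card_mono[OF finite_arrivals[OF \<omega>] this] False show ?thesis by (simp add: num_points_def S)
  qed
qed

text \<open>At the first arrival after \<open>t\<close> the compensator is at least its value at
  \<open>t\<close>. Subtracting the full excitation of all points up to \<open>t\<close> leaves
  \<nu> t minus what these points have not yet spent, which is \<open>future t\<close>. Of the
  random index only the bound by \<open>n\<close> is kept, ready for a maximum over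
  \<open>k\<close>.\<close>

lemma walk_ge_future:
  assumes \<omega>: "\<omega> \<in> space M" and "t < \<tau> n \<omega>"
  shows "\<exists>k\<le>n. ennreal (\<nu> * t - walk k \<omega>) \<le> future t \<omega>"
proof (intro exI conjI)
  \<comment> \<open>Arrivals are indexed from 0, so the arrival with this index is the first one
    after \<open>t\<close>.\<close>
  define k where "k = num_points \<tau> 0 t \<omega>"
  show "k \<le> n" unfolding k_def using num_points_le_iff[OF \<omega>] assms(2) by simp
  have tk: "t < \<tau> k \<omega>" using num_points_le_iff[OF \<omega>, of t k] by (simp add: k_def)
  have early: "\<tau> i \<omega> \<le> t" if "i < k" for i
    using num_points_le_iff[OF \<omega>, of t i] that by (simp add: k_def)
  have "\<nu> * t + (\<Sum>i<k. kern_upto (t - \<tau> i \<omega>) (a i \<omega>)) \<le> pcomp k (\<tau> k \<omega>) \<omega>"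
    using pcomp_mono[of t "\<tau> k \<omega>" k \<omega>] tk by (simp add: pcomp_def)
  then have "\<nu> * t - walk k \<omega> \<le> (\<Sum>i<k. kern_mass (a i \<omega>) - kern_upto (t - \<tau> i \<omega>) (a i \<omega>))"
    by (simp add: walk_def sum_subtractf)
  then have "ennreal (\<nu> * t - walk k \<omega>) \<le> ennreal (\<Sum>i<k. kern_mass (a i \<omega>) - kern_upto (t - \<tau> i \<omega>) (a i \<omega>))"
    by (rule ennreal_leI)
  also have "\<dots> = (\<Sum>i<k. ennreal (kern_mass (a i \<omega>) - kern_upto (t - \<tau> i \<omega>) (a i \<omega>)) * indicator {..t} (\<tau> i \<omega>))"
    using early by (subst sum_ennreal[symmetric]) (auto simp: kern_upto_le_mass intro!: sum.cong)
  also have "\<dots> \<le> future t \<omega>"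
    unfolding future_def by (rule sum_le_suminf) auto
  finally show "ennreal (\<nu> * t - walk k \<omega>) \<le> future t \<omega>" .
qed

text \<open>Markov's inequality with the bound of \<open>future_expectation\<close>: the sum of the
  mean tails at integer times is of smaller order than \<open>sqrt t\<close> by
  \<open>sum_o_sqrt\<close>.\<close>

lemma future_negligible:
  assumes int: "integrable q kern_mass" and sub: "mark.expectation kern_mass < 1"
    and tail: "((\<lambda>t. sqrt t * mean_tail t) \<longlongrightarrow> 0) at_top" and "\<epsilon> > 0"
  shows "((\<lambda>t. prob {\<omega> \<in> space M. ennreal (\<epsilon> * sqrt t) \<le> future t \<omega>}) \<longlongrightarrow> 0) at_top"
proof -
  define C where "C = \<nu> / (1 - mark.expectation kern_mass)"
  have C: "C \<ge> 0" using sub base_rate_pos by (simp add: C_def)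
  define T where "T n = (\<Sum>k<n. mean_tail (real k)) / sqrt (real n)" for n
  have "(\<lambda>k. sqrt (real k) * mean_tail (real k)) \<longlonglongrightarrow> 0"
    by (rule filterlim_compose[OF tail filterlim_real_sequentially])
  then have T: "T \<longlonglongrightarrow> 0"
    unfolding T_def by (rule sum_o_sqrt[OF mean_tail_nonneg])
  have "filterlim (\<lambda>t::real. nat \<lceil>t\<rceil>) sequentially at_top"
    unfolding filterlim_at_top
  proof
    fix Z :: nat
    show "eventually (\<lambda>t::real. Z \<le> nat \<lceil>t\<rceil>) at_top"
      using eventually_ge_at_top[of "real Z"] by eventually_elim linarith
  qed
  from filterlim_compose[OF T this] have "((\<lambda>t::real. T (nat \<lceil>t\<rceil>)) \<longlongrightarrow> 0) at_top" .
  then have lim: "((\<lambda>t::real. C * 2 / \<epsilon> * T (nat \<lceil>t\<rceil>)) \<longlongrightarrow> 0) at_top"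
    by (rule tendsto_mult_right_zero)
  have "eventually (\<lambda>t. prob {\<omega> \<in> space M. ennreal (\<epsilon> * sqrt t) \<le> future t \<omega>} \<le> C * 2 / \<epsilon> * T (nat \<lceil>t\<rceil>)) at_top"
    using eventually_ge_at_top[of "1::real"]
  proof eventually_elim
    case (elim t)
    define n where "n = nat \<lceil>t\<rceil>"
    \<comment> \<open>The factor 4 is a convenient one because its square root is 2; rounding up and
      \<open>t \<ge> 1\<close> leave room for it.\<close>
    have n: "t \<le> real n" "real n \<le> 4 * t" "n > 0" using elim unfolding n_def by linarith+
    have "emeasure M {\<omega> \<in> space M. ennreal (\<epsilon> * sqrt t) \<le> future t \<omega>} \<le>
        emeasure M ({\<omega> \<in> space M. 1 \<le> ennreal (1 / (\<epsilon> * sqrt t)) * future t \<omega>})"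
    proof (intro emeasure_mono, safe)
      fix \<omega> assume "ennreal (\<epsilon> * sqrt t) \<le> future t \<omega>"
      then have "ennreal (1 / (\<epsilon> * sqrt t)) * ennreal (\<epsilon> * sqrt t) \<le> ennreal (1 / (\<epsilon> * sqrt t)) * future t \<omega>"
        by (rule mult_left_mono) simp
      also have "ennreal (1 / (\<epsilon> * sqrt t)) * ennreal (\<epsilon> * sqrt t) = 1"
        using \<open>\<epsilon> > 0\<close> elim by (simp add: ennreal_mult[symmetric])
      finally show "1 \<le> ennreal (1 / (\<epsilon> * sqrt t)) * future t \<omega>" .
    qed measurable
    also have "\<dots> \<le> ennreal (1 / (\<epsilon> * sqrt t)) * (\<integral>\<^sup>+\<omega>. future t \<omega> * indicator (space M) \<omega> \<partial>M)"
      using nn_integral_Markov_inequality[of "future t" "space M" M "ennreal (1 / (\<epsilon> * sqrt t))"] by simp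
    also have "(\<integral>\<^sup>+\<omega>. future t \<omega> * indicator (space M) \<omega> \<partial>M) = (\<integral>\<^sup>+\<omega>. future t \<omega> \<partial>M)"
      by (intro nn_integral_cong) simp
    also have "\<dots> \<le> ennreal (C * (\<Sum>k<n. mean_tail (real k)))"
      unfolding C_def by (rule future_expectation[OF int sub n(1)])
    finally have "emeasure M {\<omega> \<in> space M. ennreal (\<epsilon> * sqrt t) \<le> future t \<omega>} \<le>
        ennreal (1 / (\<epsilon> * sqrt t)) * ennreal (C * (\<Sum>k<n. mean_tail (real k)))"
      by (simp add: mult_left_mono)
    also have "\<dots> = ennreal (1 / (\<epsilon> * sqrt t) * (C * (\<Sum>k<n. mean_tail (real k))))"
      using \<open>\<epsilon> > 0\<close> elim by (intro ennreal_mult'[symmetric]) simp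
    finally have "prob {\<omega> \<in> space M. ennreal (\<epsilon> * sqrt t) \<le> future t \<omega>} \<le>
        1 / (\<epsilon> * sqrt t) * (C * (\<Sum>k<n. mean_tail (real k)))"
      using \<open>\<epsilon> > 0\<close> elim C
      by (simp add: emeasure_eq_measure ennreal_le_iff sum_nonneg mean_tail_nonneg)
    also have "\<dots> = (C / \<epsilon> * (\<Sum>k<n. mean_tail (real k))) * (1 / sqrt t)"
      by simp
    also have "\<dots> \<le> (C / \<epsilon> * (\<Sum>k<n. mean_tail (real k))) * (2 / sqrt (real n))"
    proof (rule mult_left_mono)
      have "sqrt (real n) \<le> 2 * sqrt t" using real_sqrt_le_mono[OF n(2)] by (simp add: real_sqrt_mult)
      then show "1 / sqrt t \<le> 2 / sqrt (real n)" using n elim by (simp add: field_simps)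
      show "0 \<le> C / \<epsilon> * (\<Sum>k<n. mean_tail (real k))"
        using C \<open>\<epsilon> > 0\<close> by (simp add: sum_nonneg mean_tail_nonneg)
    qed
    also have "\<dots> = C * 2 / \<epsilon> * T n" by (simp add: T_def mult_ac)
    finally show ?case by (simp only: n_def)
  qed
  then show ?thesis
    by (intro tendsto_sandwich[OF _ _ tendsto_const lim]) simp_all
qed

lemma walk_0_negligible:
  assumes "\<epsilon> > 0"
  shows "((\<lambda>t. prob {\<omega> \<in> space M. \<epsilon> * sqrt t < walk 0 \<omega>}) \<longlongrightarrow> 0) at_top"
proof -
  have [measurable]: "walk 0 \<in> borel_measurable M" unfolding walk_0[abs_def] by measurable
  interpret D: real_distribution "distr M borel (walk 0)" by (rule real_distribution_distr) simp
  have "filterlim (\<lambda>t. \<epsilon> * sqrt t) at_top at_top"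
    by (rule filterlim_tendsto_pos_mult_at_top[OF tendsto_const assms sqrt_at_top])
  from filterlim_compose[OF D.cdf_lim_at_top_prob this]
  have "((\<lambda>t. 1 - cdf (distr M borel (walk 0)) (\<epsilon> * sqrt t)) \<longlongrightarrow> 1 - 1) at_top"
    by (intro tendsto_diff tendsto_const)
  moreover have "1 - cdf (distr M borel (walk 0)) y = prob {\<omega> \<in> space M. y < walk 0 \<omega>}" for y
  proof -
    have "cdf (distr M borel (walk 0)) y = prob {\<omega> \<in> space M. \<not> y < walk 0 \<omega>}"
      by (simp add: cdf_def measure_distr vimage_def Int_def conj_commute not_less)
    then show ?thesis using prob_neg[of "\<lambda>\<omega>. y < walk 0 \<omega>"] by simp
  qed
  ultimately show ?thesis by simp
qed

section \<open>The standardised walk and tail bounds for arrivals\<close>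

definition fluctuation :: "nat \<Rightarrow> 'w \<Rightarrow> real" where
  "fluctuation n \<omega> = (walk n \<omega> - walk 0 \<omega> - real n * (1 - mark.expectation kern_mass)) /
    sqrt (real n * (1 + mark.variance kern_mass))"

text \<open>Subtracting \<open>walk 0\<close> leaves a sum of independent steps whose common law is
  that of an exponential variable minus an independent excitation, as the classical theorem
  requires.\<close>

lemma fluctuation_clt:
  assumes sq: "integrable q (\<lambda>x. (kern_mass x)\<^sup>2)"
  shows "(\<lambda>n. cdf (distr M borel (fluctuation n)) x) \<longlonglongrightarrow> cdf std_normal_distribution x"
proof -
  interpret W: adapted_walk M premark walk "1 - mark.expectation kern_mass" "1 + mark.variance kern_mass"
    by (rule adapted_walk[OF sq])
  let ?c = "1 - mark.expectation kern_mass" and ?v = "1 + mark.variance kern_mass"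
  have v: "?v > 0" using mark.variance_positive[of kern_mass] by linarith
  have "weak_conv_m (\<lambda>n. distr M borel (\<lambda>\<omega>. (\<Sum>i<n. walk (Suc i) \<omega> - walk i \<omega> - ?c) / sqrt (real n * (sqrt ?v)\<^sup>2)))
      std_normal_distribution"
    by (rule central_limit_theorem[where X = "\<lambda>i \<omega>. walk (Suc i) \<omega> - walk i \<omega>"
          and \<mu> = "distr (density lborel (exponential_density 1) \<Otimes>\<^sub>M q) borel (\<lambda>(y, x). y - kern_mass x)"])
       (use v in \<open>auto intro: W.increments_indep W.square_integrable W.mean walk_increment_distr simp: W.var\<close>)
  moreover have "(\<lambda>\<omega>. (\<Sum>i<n. walk (Suc i) \<omega> - walk i \<omega> - ?c) / sqrt (real n * (sqrt ?v)\<^sup>2)) = fluctuation n" for n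
  proof
    fix \<omega>
    show "(\<Sum>i<n. walk (Suc i) \<omega> - walk i \<omega> - ?c) / sqrt (real n * (sqrt ?v)\<^sup>2) = fluctuation n \<omega>"
      using v sum_lessThan_telescope[of "\<lambda>i. walk i \<omega>" n]
      by (simp add: fluctuation_def sum_subtractf[of "\<lambda>i. walk (Suc i) \<omega> - walk i \<omega>" "\<lambda>_. ?c"])
  qed
  ultimately show ?thesis
    using isCont_cdf_std_normal by (simp add: weak_conv_m_def weak_conv_def)
qed

lemma measurable_fluctuation:
  assumes "integrable q (\<lambda>x. (kern_mass x)\<^sup>2)"
  shows "fluctuation n \<in> borel_measurable M"
proof -
  interpret W: adapted_walk M premark walk "1 - mark.expectation kern_mass" "1 + mark.variance kern_mass"
    by (rule adapted_walk[OF assms])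
  show ?thesis unfolding fluctuation_def[abs_def] by measurable
qed

lemma walk_tail_eq:
  assumes sq: "integrable q (\<lambda>x. (kern_mass x)\<^sup>2)" and "n > 0"
  shows "prob {\<omega> \<in> space M. y < walk n \<omega> - walk 0 \<omega>} =
    1 - cdf (distr M borel (fluctuation n))
      ((y - real n * (1 - mark.expectation kern_mass)) / sqrt (real n * (1 + mark.variance kern_mass)))"
proof -
  let ?c = "1 - mark.expectation kern_mass" and ?v = "1 + mark.variance kern_mass"
  let ?z = "(y - real n * ?c) / sqrt (real n * ?v)"
  have [measurable]: "fluctuation n \<in> borel_measurable M" by (rule measurable_fluctuation[OF sq])
  have pos: "sqrt (real n * ?v) > 0"
    using mark.variance_positive[of kern_mass] \<open>n > 0\<close> by (simp add: add_pos_nonneg)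
  have div: "x / s < x' / s \<longleftrightarrow> x < x'" if "s > 0" for x x' s :: real
    using that by (simp add: divide_less_cancel)
  have iff: "y < walk n \<omega> - walk 0 \<omega> \<longleftrightarrow> ?z < fluctuation n \<omega>" for \<omega>
    unfolding fluctuation_def by (simp only: div[OF pos]) simp
  have "cdf (distr M borel (fluctuation n)) ?z = prob {\<omega> \<in> space M. \<not> ?z < fluctuation n \<omega>}"
    by (simp add: cdf_def measure_distr vimage_def Int_def conj_commute not_less)
  then show ?thesis unfolding iff using prob_neg[of "\<lambda>\<omega>. ?z < fluctuation n \<omega>"] by simp
qed

text \<open>Both discarded quantities, the residual excitation at arrival \<open>n\<close> and the
  start \<open>walk 0\<close>, are nonnegative, so this direction has no error term.\<close>

lemma arrival_tail_lower:
  "prob {\<omega> \<in> space M. \<nu> * t < walk n \<omega> - walk 0 \<omega>} \<le> prob {\<omega> \<in> space M. t < \<tau> n \<omega>}"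
proof (intro finite_measure_mono, safe)
  fix \<omega> assume \<omega>: "\<omega> \<in> space M" and "\<nu> * t < walk n \<omega> - walk 0 \<omega>"
  moreover have "walk 0 \<omega> > 0" using arrival_pos[OF \<omega>, of 0] base_rate_pos by (simp add: walk_0)
  ultimately have "\<nu> * t < \<nu> * \<tau> n \<omega>" using walk_le[of n \<omega>] by linarith
  then show "t < \<tau> n \<omega>" using base_rate_pos by simp
qed simp

text \<open>The slack \<open>3 * d\<close> is spent in three equal parts: on the excitation
  outstanding at time \<open>t\<close>, on the passage from the maximum to the endpoint in
  \<open>ottaviani\<close>, and on the start \<open>walk 0\<close>. The divisor \<open>p\<close> is
  the factor in \<open>ottaviani\<close>.\<close>

lemma arrival_tail_upper:
  fixes d :: real
  defines "p \<equiv> 1 - (1 + mark.variance kern_mass) / (4 * (1 - mark.expectation kern_mass) * d)"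
  assumes sq: "integrable q (\<lambda>x. (kern_mass x)\<^sup>2)" and sub: "mark.expectation kern_mass < 1"
    and "d > 0" and p: "p > 0"
  shows "prob {\<omega> \<in> space M. t < \<tau> n \<omega>} \<le>
    (prob {\<omega> \<in> space M. \<nu> * t - 3 * d < walk n \<omega> - walk 0 \<omega>} + prob {\<omega> \<in> space M. d < walk 0 \<omega>}) / p +
    prob {\<omega> \<in> space M. ennreal d \<le> future t \<omega>}"
proof -
  interpret W: adapted_walk M premark walk "1 - mark.expectation kern_mass" "1 + mark.variance kern_mass"
    by (rule adapted_walk[OF sq])
  have "prob {\<omega> \<in> space M. t < \<tau> n \<omega>} \<le>
      prob ({\<omega> \<in> space M. \<exists>k\<le>n. walk k \<omega> > \<nu> * t - d} \<union> {\<omega> \<in> space M. ennreal d \<le> future t \<omega>})"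
  proof (intro finite_measure_mono subsetI)
    fix \<omega> assume "\<omega> \<in> {\<omega> \<in> space M. t < \<tau> n \<omega>}"
    then have \<omega>: "\<omega> \<in> space M" "t < \<tau> n \<omega>" by auto
    obtain k where k: "k \<le> n" "ennreal (\<nu> * t - walk k \<omega>) \<le> future t \<omega>" using walk_ge_future[OF \<omega>] by auto
    show "\<omega> \<in> {\<omega> \<in> space M. \<exists>k\<le>n. walk k \<omega> > \<nu> * t - d} \<union> {\<omega> \<in> space M. ennreal d \<le> future t \<omega>}"
    proof (cases "walk k \<omega> > \<nu> * t - d")
      case True then show ?thesis using k \<omega> by auto
    next
      case False
      then have "ennreal d \<le> ennreal (\<nu> * t - walk k \<omega>)" by (intro ennreal_leI) simp
      then show ?thesis using k \<omega> by auto
    qed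
  qed measurable
  also have "\<dots> \<le> prob {\<omega> \<in> space M. \<exists>k\<le>n. walk k \<omega> > \<nu> * t - d} + prob {\<omega> \<in> space M. ennreal d \<le> future t \<omega>}"
    by (intro measure_Un_le) measurable
  finally have "p * (prob {\<omega> \<in> space M. t < \<tau> n \<omega>} - prob {\<omega> \<in> space M. ennreal d \<le> future t \<omega>}) \<le>
      p * prob {\<omega> \<in> space M. \<exists>k\<le>n. walk k \<omega> > \<nu> * t - d}"
    using p by (intro mult_left_mono) auto
  also have "\<dots> \<le> prob {\<omega> \<in> space M. walk n \<omega> > \<nu> * t - d - d}"
    unfolding p_def using sub \<open>d > 0\<close> by (intro W.ottaviani) auto
  also have "\<dots> \<le> prob ({\<omega> \<in> space M. \<nu> * t - 3 * d < walk n \<omega> - walk 0 \<omega>} \<union> {\<omega> \<in> space M. d < walk 0 \<omega>})"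
    by (intro finite_measure_mono) auto
  also have "\<dots> \<le> prob {\<omega> \<in> space M. \<nu> * t - 3 * d < walk n \<omega> - walk 0 \<omega>} + prob {\<omega> \<in> space M. d < walk 0 \<omega>}"
    by (intro measure_Un_le) measurable
  finally show ?thesis using p by (simp add: field_simps)
qed

lemma asymptotic_normality:
  assumes sq: "integrable q (\<lambda>x. (kern_mass x)\<^sup>2)" and sub: "mark.expectation kern_mass < 1"
    and tail: "((\<lambda>t. sqrt t * mean_tail t) \<longlongrightarrow> 0) at_top"
  defines "c \<equiv> 1 - mark.expectation kern_mass" and "V \<equiv> 1 + mark.variance kern_mass"
  shows "((\<lambda>t. prob {\<omega> \<in> space M. (real (num_points \<tau> 0 t \<omega>) - \<nu> * t / c) / sqrt t \<le> x}) \<longlongrightarrow>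
    1 - cdf std_normal_distribution (- x / sqrt (\<nu> * V / c ^ 3))) at_top"
proof -
  have int: "integrable q kern_mass"
    by (rule mark.square_integrable_imp_integrable[OF _ sq]) simp
  have c: "c > 0" using sub by (simp add: c_def)
  have V: "V > 0" using mark.variance_positive[of kern_mass] by (simp add: V_def add_pos_nonneg)
  define \<Phi> where "\<Phi> = cdf std_normal_distribution"
  define \<mu> where "\<mu> = \<nu> / c"
  have \<mu>: "\<mu> > 0" using c base_rate_pos by (simp add: \<mu>_def)
  \<comment> \<open>The value that the count must not exceed. Counts are integers, so
    \<open>b t\<close> may be rounded down to \<open>n t\<close> and the event becomes a statement
    about the arrival with index \<open>n t\<close>.\<close>
  define b where "b t = \<mu> * t + x * sqrt t" for t
  define n where "n t = nat \<lfloor>b t\<rfloor>" for t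
  define g where "g t = prob {\<omega> \<in> space M. t < \<tau> (n t) \<omega>}" for t
  \<comment> \<open>The level at which the tail of the standardised walk is read when
    \<open>d\<close> is taken as \<epsilon> times \<open>sqrt t\<close>; \<open>w\<close> is its
    limit.\<close>
  define z where "z \<epsilon> t = (\<nu> * t - 3 * (\<epsilon> * sqrt t) - real (n t) * c) / sqrt (real (n t) * V)" for \<epsilon> t
  define w where "w \<epsilon> = (- x * c - 3 * \<epsilon>) / sqrt (\<mu> * V)" for \<epsilon>
  have b_top: "filterlim b at_top at_top"
    unfolding b_def using \<mu> by real_asymp
  have ev: "eventually (\<lambda>t. t \<ge> 1 \<and> b t \<ge> 1) at_top"
    using b_top by (auto simp: filterlim_at_top intro: eventually_conj eventually_ge_at_top)
  have n: "b t - 1 \<le> real (n t)" "real (n t) \<le> b t" "n t > 0" if "b t \<ge> 1" for t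
    using that unfolding n_def by linarith+
  have n_top: "filterlim n sequentially at_top"
    unfolding filterlim_at_top
  proof
    fix Z :: nat
    have "eventually (\<lambda>t. b t \<ge> real Z + 1) at_top" using b_top by (simp add: filterlim_at_top)
    then show "eventually (\<lambda>t. Z \<le> n t) at_top"
    proof eventually_elim
      case (elim t)
      then show ?case using n(1)[of t] by linarith
    qed
  qed
  have n_over: "((\<lambda>t. real (n t) / t) \<longlongrightarrow> \<mu>) at_top"
  proof (rule tendsto_sandwich)
    show "((\<lambda>t. (b t - 1) / t) \<longlongrightarrow> \<mu>) at_top" "((\<lambda>t. b t / t) \<longlongrightarrow> \<mu>) at_top"
      unfolding b_def by real_asymp+
    show "eventually (\<lambda>t. (b t - 1) / t \<le> real (n t) / t) at_top" "eventually (\<lambda>t. real (n t) / t \<le> b t / t) at_top"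
      using ev by (eventually_elim, use n in \<open>auto intro!: divide_right_mono\<close>)+
  qed
  \<comment> \<open>Since \<mu> c = \<nu>, using \<open>b t\<close> instead of \<open>n t\<close>
    would give exactly \<open>- x * c\<close>; rounding changes the numerator by at most
    \<open>c\<close>.\<close>
  have n_dev: "((\<lambda>t. (\<nu> * t - real (n t) * c) / sqrt t) \<longlongrightarrow> - x * c) at_top"
  proof (rule tendsto_sandwich)
    show "((\<lambda>t. - x * c) \<longlongrightarrow> - x * c) at_top" by (rule tendsto_const)
    show "((\<lambda>t. - x * c + c / sqrt t) \<longlongrightarrow> - x * c) at_top"
      using c by real_asymp
    show "eventually (\<lambda>t. - x * c \<le> (\<nu> * t - real (n t) * c) / sqrt t) at_top"
      using ev
    proof eventually_elim
      case (elim t)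
      then have "real (n t) * c \<le> b t * c" using n c by simp
      also have "b t * c = \<nu> * t + x * c * sqrt t" using c by (simp add: b_def \<mu>_def field_simps)
      finally show ?case using elim by (simp add: field_simps)
    qed
    show "eventually (\<lambda>t. (\<nu> * t - real (n t) * c) / sqrt t \<le> - x * c + c / sqrt t) at_top"
      using ev
    proof eventually_elim
      case (elim t)
      then have "(b t - 1) * c \<le> real (n t) * c" using n c by simp
      moreover have "(b t - 1) * c = \<nu> * t + x * c * sqrt t - c" using c by (simp add: b_def \<mu>_def field_simps)
      ultimately have "\<nu> * t - real (n t) * c \<le> c - x * c * sqrt t" by linarith
      from divide_right_mono[OF this, of "sqrt t"] elim show ?case
        by (simp add: diff_divide_distrib)
    qed
  qed
  have z_lim: "(z \<epsilon> \<longlongrightarrow> w \<epsilon>) at_top" for \<epsilon>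
  proof -
    have "((\<lambda>t. ((\<nu> * t - real (n t) * c) / sqrt t - 3 * \<epsilon>) / sqrt (real (n t) / t * V)) \<longlongrightarrow> w \<epsilon>) at_top"
      unfolding w_def using c V \<mu>
      by (intro tendsto_divide tendsto_diff n_dev tendsto_const tendsto_real_sqrt tendsto_mult n_over) auto
    moreover have "eventually (\<lambda>t. ((\<nu> * t - real (n t) * c) / sqrt t - 3 * \<epsilon>) / sqrt (real (n t) / t * V) = z \<epsilon> t) at_top"
      using ev
    proof eventually_elim
      case (elim t)
      then have t: "sqrt t > 0" by simp
      have "(\<nu> * t - real (n t) * c) / sqrt t - 3 * \<epsilon> = (\<nu> * t - 3 * (\<epsilon> * sqrt t) - real (n t) * c) / sqrt t"
        using t by (simp add: field_simps)
      moreover have "sqrt (real (n t) / t * V) = sqrt (real (n t) * V) / sqrt t"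
        by (simp add: real_sqrt_divide real_sqrt_mult)
      ultimately show ?case using t by (simp add: z_def)
    qed
    ultimately show ?thesis by (rule Lim_transform_eventually)
  qed
  have F_lim: "((\<lambda>t. 1 - cdf (distr M borel (fluctuation (n t))) (z \<epsilon> t)) \<longlongrightarrow> 1 - \<Phi> (w \<epsilon>)) at_top" for \<epsilon>
  proof -
    have "mono (cdf (distr M borel (fluctuation k)))" for k
    proof -
      interpret D: real_distribution "distr M borel (fluctuation k)"
        by (rule real_distribution_distr[OF measurable_fluctuation[OF sq]])
      show ?thesis by (rule monoI) (rule D.cdf_nondecreasing)
    qed
    then have "((\<lambda>t. cdf (distr M borel (fluctuation (n t))) (z \<epsilon> t)) \<longlongrightarrow> \<Phi> (w \<epsilon>)) at_top"
      unfolding \<Phi>_def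
      by (rule tendsto_mono_functions_moving[OF _ fluctuation_clt[OF sq] isCont_cdf_std_normal z_lim n_top])
    then show ?thesis by (intro tendsto_diff tendsto_const)
  qed
  have walk_tail: "prob {\<omega> \<in> space M. \<nu> * t - 3 * (\<epsilon> * sqrt t) < walk (n t) \<omega> - walk 0 \<omega>} =
      1 - cdf (distr M borel (fluctuation (n t))) (z \<epsilon> t)" if "b t \<ge> 1" for \<epsilon> t
    using walk_tail_eq[OF sq n(3)[OF that]] by (simp add: z_def c_def V_def)
  have lower: "eventually (\<lambda>t. 1 - cdf (distr M borel (fluctuation (n t))) (z 0 t) \<le> g t) at_top"
    using ev
  proof eventually_elim
    case (elim t)
    then show ?case
      using walk_tail[of t 0] arrival_tail_lower[of t "n t"] by (simp add: g_def)
  qed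
  \<comment> \<open>Here \<epsilon> is fixed while \<open>t\<close> grows. The slack of order
    \<open>sqrt t\<close> tends to infinity, so the Ottaviani factor \<open>p t\<close> tends to 1,
    while both error probabilities tend to 0.\<close>
  have upper: "eventually (\<lambda>t. g t < B) at_top" if "\<epsilon> > 0" "1 - \<Phi> (w \<epsilon>) < B" for \<epsilon> B
  proof -
    define p where "p t = 1 - V / (4 * c * (\<epsilon> * sqrt t))" for t
    define u where "u t = ((1 - cdf (distr M borel (fluctuation (n t))) (z \<epsilon> t)) +
      prob {\<omega> \<in> space M. \<epsilon> * sqrt t < walk 0 \<omega>}) / p t + prob {\<omega> \<in> space M. ennreal (\<epsilon> * sqrt t) \<le> future t \<omega>}" for t
    have p: "(p \<longlongrightarrow> 1) at_top"
      unfolding p_def using c V \<open>\<epsilon> > 0\<close> by real_asymp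
    have "(u \<longlongrightarrow> ((1 - \<Phi> (w \<epsilon>)) + 0) / 1 + 0) at_top"
      unfolding u_def
      by (intro tendsto_add tendsto_divide F_lim p walk_0_negligible future_negligible int sub tail that) simp
    then have "eventually (\<lambda>t. u t < B) at_top" using that(2) by (intro order_tendstoD(2)) auto
    moreover have "eventually (\<lambda>t. p t > 0) at_top" using p by (intro order_tendstoD(1)) auto
    ultimately show ?thesis using ev
    proof eventually_elim
      case (elim t)
      have "g t \<le> u t"
        using arrival_tail_upper[OF sq sub, of "\<epsilon> * sqrt t" t "n t"] elim \<open>\<epsilon> > 0\<close> walk_tail[of t \<epsilon>]
        by (simp add: g_def u_def p_def c_def V_def)
      with elim show ?case by simp
    qed
  qed
  have g_lim: "(g \<longlongrightarrow> 1 - \<Phi> (w 0)) at_top"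
  proof (rule order_tendstoI)
    fix B assume "B < 1 - \<Phi> (w 0)"
    from order_tendstoD(1)[OF F_lim this] lower show "eventually (\<lambda>t. B < g t) at_top"
      by eventually_elim linarith
  next
    fix B assume B: "1 - \<Phi> (w 0) < B"
    \<comment> \<open>The slack is removed only after the limit in \<open>t\<close>, using
      continuity of the normal distribution function. The lower bound already has \<epsilon> =
      0.\<close>
    have "(w \<longlongrightarrow> w 0) (at_right 0)"
      unfolding w_def using c V \<mu> by (intro tendsto_intros) auto
    then have "((\<lambda>\<epsilon>. 1 - \<Phi> (w \<epsilon>)) \<longlongrightarrow> 1 - \<Phi> (w 0)) (at_right 0)"
      unfolding \<Phi>_def by (intro tendsto_diff tendsto_const isCont_tendsto_compose[OF isCont_cdf_std_normal])
    from order_tendstoD(2)[OF this B] eventually_at_right_less[of "0::real"]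
    have "eventually (\<lambda>\<epsilon>. 1 - \<Phi> (w \<epsilon>) < B \<and> 0 < \<epsilon>) (at_right 0)"
      by (rule eventually_conj)
    then obtain \<epsilon> where "\<epsilon> > 0" "1 - \<Phi> (w \<epsilon>) < B"
      using eventually_happens'[OF trivial_limit_at_right_real] by blast
    then show "eventually (\<lambda>t. g t < B) at_top" by (rule upper)
  qed
  \<comment> \<open>Cancelling the drift \<open>c\<close> in the numerator against the root of \<mu>
    V = \<nu> V / c produces the third power.\<close>
  have "w 0 = - x / sqrt (\<nu> * V / c ^ 3)"
  proof -
    have "\<mu> * V = (\<nu> * V / c ^ 3) * c\<^sup>2"
      using c by (simp add: \<mu>_def field_simps power2_eq_square power3_eq_cube)
    then have "sqrt (\<mu> * V) = sqrt ((\<nu> * V / c ^ 3) * c\<^sup>2)" by (simp only:)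
    also have "\<dots> = sqrt (\<nu> * V / c ^ 3) * c"
      using c by (simp only: real_sqrt_mult real_sqrt_abs abs_of_pos)
    finally have "sqrt (\<mu> * V) = sqrt (\<nu> * V / c ^ 3) * c" .
    then show ?thesis using c by (simp add: w_def)
  qed
  moreover have "eventually (\<lambda>t. g t = prob {\<omega> \<in> space M. (real (num_points \<tau> 0 t \<omega>) - \<nu> * t / c) / sqrt t \<le> x}) at_top"
    using ev
  proof eventually_elim
    case (elim t)
    have "t < \<tau> (n t) \<omega> \<longleftrightarrow> (real (num_points \<tau> 0 t \<omega>) - \<nu> * t / c) / sqrt t \<le> x" if "\<omega> \<in> space M" for \<omega>
    proof -
      have "t < \<tau> (n t) \<omega> \<longleftrightarrow> num_points \<tau> 0 t \<omega> \<le> n t"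
        using num_points_le_iff[OF that] by simp
      also have "\<dots> \<longleftrightarrow> real (num_points \<tau> 0 t \<omega>) \<le> b t"
        unfolding n_def using elim by (simp add: nat_le_eq_zle le_nat_iff le_floor_iff)
      also have "\<dots> \<longleftrightarrow> (real (num_points \<tau> 0 t \<omega>) - \<nu> * t / c) / sqrt t \<le> x"
        unfolding b_def \<mu>_def using elim by (simp add: pos_divide_le_eq algebra_simps)
      finally show ?thesis .
    qed
    then show ?case unfolding g_def by (intro arg_cong[where f = prob]) auto
  qed
  ultimately show ?thesis
    using Lim_transform_eventually[OF g_lim] by (simp add: \<Phi>_def)
qed

end

theorem theorem2:
  fixes M :: "'w measure" and q :: "'x measure"
    and \<nu> :: real and h :: "real \<Rightarrow> 'x \<Rightarrow> real"
    and \<tau> :: "nat \<Rightarrow> 'w \<Rightarrow> real" and a :: "nat \<Rightarrow> 'w \<Rightarrow> 'x"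
  assumes hawkes: "marked_hawkes M q \<nu> h \<tau> a"
    and tail: "((\<lambda>t. sqrt t * (LINT s:{t..}|lborel. prob_space.expectation q (\<lambda>x. h s x))) \<longlongrightarrow> 0) at_top"
    and subcritical: "prob_space.expectation q (total_excitation h) < 1"
    and finite_variance: "integrable q (\<lambda>x. (total_excitation h x)\<^sup>2)"
  shows "weak_conv_m_at_top
    (\<lambda>t. distr M borel (\<lambda>\<omega>.
      (real (num_points \<tau> 0 t \<omega>) - \<nu> * t / (1 - prob_space.expectation q (total_excitation h))) / sqrt t))
    (density lborel (normal_density 0
      (sqrt (\<nu> * (1 + prob_space.variance q (total_excitation h))
             / (1 - prob_space.expectation q (total_excitation h)) ^ 3))))"
proof -
  interpret marked_hawkes M q \<nu> h \<tau> a by (rule hawkes)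
  let ?H = "total_excitation h"
  have E: "mark.expectation ?H = mark.expectation kern_mass"
    by (rule Bochner_Integration.integral_cong) (auto simp: total_excitation_eq)
  have V: "mark.variance ?H = mark.variance kern_mass"
    unfolding E by (rule Bochner_Integration.integral_cong) (auto simp: total_excitation_eq)
  have sub: "mark.expectation kern_mass < 1" using subcritical by (simp add: E)
  have sq: "integrable q (\<lambda>x. (kern_mass x)\<^sup>2)"
    using finite_variance
    by (rule Bochner_Integration.integrable_cong[THEN iffD1, rotated 2]) (auto simp: total_excitation_eq)
  have int: "integrable q kern_mass"
    by (rule mark.square_integrable_imp_integrable[OF _ sq]) simp
  have tail': "((\<lambda>t. sqrt t * mean_tail t) \<longlongrightarrow> 0) at_top"
  proof (rule Lim_transform_eventually[OF tail])
    show "eventually (\<lambda>t. sqrt t * (LINT s:{t..}|lborel. mark.expectation (\<lambda>x. h s x)) = sqrt t * mean_tail t) at_top"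
      using eventually_gt_at_top[of 0] by eventually_elim (simp add: mean_tail_eq[OF int])
  qed
  let ?s = "sqrt (\<nu> * (1 + mark.variance kern_mass) / (1 - mark.expectation kern_mass) ^ 3)"
  have s: "?s > 0"
    using base_rate_pos sub mark.variance_positive[of kern_mass]
    by (auto intro!: divide_pos_pos mult_pos_pos add_pos_nonneg)
  have cdf: "cdf (distr M borel (\<lambda>\<omega>. (real (num_points \<tau> 0 t \<omega>) - \<nu> * t / (1 - mark.expectation kern_mass)) / sqrt t)) x =
      prob {\<omega> \<in> space M. (real (num_points \<tau> 0 t \<omega>) - \<nu> * t / (1 - mark.expectation kern_mass)) / sqrt t \<le> x}" for t x
  proof -
    have [measurable]: "(\<lambda>\<omega>. real (num_points \<tau> 0 t \<omega>)) \<in> borel_measurable M"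
      using count_integrable by blast
    show ?thesis by (simp add: cdf_def measure_distr vimage_def Int_def conj_commute)
  qed
  show ?thesis
    unfolding E V[unfolded E] weak_conv_m_at_top_def cdf cdf_scaled_normal[OF s]
    by (intro allI impI asymptotic_normality[OF sq sub tail'])
qed

end
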